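(* Let $m\ge 4$ and let $\theta$ be an inner automorphism of $\mathfrak g=\mathfrak{gl}(\mathbb V)$ of order $m$ with multiplicities vector $\hat r=(r_0,\dots,r_{m-1})$. Suppose that either $\mathrm{rank}(G_0,\mathfrak g_1)>1$, or $\mathrm{rank}(G_0,\mathfrak g_1)=1$ and there are three consecutive entries $(r_i,r_{i+1},r_{i+2})=(a,b,c)$ of $\hat r$ (indices modulo $m$) with $a,b,c\ge 2$. Then the $\theta$-representation of $G_0$ on $\mathfrak g_1$ does not have GIB.
   Context: $\mathbb F$ is an algebraically closed field of characteristic zero. For a Lie algebra $\mathfrak q$ and a finite-dimensional $\mathfrak q$-module $V$, the index is $\mathrm{ind}(\mathfrak q,V)=\dim V-\max_{\xi\in V^*}\dim(\mathfrak q\cdot\xi)$. Let $Q$ be an algebraic group with $\mathfrak q=\mathrm{Lie}\,Q$ and $V$ a finite-dimensional $Q$-module; $\mathfrak q_v=\{x\in\mathfrak q\mid x\cdot v=0\}$. The pair $(Q,V)$ has GIB (good index behaviour) if $\mathrm{ind}(\mathfrak q,V^* )=\mathrm{ind}(\mathfrak q_v,(V/\mathfrak q\cdot v)^* )$ for every $v\in V$. Inner automorphisms of $\mathfrak g=\mathfrak{gl}(\mathbb V)$, where $\mathbb V$ is a finite-dimensional vector space over $\mathbb F$: fix a primitive $m$-th root of unity $\zeta$. A vector $\hat r=(r_0,\dots,r_{m-1})$ of non-negative integers with $\sum r_t=\dim\mathbb V$ (the multiplicities vector) defines the inner automorphism $\theta$ of $\mathfrak g$ given by conjugation by the diagonalisable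 element of $\mathrm{GL}(\mathbb V)$ that acts as $\zeta^t$ on $\mathbb V_t$, where $\mathbb V=\bigoplus_t\mathbb V_t$ and $\dim\mathbb V_t=r_t$. Cyclic permutations of the entries of $\hat r$ define the same automorphism. Let $\mathfrak g=\bigoplus_{i\in\mathbb Z/m\mathbb Z}\mathfrak g_i$ be the corresponding grading, $\mathfrak g_i$ being the $\zeta^i$-eigenspace of $\theta$; then $\mathfrak g_1=\bigoplus_{i}\mathrm{Hom}(\mathbb V_i,\mathbb V_{i+1})$ (indices modulo $m$), and $G_0=\mathrm{GL}(\mathbb V_0)\times\dots\times\mathrm{GL}(\mathbb V_{m-1})$ acts on $\mathfrak g_1$ by restriction of the adjoint action (this is the $\theta$-representation). The number $\mathrm{rank}(G_0,\mathfrak g_1)$ is the dimension of a maximal subspace of $\mathfrak g_1$ consisting of pairwise commuting semisimple elements; it is known to equal $\min_i r_i$. *)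

theory Defs
  imports
    "HOL-Computational_Algebra.Computational_Algebra"
    "HOL-Algebra.Bij"
    "HOL-Algebra.Multiplicative_Group"
    "Jordan_Normal_Form.VS_Connect"
begin

section \<open>Spaces of linear maps, duals and quotients\<close>

text \<open>
  Vector spaces over a field given by a type class are \<open>module\<close> records satisfying
  \<open>vectorspace class_ring\<close>. Linear maps are extensional functions, so that equality of
  linear maps is equality on the carrier. The ring multiplication and unit that every
  \<open>module\<close> record carries play no role and are left unspecified.
\<close>

abbreviation vdim :: "('a::field, 'v, 'e) module_scheme \<Rightarrow> nat"
  where "vdim V \<equiv> vectorspace.dim class_ring V"

definition hom_space ::
  "('a::field, 'v, 'e) module_scheme \<Rightarrow> ('a, 'w, 'f) module_scheme \<Rightarrow> ('a, 'v \<Rightarrow> 'w) module"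
  where
  "hom_space V W =
    \<lparr>carrier = module_hom class_ring V W \<inter> extensional (carrier V),
     mult = undefined, one = undefined,
     zero = (\<lambda>v\<in>carrier V. \<zero>\<^bsub>W\<^esub>),
     add = (\<lambda>f g. \<lambda>v\<in>carrier V. f v \<oplus>\<^bsub>W\<^esub> g v),
     smult = (\<lambda>c f. \<lambda>v\<in>carrier V. c \<odot>\<^bsub>W\<^esub> f v)\<rparr>"

definition field_space :: "('a::field, 'a) module"
  where
  "field_space =
    \<lparr>carrier = UNIV, mult = (*), one = 1, zero = 0, add = (+), smult = (*)\<rparr>"

definition dual_space :: "('a::field, 'v, 'e) module_scheme \<Rightarrow> ('a, 'v \<Rightarrow> 'a) module"
  where "dual_space V = hom_space V field_space"

text \<open>The quotient \<open>V / U\<close> consists of the cosets \<open>U + v\<close>.\<close>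

definition quot_space ::
  "('a::field, 'v, 'e) module_scheme \<Rightarrow> 'v set \<Rightarrow> ('a, 'v set) module"
  where
  "quot_space V U =
    \<lparr>carrier = a_rcosets\<^bsub>V\<^esub> U,
     mult = undefined, one = undefined,
     zero = U,
     add = (\<lambda>X Y. X <+>\<^bsub>V\<^esub> Y),
     smult = (\<lambda>c X. \<Union>v\<in>X. U +>\<^bsub>V\<^esub> (c \<odot>\<^bsub>V\<^esub> v))\<rparr>"


section \<open>Lie algebras and their modules\<close>

record ('a, 'q) lie_alg = "('a, 'q) module" +
  lie_bracket :: "'q \<Rightarrow> 'q \<Rightarrow> 'q"

locale lie_algebra =
  fixes L :: "('a::field, 'q, 'e) lie_alg_scheme" (structure)
  assumes vectorspace_L: "vectorspace class_ring L"
    and bracket_closed: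
      "\<lbrakk>x \<in> carrier L; y \<in> carrier L\<rbrakk> \<Longrightarrow> lie_bracket L x y \<in> carrier L"
    and bracket_add_left:
      "\<lbrakk>x \<in> carrier L; y \<in> carrier L; z \<in> carrier L\<rbrakk> \<Longrightarrow>
        lie_bracket L (x \<oplus> y) z = lie_bracket L x z \<oplus> lie_bracket L y z"
    and bracket_add_right:
      "\<lbrakk>x \<in> carrier L; y \<in> carrier L; z \<in> carrier L\<rbrakk> \<Longrightarrow>
        lie_bracket L x (y \<oplus> z) = lie_bracket L x y \<oplus> lie_bracket L x z"
    and bracket_smult_left:
      "\<lbrakk>x \<in> carrier L; y \<in> carrier L\<rbrakk> \<Longrightarrow>
        lie_bracket L (c \<odot>\<^bsub>L\<^esub> x) y = c \<odot>\<^bsub>L\<^esub> lie_bracket L x y"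
    and bracket_smult_right:
      "\<lbrakk>x \<in> carrier L; y \<in> carrier L\<rbrakk> \<Longrightarrow>
        lie_bracket L x (c \<odot>\<^bsub>L\<^esub> y) = c \<odot>\<^bsub>L\<^esub> lie_bracket L x y"
    and bracket_self: "x \<in> carrier L \<Longrightarrow> lie_bracket L x x = \<zero>"
    and jacobi:
      "\<lbrakk>x \<in> carrier L; y \<in> carrier L; z \<in> carrier L\<rbrakk> \<Longrightarrow>
        lie_bracket L x (lie_bracket L y z) \<oplus> lie_bracket L y (lie_bracket L z x)
          \<oplus> lie_bracket L z (lie_bracket L x y) = \<zero>"

locale lie_module = lie_algebra L
  for L :: "('a::field, 'q, 'e) lie_alg_scheme" (structure) +
  fixes V :: "('a, 'v, 'f) module_scheme"
    and act :: "'q \<Rightarrow> 'v \<Rightarrow> 'v"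
  assumes vectorspace_V: "vectorspace class_ring V"
    and act_closed: "\<lbrakk>x \<in> carrier L; v \<in> carrier V\<rbrakk> \<Longrightarrow> act x v \<in> carrier V"
    and act_add_left:
      "\<lbrakk>x \<in> carrier L; y \<in> carrier L; v \<in> carrier V\<rbrakk> \<Longrightarrow>
        act (x \<oplus> y) v = act x v \<oplus>\<^bsub>V\<^esub> act y v"
    and act_add_right:
      "\<lbrakk>x \<in> carrier L; v \<in> carrier V; w \<in> carrier V\<rbrakk> \<Longrightarrow>
        act x (v \<oplus>\<^bsub>V\<^esub> w) = act x v \<oplus>\<^bsub>V\<^esub> act x w"
    and act_smult_left:
      "\<lbrakk>x \<in> carrier L; v \<in> carrier V\<rbrakk> \<Longrightarrow> act (c \<odot>\<^bsub>L\<^esub> x) v = c \<odot>\<^bsub>V\<^esub> act x v"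
    and act_smult_right:
      "\<lbrakk>x \<in> carrier L; v \<in> carrier V\<rbrakk> \<Longrightarrow> act x (c \<odot>\<^bsub>V\<^esub> v) = c \<odot>\<^bsub>V\<^esub> act x v"
    and act_bracket:
      "\<lbrakk>x \<in> carrier L; y \<in> carrier L; v \<in> carrier V\<rbrakk> \<Longrightarrow>
        act (lie_bracket L x y) v = act x (act y v) \<ominus>\<^bsub>V\<^esub> act y (act x v)"

text \<open>The tangent space \<open>L \<cdot> v\<close> of the orbit of \<open>v\<close>, and the stabiliser \<open>L\<^sub>v\<close>.\<close>

definition lie_orbit ::
  "('a::field, 'q, 'e) lie_alg_scheme \<Rightarrow> ('q \<Rightarrow> 'v \<Rightarrow> 'v) \<Rightarrow> 'v \<Rightarrow> 'v set"
  where "lie_orbit L act v = (\<lambda>x. act x v) ` carrier L"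

definition lie_stabiliser ::
  "('a::field, 'q, 'e) lie_alg_scheme \<Rightarrow> ('a, 'v, 'f) module_scheme \<Rightarrow>
    ('q \<Rightarrow> 'v \<Rightarrow> 'v) \<Rightarrow> 'v \<Rightarrow> ('a, 'q, 'e) lie_alg_scheme"
  where
  "lie_stabiliser L V act v = L\<lparr>carrier := {x \<in> carrier L. act x v = \<zero>\<^bsub>V\<^esub>}\<rparr>"

definition dual_action ::
  "('a::field, 'v, 'f) module_scheme \<Rightarrow> ('q \<Rightarrow> 'v \<Rightarrow> 'v) \<Rightarrow> 'q \<Rightarrow> ('v \<Rightarrow> 'a) \<Rightarrow> ('v \<Rightarrow> 'a)"
  where "dual_action V act x \<xi> = (\<lambda>v\<in>carrier V. - \<xi> (act x v))"

definition quot_action ::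
  "('a::field, 'v, 'f) module_scheme \<Rightarrow> 'v set \<Rightarrow> ('q \<Rightarrow> 'v \<Rightarrow> 'v) \<Rightarrow> 'q \<Rightarrow> 'v set \<Rightarrow> 'v set"
  where "quot_action V U act x X = (\<Union>v\<in>X. U +>\<^bsub>V\<^esub> act x v)"

definition lie_index ::
  "('a::field, 'q, 'e) lie_alg_scheme \<Rightarrow> ('a, 'v, 'f) module_scheme \<Rightarrow>
    ('q \<Rightarrow> 'v \<Rightarrow> 'v) \<Rightarrow> int"
  where
  "lie_index L V act =
    int (vdim V) -
    int (MAX \<xi>\<in>carrier (dual_space V).
      vdim ((dual_space V)\<lparr>carrier := lie_orbit L (dual_action V act) \<xi>\<rparr>))"

text \<open>
  Good index behaviour of a pair \<open>(Q, V)\<close> depends only on \<open>V\<close> as a module over the Lie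
  algebra \<open>L\<close> of \<open>Q\<close>. By invariance of \<open>L \<cdot> v\<close> under \<open>L\<^sub>v\<close>, the action descends to
  the quotient \<open>V / L \<cdot> v\<close>.
\<close>

definition has_GIB ::
  "('a::field, 'q, 'e) lie_alg_scheme \<Rightarrow> ('a, 'v, 'f) module_scheme \<Rightarrow>
    ('q \<Rightarrow> 'v \<Rightarrow> 'v) \<Rightarrow> bool"
  where
  "has_GIB L V act \<longleftrightarrow>
    (\<forall>v\<in>carrier V.
      lie_index L (dual_space V) (dual_action V act) =
      (let U = lie_orbit L act v; W = quot_space V U in
        lie_index (lie_stabiliser L V act v) (dual_space W)
          (dual_action W (quot_action V U act))))"


section \<open>Inner automorphisms of \<open>gl(V)\<close> and their gradings\<close>

definition gl :: "('a::field, 'v, 'e) module_scheme \<Rightarrow> ('a, 'v \<Rightarrow> 'v) lie_alg"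
  where
  "gl V =
    \<lparr>carrier = carrier (hom_space V V),
     mult = undefined, one = undefined,
     zero = zero (hom_space V V),
     add = add (hom_space V V),
     smult = smult (hom_space V V),
     lie_bracket = (\<lambda>f g. \<lambda>v\<in>carrier V. f (g v) \<ominus>\<^bsub>V\<^esub> g (f v))\<rparr>"

definition GL :: "('a::field, 'v, 'e) module_scheme \<Rightarrow> ('v \<Rightarrow> 'v) set"
  where "GL V = {s \<in> carrier (gl V). bij_betw s (carrier V) (carrier V)}"

definition GL_conj ::
  "('a::field, 'v, 'e) module_scheme \<Rightarrow> ('v \<Rightarrow> 'v) \<Rightarrow> ('v \<Rightarrow> 'v) \<Rightarrow> ('v \<Rightarrow> 'v)"
  where
  "GL_conj V s =
    (\<lambda>f\<in>carrier (gl V). \<lambda>v\<in>carrier V. s (f (inv_into (carrier V) s v)))"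

definition primitive_root_of_unity :: "nat \<Rightarrow> 'a::field \<Rightarrow> bool"
  where
  "primitive_root_of_unity m \<zeta> \<longleftrightarrow>
    m > 0 \<and> \<zeta> ^ m = 1 \<and> (\<forall>k. 0 < k \<and> k < m \<longrightarrow> \<zeta> ^ k \<noteq> 1)"

definition internal_direct_sum ::
  "('a::field, 'v, 'e) module_scheme \<Rightarrow> 'i set \<Rightarrow> ('i \<Rightarrow> 'v set) \<Rightarrow> bool"
  where
  "internal_direct_sum V I W \<longleftrightarrow>
    (\<forall>t\<in>I. VectorSpace.subspace class_ring (W t) V) \<and>
    (\<forall>v\<in>carrier V. \<exists>!u. u \<in> (\<Pi>\<^sub>E t\<in>I. W t) \<and> v = (\<Oplus>\<^bsub>V\<^esub>t\<in>I. u t))"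

text \<open>
  \<open>\<theta>\<close> is conjugation by an element of \<open>GL(V)\<close> acting as \<open>\<zeta> ^ t\<close> on \<open>W t\<close>, where
  \<open>V\<close> is the direct sum of the \<open>W t\<close> for \<open>t < m\<close> and \<open>W t\<close> has dimension \<open>r t\<close>.
  The entries \<open>r t\<close> with \<open>t \<ge> m\<close> are irrelevant.
\<close>

definition has_multiplicities ::
  "('a::field, 'v, 'e) module_scheme \<Rightarrow> nat \<Rightarrow> 'a \<Rightarrow> (nat \<Rightarrow> nat) \<Rightarrow>
    (('v \<Rightarrow> 'v) \<Rightarrow> ('v \<Rightarrow> 'v)) \<Rightarrow> bool"
  where
  "has_multiplicities V m \<zeta> r \<theta> \<longleftrightarrow>
    (\<exists>W. \<exists>s\<in>GL V.
      internal_direct_sum V {..<m} W \<and>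
      (\<forall>t<m. vdim (V\<lparr>carrier := W t\<rparr>) = r t) \<and>
      (\<forall>t<m. \<forall>v\<in>W t. s v = (\<zeta> ^ t) \<odot>\<^bsub>V\<^esub> v) \<and>
      \<theta> = GL_conj V s)"

text \<open>The summand \<open>g\<^sub>i\<close> of \<open>gl(V)\<close>, i.e. the \<open>\<zeta> ^ i\<close>-eigenspace of \<open>\<theta>\<close>.\<close>

definition graded_part ::
  "('a::field, 'v, 'e) module_scheme \<Rightarrow> 'a \<Rightarrow> (('v \<Rightarrow> 'v) \<Rightarrow> ('v \<Rightarrow> 'v)) \<Rightarrow> nat \<Rightarrow>
    ('a, 'v \<Rightarrow> 'v) lie_alg"
  where
  "graded_part V \<zeta> \<theta> i =
    (gl V)\<lparr>carrier := {f \<in> carrier (gl V). \<theta> f = (\<zeta> ^ i) \<odot>\<^bsub>gl V\<^esub> f}\<rparr>"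

text \<open>Over an algebraically closed field, semisimple means diagonalisable.\<close>

definition semisimple_endo :: "('a::field, 'v, 'e) module_scheme \<Rightarrow> ('v \<Rightarrow> 'v) \<Rightarrow> bool"
  where
  "semisimple_endo V f \<longleftrightarrow>
    (\<exists>B. vectorspace.basis class_ring V B \<and> (\<forall>b\<in>B. \<exists>c. f b = c \<odot>\<^bsub>V\<^esub> b))"

definition theta_rank ::
  "('a::field, 'v, 'e) module_scheme \<Rightarrow> 'a \<Rightarrow> (('v \<Rightarrow> 'v) \<Rightarrow> ('v \<Rightarrow> 'v)) \<Rightarrow> nat"
  where
  "theta_rank V \<zeta> \<theta> =
    Max {vdim ((gl V)\<lparr>carrier := C\<rparr>) | C.
      VectorSpace.subspace class_ring C (graded_part V \<zeta> \<theta> 1) \<and>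
      (\<forall>x\<in>C. \<forall>y\<in>C. lie_bracket (gl V) x y = \<zero>\<^bsub>gl V\<^esub>) \<and>
      (\<forall>x\<in>C. semisimple_endo V x)}"

text \<open>
  The \<open>\<theta>\<close>-representation: the group of fixed points \<open>G\<^sub>0 = \<Prod>\<^sub>t GL(W t)\<close> has Lie algebra
  \<open>g\<^sub>0\<close>, and the differential of its adjoint action on \<open>g\<^sub>1\<close> is the bracket of \<open>gl(V)\<close>.
\<close>

definition theta_rep_has_GIB ::
  "('a::field, 'v, 'e) module_scheme \<Rightarrow> 'a \<Rightarrow> (('v \<Rightarrow> 'v) \<Rightarrow> ('v \<Rightarrow> 'v)) \<Rightarrow> bool"
  where
  "theta_rep_has_GIB V \<zeta> \<theta> \<longleftrightarrow>
    has_GIB (graded_part V \<zeta> \<theta> 0) (graded_part V \<zeta> \<theta> 1) (lie_bracket (gl V))"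


section \<open>The constructions yield vector spaces, Lie algebras and Lie modules\<close>

lemma vectorspace_classI:
  fixes V :: "('a::field, 'v, 'e) module_scheme"
  assumes "abelian_group V"
    and "\<And>c x. x \<in> carrier V \<Longrightarrow> c \<odot>\<^bsub>V\<^esub> x \<in> carrier V"
    and "\<And>a b x. x \<in> carrier V \<Longrightarrow> (a + b) \<odot>\<^bsub>V\<^esub> x = a \<odot>\<^bsub>V\<^esub> x \<oplus>\<^bsub>V\<^esub> b \<odot>\<^bsub>V\<^esub> x"
    and "\<And>a x y. x \<in> carrier V \<Longrightarrow> y \<in> carrier V \<Longrightarrow>
      a \<odot>\<^bsub>V\<^esub> (x \<oplus>\<^bsub>V\<^esub> y) = a \<odot>\<^bsub>V\<^esub> x \<oplus>\<^bsub>V\<^esub> a \<odot>\<^bsub>V\<^esub> y"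
    and "\<And>a b x. x \<in> carrier V \<Longrightarrow> (a * b) \<odot>\<^bsub>V\<^esub> x = a \<odot>\<^bsub>V\<^esub> (b \<odot>\<^bsub>V\<^esub> x)"
    and "\<And>x. x \<in> carrier V \<Longrightarrow> 1 \<odot>\<^bsub>V\<^esub> x = x"
  shows "vectorspace class_ring V"
proof (rule vectorspace.intro)
  show "module class_ring V"
    by (rule moduleI) (use assms class_cring.is_cring in auto)
  show "field (class_ring :: 'a ring)" by (rule class_field)
qed

lemma vs_facts:
  fixes V :: "('a::field, 'v, 'e) module_scheme"
  assumes "vectorspace class_ring V"
  shows "abelian_group V"
    and "\<And>c x. x \<in> carrier V \<Longrightarrow> c \<odot>\<^bsub>V\<^esub> x \<in> carrier V"
    and "\<And>a b x. x \<in> carrier V \<Longrightarrow> (a + b) \<odot>\<^bsub>V\<^esub> x = a \<odot>\<^bsub>V\<^esub> x \<oplus>\<^bsub>V\<^esub> b \<odot>\<^bsub>V\<^esub> x"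
    and "\<And>a x y. x \<in> carrier V \<Longrightarrow> y \<in> carrier V \<Longrightarrow>
      a \<odot>\<^bsub>V\<^esub> (x \<oplus>\<^bsub>V\<^esub> y) = a \<odot>\<^bsub>V\<^esub> x \<oplus>\<^bsub>V\<^esub> a \<odot>\<^bsub>V\<^esub> y"
    and "\<And>a b x. x \<in> carrier V \<Longrightarrow> (a * b) \<odot>\<^bsub>V\<^esub> x = a \<odot>\<^bsub>V\<^esub> (b \<odot>\<^bsub>V\<^esub> x)"
    and "\<And>x. x \<in> carrier V \<Longrightarrow> 1 \<odot>\<^bsub>V\<^esub> x = x"
    and "\<And>c. c \<odot>\<^bsub>V\<^esub> \<zero>\<^bsub>V\<^esub> = \<zero>\<^bsub>V\<^esub>"
    and "\<And>x. x \<in> carrier V \<Longrightarrow> 0 \<odot>\<^bsub>V\<^esub> x = \<zero>\<^bsub>V\<^esub>"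
    and "\<And>x. x \<in> carrier V \<Longrightarrow> (-1) \<odot>\<^bsub>V\<^esub> x = \<ominus>\<^bsub>V\<^esub> x"
proof -
  interpret V: vectorspace class_ring V by fact
  show "abelian_group V" by (rule V.M.abelian_group_axioms)
  show "\<And>c x. x \<in> carrier V \<Longrightarrow> c \<odot>\<^bsub>V\<^esub> x \<in> carrier V" by simp
  show "\<And>a b x. x \<in> carrier V \<Longrightarrow> (a + b) \<odot>\<^bsub>V\<^esub> x = a \<odot>\<^bsub>V\<^esub> x \<oplus>\<^bsub>V\<^esub> b \<odot>\<^bsub>V\<^esub> x"
    using V.smult_l_distr by simp
  show "\<And>a x y. x \<in> carrier V \<Longrightarrow> y \<in> carrier V \<Longrightarrow>
      a \<odot>\<^bsub>V\<^esub> (x \<oplus>\<^bsub>V\<^esub> y) = a \<odot>\<^bsub>V\<^esub> x \<oplus>\<^bsub>V\<^esub> a \<odot>\<^bsub>V\<^esub> y"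
    using V.smult_r_distr by simp
  show "\<And>a b x. x \<in> carrier V \<Longrightarrow> (a * b) \<odot>\<^bsub>V\<^esub> x = a \<odot>\<^bsub>V\<^esub> (b \<odot>\<^bsub>V\<^esub> x)"
    using V.smult_assoc1 by simp
  show one: "\<And>x. x \<in> carrier V \<Longrightarrow> 1 \<odot>\<^bsub>V\<^esub> x = x" using V.smult_one by simp
  show "\<And>c. c \<odot>\<^bsub>V\<^esub> \<zero>\<^bsub>V\<^esub> = \<zero>\<^bsub>V\<^esub>" using V.smult_r_null by simp
  show "\<And>x. x \<in> carrier V \<Longrightarrow> 0 \<odot>\<^bsub>V\<^esub> x = \<zero>\<^bsub>V\<^esub>" using V.smult_l_null by simp
  show "\<And>x. x \<in> carrier V \<Longrightarrow> (-1) \<odot>\<^bsub>V\<^esub> x = \<ominus>\<^bsub>V\<^esub> x"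
  proof -
    fix x assume x: "x \<in> carrier V"
    show "(-1) \<odot>\<^bsub>V\<^esub> x = \<ominus>\<^bsub>V\<^esub> x"
      using V.smult_minus_1[OF x] by (simp add: class_ring_simps)
  qed
qed

lemma vectorspace_hom_space:
  assumes V: "vectorspace class_ring (V :: ('a::field, 'v, 'e) module_scheme)"
    and W: "vectorspace class_ring (W :: ('a, 'w, 'f) module_scheme)"
  shows "vectorspace class_ring (hom_space V W)"
proof -
  interpret A: abelian_group V using vs_facts(1)[OF V] .
  interpret B: abelian_group W using vs_facts(1)[OF W] .
  note [simp] = vs_facts(2-6)[OF V] vs_facts(2-9)[OF W] B.l_neg B.minus_add
  have comm: "a \<odot>\<^bsub>W\<^esub> (b \<odot>\<^bsub>W\<^esub> x) = b \<odot>\<^bsub>W\<^esub> (a \<odot>\<^bsub>W\<^esub> x)" if "x \<in> carrier W" for a b x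
    using vs_facts(5)[OF W that] by (metis mult.commute)
  have neg: "\<exists>g \<in> carrier (hom_space V W). g \<oplus>\<^bsub>hom_space V W\<^esub> f = \<zero>\<^bsub>hom_space V W\<^esub>"
    if f: "f \<in> carrier (hom_space V W)" for f
  proof (rule bexI)
    have fc: "f v \<in> carrier W" if "v \<in> carrier V" for v
      using f that by (auto simp: hom_space_def module_hom_def)
    show "(\<lambda>v\<in>carrier V. (-1) \<odot>\<^bsub>W\<^esub> f v) \<oplus>\<^bsub>hom_space V W\<^esub> f = \<zero>\<^bsub>hom_space V W\<^esub>"
      using fc by (auto simp: hom_space_def B.l_neg intro!: restrict_ext)
    show "(\<lambda>v\<in>carrier V. (-1) \<odot>\<^bsub>W\<^esub> f v) \<in> carrier (hom_space V W)"
      using f by (auto simp: hom_space_def module_hom_def Pi_def B.minus_add comm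
        simp del: vs_facts(9)[OF W])
  qed
  show ?thesis
    apply (rule vectorspace_classI)
    apply (rule abelian_groupI)
    using neg
    by (auto simp: hom_space_def module_hom_def Pi_def B.a_ac comm fun_eq_iff restrict_def extensional_def)
qed

lemma vectorspace_field_space: "vectorspace class_ring (field_space :: ('a::field,'a) module)"
  by (rule vectorspace_classI, rule abelian_groupI)
    (auto simp: field_space_def algebra_simps intro: exI[of _ "- x" for x])

lemma vectorspace_dual_space:
  "vectorspace class_ring V \<Longrightarrow> vectorspace class_ring (dual_space V)"
  by (simp add: dual_space_def vectorspace_hom_space vectorspace_field_space)

lemma vectorspace_quot_space:
  assumes U: "VectorSpace.subspace class_ring U (V :: ('a::field, 'v, 'e) module_scheme)"
  shows "vectorspace class_ring (quot_space V U)"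
    and "\<And>c v. v \<in> carrier V \<Longrightarrow>
      c \<odot>\<^bsub>quot_space V U\<^esub> (U +>\<^bsub>V\<^esub> v) = U +>\<^bsub>V\<^esub> (c \<odot>\<^bsub>V\<^esub> v)"
proof -
  have V: "vectorspace class_ring V" and sm: "submodule class_ring U V"
    using U by (auto simp: VectorSpace.subspace_def)
  interpret V: vectorspace class_ring V by fact
  note [simp] = vs_facts(2-6)[OF V]
  have sub: "U \<subseteq> carrier V" using sm submodule.subset by blast
  have clo: "c \<odot>\<^bsub>V\<^esub> u \<in> U" if "u \<in> U" for c u
    using submodule.smult_closed[OF sm, of c u] that by simp
  have nm: "(-1) \<odot>\<^bsub>V\<^esub> u = \<ominus>\<^bsub>V\<^esub> u" if "u \<in> U" for u
    using vs_facts(9)[OF V, of u] sub that by auto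
  have "additive_subgroup U V"
    apply (rule additive_subgroup.intro)
    apply (rule group.subgroupI[OF V.M.a_group])
    using sub submodule.zero_closed[OF sm] submodule.m_closed[OF sm] clo[of _ "-1"] nm
    by (auto simp: a_inv_def[symmetric])
  then have "abelian_subgroup U V"
    by (rule abelian_subgroupI3) (rule vs_facts(1)[OF V])
  then interpret U: abelian_subgroup U V .
  have sm': "(\<Union>w\<in>U +>\<^bsub>V\<^esub> v. U +>\<^bsub>V\<^esub> (c \<odot>\<^bsub>V\<^esub> w)) = U +>\<^bsub>V\<^esub> (c \<odot>\<^bsub>V\<^esub> v)"
    if v: "v \<in> carrier V" for c v
  proof -
    have "U +>\<^bsub>V\<^esub> (c \<odot>\<^bsub>V\<^esub> w) = U +>\<^bsub>V\<^esub> (c \<odot>\<^bsub>V\<^esub> v)" if w: "w \<in> U +>\<^bsub>V\<^esub> v" for w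
    proof -
      obtain u where u: "u \<in> U" "w = u \<oplus>\<^bsub>V\<^esub> v" using w by (auto simp: a_r_coset_def')
      then have "c \<odot>\<^bsub>V\<^esub> w = c \<odot>\<^bsub>V\<^esub> u \<oplus>\<^bsub>V\<^esub> c \<odot>\<^bsub>V\<^esub> v" using sub v by auto
      then have "c \<odot>\<^bsub>V\<^esub> w \<in> U +>\<^bsub>V\<^esub> (c \<odot>\<^bsub>V\<^esub> v)"
        using clo[OF u(1)] unfolding a_r_coset_def' by blast
      then show ?thesis
        by (rule V.M.a_repr_independence[symmetric])
          (use vs_facts(2)[OF V v] U.a_subgroup in blast)+
    qed
    moreover have "v \<in> U +>\<^bsub>V\<^esub> v" using v by (simp add: U.a_rcos_self)
    ultimately show ?thesis by blast
  qed
  then show scal: "\<And>c v. v \<in> carrier V \<Longrightarrow>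
      c \<odot>\<^bsub>quot_space V U\<^esub> (U +>\<^bsub>V\<^esub> v) = U +>\<^bsub>V\<^esub> (c \<odot>\<^bsub>V\<^esub> v)" 
    by (simp add: quot_space_def)
  have carr: "carrier (quot_space V U) = (\<lambda>v. U +>\<^bsub>V\<^esub> v) ` carrier V"
    by (auto simp: quot_space_def A_RCOSETS_def')
  have add: "(U +>\<^bsub>V\<^esub> v) \<oplus>\<^bsub>quot_space V U\<^esub> (U +>\<^bsub>V\<^esub> w) = U +>\<^bsub>V\<^esub> (v \<oplus>\<^bsub>V\<^esub> w)"
    if "v \<in> carrier V" "w \<in> carrier V" for v w
    using that by (simp add: quot_space_def U.a_rcos_sum)
  have zero: "\<zero>\<^bsub>quot_space V U\<^esub> = U +>\<^bsub>V\<^esub> \<zero>\<^bsub>V\<^esub>"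
    using sub by (simp add: quot_space_def V.M.a_coset_add_zero)
  have mem: "U +>\<^bsub>V\<^esub> v \<in> carrier (quot_space V U)" if "v \<in> carrier V" for v
    using that unfolding carr by blast
  have ag: "abelian_group (quot_space V U)"
  proof (rule abelian_groupI, goal_cases)
    case (1 x y) then show ?case unfolding carr by (elim imageE, hypsubst) (simp add: add)
  next
    case 2 show ?case unfolding carr zero by simp
  next
    case (3 x y z) then show ?case
      unfolding carr by (elim imageE, hypsubst) (simp add: add V.M.a_assoc)
  next
    case (4 x y) then show ?case
      unfolding carr by (elim imageE, hypsubst) (simp add: add V.M.a_comm)
  next
    case (5 x) then show ?case
      unfolding carr zero by (elim imageE, hypsubst) (simp add: add)
  next
    case (6 x)
    then obtain v where v: "v \<in> carrier V" "x = U +>\<^bsub>V\<^esub> v" unfolding carr by blast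
    have "(U +>\<^bsub>V\<^esub> (\<ominus>\<^bsub>V\<^esub> v)) \<oplus>\<^bsub>quot_space V U\<^esub> x = \<zero>\<^bsub>quot_space V U\<^esub>"
      unfolding v(2) zero using v(1) by (subst add) (simp_all add: V.M.l_neg)
    then show ?case using mem v(1) by (intro bexI) auto
  qed
  show "vectorspace class_ring (quot_space V U)"
    by (rule vectorspace_classI[OF ag]; unfold carr; elim imageE; hypsubst;
      simp only: add scal vs_facts(2)[OF V] V.M.add.m_closed; (rule imageI)?;
      simp add: vs_facts(2-6)[OF V])
qed

lemma lie_algebra_gl:
  assumes V: "vectorspace class_ring (V :: ('a::field, 'v, 'e) module_scheme)"
  shows "lie_algebra (gl V)"
proof -
  interpret V: vectorspace class_ring V by fact
  have eqs: "carrier (gl V) = carrier (hom_space V V)" "add (gl V) = add (hom_space V V)"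
    "zero (gl V) = zero (hom_space V V)" "smult (gl V) = smult (hom_space V V)"
    by (auto simp: gl_def)
  have vs: "vectorspace class_ring (gl V)"
  proof -
    note H = vs_facts[OF vectorspace_hom_space[OF V V]]
    interpret H: abelian_group "hom_space V V" by (rule H(1))
    show ?thesis
      by (rule vectorspace_classI, rule abelian_groupI; unfold eqs)
        (use H(2-6) H.l_neg in \<open>auto simp: H.a_ac intro: bexI[of _ "\<ominus>\<^bsub>hom_space V V\<^esub> x" for x]\<close>)
  qed
  have gc: "f \<in> carrier (gl V) \<longleftrightarrow> f \<in> extensional (carrier V) \<and> (\<forall>v\<in>carrier V. f v \<in> carrier V)
     \<and> (\<forall>v\<in>carrier V. \<forall>w\<in>carrier V. f (v \<oplus>\<^bsub>V\<^esub> w) = f v \<oplus>\<^bsub>V\<^esub> f w)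
     \<and> (\<forall>c. \<forall>v\<in>carrier V. f (c \<odot>\<^bsub>V\<^esub> v) = c \<odot>\<^bsub>V\<^esub> f v)" for f
    unfolding gl_def hom_space_def module_hom_def by auto
  have sub: "a \<ominus>\<^bsub>V\<^esub> b = a \<oplus>\<^bsub>V\<^esub> (-1) \<odot>\<^bsub>V\<^esub> b" if "b \<in> carrier V" for a b
    using vs_facts(9)[OF V that] by (simp add: a_minus_def)
  have br: "lie_bracket (gl V) f g = (\<lambda>v\<in>carrier V. f (g v) \<oplus>\<^bsub>V\<^esub> (-1) \<odot>\<^bsub>V\<^esub> g (f v))"
    if "f \<in> carrier (gl V)" "g \<in> carrier (gl V)" for f g
    using that by (auto simp: gl_def sub gc[unfolded gl_def, simplified] intro!: restrict_ext)
  note [simp] = vs_facts(2,4,6-8)[OF V] vs_facts(5)[OF V, symmetric]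
  have ext: "f = g" if "f \<in> extensional (carrier V)" "g \<in> extensional (carrier V)"
    "\<And>v. v \<in> carrier V \<Longrightarrow> f v = g v" for f g :: "'v \<Rightarrow> 'v"
    using that by (rule extensionalityI)
  have bc: "lie_bracket (gl V) f g \<in> carrier (gl V)"
    if "f \<in> carrier (gl V)" "g \<in> carrier (gl V)" for f g
    using that unfolding br[OF that] unfolding gc
    by (simp add: V.M.a_ac mult.commute)
  have canc: "a \<oplus>\<^bsub>V\<^esub> (-1) \<odot>\<^bsub>V\<^esub> a = \<zero>\<^bsub>V\<^esub>" if "a \<in> carrier V" for a
    using vs_facts(9)[OF V that] V.M.r_neg[OF that] by simp
  have ops: "f \<oplus>\<^bsub>gl V\<^esub> g = (\<lambda>v\<in>carrier V. f v \<oplus>\<^bsub>V\<^esub> g v)"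
    "c \<odot>\<^bsub>gl V\<^esub> f = (\<lambda>v\<in>carrier V. c \<odot>\<^bsub>V\<^esub> f v)"
    "\<zero>\<^bsub>gl V\<^esub> = (\<lambda>v\<in>carrier V. \<zero>\<^bsub>V\<^esub>)" for f g c
    by (simp_all add: gl_def hom_space_def)
  have opc: "f \<oplus>\<^bsub>gl V\<^esub> g \<in> carrier (gl V)" "c \<odot>\<^bsub>gl V\<^esub> f \<in> carrier (gl V)"
    if "f \<in> carrier (gl V)" "g \<in> carrier (gl V)" for f g c
    using vs_facts(1,2)[OF vs] that by (auto intro: abelian_groupE(1))
  have gD: "f v \<in> carrier V" "f (v \<oplus>\<^bsub>V\<^esub> w) = f v \<oplus>\<^bsub>V\<^esub> f w" "f (c \<odot>\<^bsub>V\<^esub> v) = c \<odot>\<^bsub>V\<^esub> f v"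
    if "f \<in> carrier (gl V)" "v \<in> carrier V" "w \<in> carrier V" for f v w c
    using that gc by auto
  show ?thesis
  proof (rule lie_algebra.intro, goal_cases)
    case 1 show ?case by (rule vs)
  next
    case (2 x y) then show ?case by (rule bc)
  next
    case (3 x y z)
    then show ?case
      by (subst (1 2 3) br; (intro opc bc)?) (auto simp: ops gD V.M.a_ac intro!: restrict_ext)
  next
    case (4 x y z)
    then show ?case
      by (subst (1 2 3) br; (intro opc bc)?) (auto simp: ops gD V.M.a_ac intro!: restrict_ext)
  next
    case (5 x y c)
    then show ?case
      by (subst (1 2) br; (intro opc bc)?) (auto simp: ops gD V.M.a_ac mult.commute intro!: restrict_ext)
  next
    case (6 x y c)
    then show ?case
      by (subst (1 2) br; (intro opc bc)?) (auto simp: ops gD V.M.a_ac mult.commute intro!: restrict_ext)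
  next
    case (7 x)
    then show ?case by (auto simp: br ops gD canc intro!: restrict_ext)
  next
    case (8 x y z)
    have cc: "a \<oplus>\<^bsub>V\<^esub> (-1) \<odot>\<^bsub>V\<^esub> b = (-1) \<odot>\<^bsub>V\<^esub> b \<oplus>\<^bsub>V\<^esub> a" if "a \<in> carrier V" "b \<in> carrier V" for a b
      using that by (simp add: V.M.a_comm)
    have br2: "lie_bracket (gl V) f (lie_bracket (gl V) g h) v =
        f (g (h v)) \<oplus>\<^bsub>V\<^esub> (-1) \<odot>\<^bsub>V\<^esub> f (h (g v)) \<oplus>\<^bsub>V\<^esub>
        ((-1) \<odot>\<^bsub>V\<^esub> g (h (f v)) \<oplus>\<^bsub>V\<^esub> h (g (f v)))"
      if "f \<in> carrier (gl V)" "g \<in> carrier (gl V)" "h \<in> carrier (gl V)" "v \<in> carrier V" for f g h v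
      unfolding br[OF that(1) bc[OF that(2,3)]] using that
      by (simp add: br[OF that(2,3)] gD)
    show ?case
      unfolding ops
    proof (rule restrict_ext)
      fix v assume "v \<in> carrier V"
      then show "((\<lambda>v\<in>carrier V. lie_bracket (gl V) x (lie_bracket (gl V) y z) v \<oplus>\<^bsub>V\<^esub>
          lie_bracket (gl V) y (lie_bracket (gl V) z x) v) v) \<oplus>\<^bsub>V\<^esub>
          lie_bracket (gl V) z (lie_bracket (gl V) x y) v = \<zero>\<^bsub>V\<^esub>"
        using 8 canc[of "x (y (z v)) \<oplus>\<^bsub>V\<^esub> x (z (y v)) \<oplus>\<^bsub>V\<^esub> y (x (z v)) \<oplus>\<^bsub>V\<^esub>
            y (z (x v)) \<oplus>\<^bsub>V\<^esub> z (x (y v)) \<oplus>\<^bsub>V\<^esub> z (y (x v))"]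
        by (simp add: br2 gD V.M.a_ac)
    qed
  qed
qed

lemma restrict_carrier_lie_module:
  assumes "lie_algebra (L :: ('a::field, 'q, 'e) lie_alg_scheme)"
    and "VectorSpace.subspace class_ring A L" "VectorSpace.subspace class_ring B L"
    and AA: "\<And>x y. x \<in> A \<Longrightarrow> y \<in> A \<Longrightarrow> lie_bracket L x y \<in> A"
    and AB: "\<And>x y. x \<in> A \<Longrightarrow> y \<in> B \<Longrightarrow> lie_bracket L x y \<in> B"
  shows "lie_module (L\<lparr>carrier := A\<rparr>) (L\<lparr>carrier := B\<rparr>) (lie_bracket L)"
proof -
  interpret L: lie_algebra L by fact
  interpret V: vectorspace class_ring L by (rule L.vectorspace_L)
  have sub: "A \<subseteq> carrier L" "B \<subseteq> carrier L" 
    using assms(2,3) submodule.subset by (fastforce simp: VectorSpace.subspace_def)+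
  then have AI: "x \<in> A \<Longrightarrow> x \<in> carrier L" "x \<in> B \<Longrightarrow> x \<in> carrier L" for x by auto
  have vA: "vectorspace class_ring (L\<lparr>carrier := A\<rparr>)" "vectorspace class_ring (L\<lparr>carrier := B\<rparr>)"
    using assms(2,3) V.subspace_is_vs by blast+
  have minus: "x \<ominus>\<^bsub>L\<lparr>carrier := B\<rparr>\<^esub> y = x \<ominus>\<^bsub>L\<^esub> y" if "x \<in> B" "y \<in> B" for x y
    using vs_facts(9)[OF vA(2), of y] vs_facts(9)[OF L.vectorspace_L, of y] that AI
    by (simp add: a_minus_def)
  have jac: "lie_bracket L (lie_bracket L x y) v = 
     lie_bracket L x (lie_bracket L y v) \<ominus>\<^bsub>L\<^esub> lie_bracket L y (lie_bracket L x v)"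
    if "x \<in> carrier L" "y \<in> carrier L" "v \<in> carrier L" for x y v
  proof -
    have anti: "lie_bracket L b a = \<ominus>\<^bsub>L\<^esub> lie_bracket L a b" if "a \<in> carrier L" "b \<in> carrier L" for a b
    proof -
      have "lie_bracket L (a \<oplus>\<^bsub>L\<^esub> b) (a \<oplus>\<^bsub>L\<^esub> b) = \<zero>\<^bsub>L\<^esub>" using that by (intro L.bracket_self) auto
      moreover have "lie_bracket L (a \<oplus>\<^bsub>L\<^esub> b) (a \<oplus>\<^bsub>L\<^esub> b) =
        lie_bracket L a a \<oplus>\<^bsub>L\<^esub> lie_bracket L b a \<oplus>\<^bsub>L\<^esub> (lie_bracket L a b \<oplus>\<^bsub>L\<^esub> lie_bracket L b b)"
        using that by (simp only: L.bracket_add_left L.bracket_add_right V.M.a_closed)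
      ultimately have "lie_bracket L b a \<oplus>\<^bsub>L\<^esub> lie_bracket L a b = \<zero>\<^bsub>L\<^esub>"
        using that by (simp add: L.bracket_self L.bracket_closed V.M.a_comm)
      then show ?thesis using that by (simp add: L.bracket_closed V.M.minus_equality)
    qed
    define a where "a = lie_bracket L x (lie_bracket L y v)"
    define b where "b = lie_bracket L y (lie_bracket L x v)"
    define c where "c = lie_bracket L (lie_bracket L x y) v"
    have cl: "a \<in> carrier L" "b \<in> carrier L" "c \<in> carrier L"
      using that by (auto simp: a_def b_def c_def L.bracket_closed)
    have n: "lie_bracket L y (\<ominus>\<^bsub>L\<^esub> z) = \<ominus>\<^bsub>L\<^esub> lie_bracket L y z" if "z \<in> carrier L" for z
      using vs_facts(9)[OF L.vectorspace_L] L.bracket_smult_right[of y z "-1"] that \<open>y \<in> carrier L\<close>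
      by (metis L.bracket_closed)
    have "a \<oplus>\<^bsub>L\<^esub> \<ominus>\<^bsub>L\<^esub> b \<oplus>\<^bsub>L\<^esub> \<ominus>\<^bsub>L\<^esub> c = \<zero>\<^bsub>L\<^esub>"
      using L.jacobi[OF that] anti[of x v] anti[of "lie_bracket L x y" v] that n
      by (simp add: a_def b_def c_def L.bracket_closed)
    then have "c = a \<oplus>\<^bsub>L\<^esub> \<ominus>\<^bsub>L\<^esub> b"
      using cl by (metis V.M.a_closed V.M.a_inv_closed V.M.minus_equality V.M.minus_minus)
    then show ?thesis by (simp add: a_def b_def c_def a_minus_def)
  qed
  have la: "lie_algebra (L\<lparr>carrier := A\<rparr>)"
    by (rule lie_algebra.intro)
     (use vA AA in \<open>auto simp: AI L.bracket_add_left L.bracket_add_right L.bracket_smult_left L.bracket_smult_right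
       L.bracket_self L.jacobi\<close>)
  show ?thesis
    by (rule lie_module.intro[OF la], rule lie_module_axioms.intro)
      (use vA AB in \<open>auto simp: AI L.bracket_add_left L.bracket_add_right L.bracket_smult_left L.bracket_smult_right
       jac minus\<close>)
qed

lemma lie_module_dual:
  assumes "lie_module (L :: ('a::field, 'q, 'e) lie_alg_scheme) (V :: ('a, 'v, 'f) module_scheme) act"
  shows "lie_module L (dual_space V) (dual_action V act)"
proof -
  interpret lie_module L V act by fact
  interpret V: vectorspace class_ring V by (rule vectorspace_V)
  interpret L: vectorspace class_ring L by (rule vectorspace_L)
  have dc: "f \<in> carrier (dual_space V) \<longleftrightarrow> f \<in> extensional (carrier V)
     \<and> (\<forall>v\<in>carrier V. \<forall>w\<in>carrier V. f (v \<oplus>\<^bsub>V\<^esub> w) = f v + f w)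
     \<and> (\<forall>c. \<forall>v\<in>carrier V. f (c \<odot>\<^bsub>V\<^esub> v) = c * f v)" for f
    unfolding dual_space_def hom_space_def module_hom_def field_space_def by auto
  have ops: "f \<oplus>\<^bsub>dual_space V\<^esub> g = (\<lambda>v\<in>carrier V. f v + g v)"
    "c \<odot>\<^bsub>dual_space V\<^esub> f = (\<lambda>v\<in>carrier V. c * f v)" for f g c
    by (simp_all add: dual_space_def hom_space_def field_space_def)
  have vd: "vectorspace class_ring (dual_space V)" by (rule vectorspace_dual_space[OF vectorspace_V])
  have dD: "f (v \<oplus>\<^bsub>V\<^esub> w) = f v + f w" "f (c \<odot>\<^bsub>V\<^esub> v) = c * f v"
    if "f \<in> carrier (dual_space V)" "v \<in> carrier V" "w \<in> carrier V" for f v w c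
    using that dc by auto
  have ac: "dual_action V act x f \<in> carrier (dual_space V)"
    if "x \<in> carrier L" "f \<in> carrier (dual_space V)" for x f
    using that(1) unfolding dc dual_action_def
    by (auto simp: act_add_right act_smult_right act_closed dD[OF that(2)] vs_facts(2)[OF vectorspace_V])
  have minus: "f \<ominus>\<^bsub>dual_space V\<^esub> g = (\<lambda>v\<in>carrier V. f v - g v)"
    if "g \<in> carrier (dual_space V)" for f g
    using vs_facts(9)[OF vd that] by (auto simp: a_minus_def ops simp flip: vs_facts(9)[OF vd that] intro!: restrict_ext)
  have aminus: "f (v \<ominus>\<^bsub>V\<^esub> w) = f v - f w" 
    if "f \<in> carrier (dual_space V)" "v \<in> carrier V" "w \<in> carrier V" for f v w
    using vs_facts(9)[OF vectorspace_V that(3)] vs_facts(2)[OF vectorspace_V that(3), of "-1"]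
      dD(2)[OF that(1,3,3), of "-1"] dD(1)[OF that(1,2), of "(-1) \<odot>\<^bsub>V\<^esub> w"] by (simp add: a_minus_def)
  show ?thesis
  proof (intro_locales, rule lie_module_axioms.intro, goal_cases)
    case 1 show ?case by (rule vd)
  next
    case (2 x v) then show ?case by (rule ac)
  next
    case (3 x y f) then show ?case
      by (auto simp: dual_action_def ops act_add_left dD act_closed intro!: restrict_ext)
  next
    case (4 x f g) then show ?case
      by (auto simp: dual_action_def ops act_closed intro!: restrict_ext)
  next
    case (5 x f c) then show ?case
      by (auto simp: dual_action_def ops act_closed act_smult_left dD intro!: restrict_ext)
  next
    case (6 x f c) then show ?case
      by (auto simp: dual_action_def ops act_closed intro!: restrict_ext)
  next
    case (7 x y f)
    show ?case
      using 7 unfolding minus[OF ac[OF 7(2) ac[OF 7(1,3)]]]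
      by (auto simp: dual_action_def act_closed act_bracket aminus intro!: restrict_ext)
  qed
qed

lemma lie_module_quot:
  assumes "lie_module (L :: ('a::field, 'q, 'e) lie_alg_scheme) (V :: ('a, 'v, 'f) module_scheme) act"
    and v: "v \<in> carrier V"
  shows "lie_module (lie_stabiliser L V act v) (quot_space V (lie_orbit L act v))
    (quot_action V (lie_orbit L act v) act)"
proof -
  interpret lie_module L V act by fact
  interpret V: vectorspace class_ring V by (rule vectorspace_V)
  interpret L: vectorspace class_ring L by (rule vectorspace_L)
  define U where "U = lie_orbit L act v"
  define S where "S = {x \<in> carrier L. act x v = \<zero>\<^bsub>V\<^esub>}"
  have act0: "act \<zero>\<^bsub>L\<^esub> w = \<zero>\<^bsub>V\<^esub>" "act x \<zero>\<^bsub>V\<^esub> = \<zero>\<^bsub>V\<^esub>" if "w \<in> carrier V" "x \<in> carrier L" for x w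
    using act_smult_left[of "\<zero>\<^bsub>L\<^esub>" w 0] act_smult_right[of x "\<zero>\<^bsub>V\<^esub>" 0] that act_closed
    by (simp_all add: vs_facts(7,8)[OF vectorspace_V] vs_facts(7,8)[OF vectorspace_L])
  have act0v: "act \<zero>\<^bsub>L\<^esub> v = \<zero>\<^bsub>V\<^esub>" by (rule act0(1)[OF v L.M.zero_closed])
  have sub: "VectorSpace.subspace class_ring U V"
  proof -
    have "submodule class_ring U V"
    proof (rule submodule.intro, goal_cases)
      case 1 show ?case by (rule V.module_axioms)
    next
      case 2 show ?case using v by (auto simp: U_def lie_orbit_def act_closed)
    next
      case (3 x y) then show ?case
        using v by (auto simp: U_def lie_orbit_def act_add_left[symmetric])
    next
      case 4 show ?case unfolding U_def lie_orbit_def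
        by (rule image_eqI[of _ _ "\<zero>\<^bsub>L\<^esub>"]) (simp_all add: act0v)
    next
      case (5 c x) then show ?case
        using v by (auto simp: U_def lie_orbit_def act_smult_left[symmetric] vs_facts(2)[OF vectorspace_L])
    qed
    then show ?thesis using vectorspace_V by (simp add: VectorSpace.subspace_def)
  qed
  have subS: "VectorSpace.subspace class_ring S L"
  proof -
    have "submodule class_ring S L"
      by (rule submodule.intro)
        (use v in \<open>auto simp: S_def act_add_left act_smult_left act0v vs_facts(2)[OF vectorspace_L] vs_facts(7)[OF vectorspace_V] L.module_axioms\<close>)
    then show ?thesis using vectorspace_L by (simp add: VectorSpace.subspace_def)
  qed
  have Sb: "lie_bracket L x y \<in> S" if "x \<in> S" "y \<in> S" for x y
    using that v by (auto simp: S_def bracket_closed act_bracket act0 a_minus_def)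
  have la: "lie_algebra (L\<lparr>carrier := S\<rparr>)"
    using restrict_carrier_lie_module[OF lie_algebra_axioms subS subS Sb Sb] lie_module.axioms(1) by blast
  have UV: "U \<subseteq> carrier V" using v by (auto simp: U_def lie_orbit_def act_closed)
  have SL: "x \<in> S \<Longrightarrow> x \<in> carrier L" for x by (auto simp: S_def)
  have SU: "act x u \<in> U" if "x \<in> S" and uU: "u \<in> U" for x u
  proof -
    obtain y where y: "y \<in> carrier L" "u = act y v" using uU by (auto simp: U_def lie_orbit_def)
    have "act (lie_bracket L x y) v = act x u"
      using that(1) v y by (simp add: S_def act_bracket act0 a_minus_def act_closed)
    then show ?thesis using bracket_closed[OF SL[OF that(1)] y(1)] unfolding U_def lie_orbit_def
      by (metis image_eqI)
  qed
  have Usg: "subgroup U (add_monoid V)"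
  proof -
    have "act x v \<in> U" if "x \<in> carrier L" for x using that by (auto simp: U_def lie_orbit_def)
    moreover have "\<ominus>\<^bsub>V\<^esub> u \<in> U" if "u \<in> U" for u
      using submodule.smult_closed[of class_ring U V "-1" u] sub that UV vs_facts(9)[OF vectorspace_V, of u]
      by (auto simp: VectorSpace.subspace_def)
    ultimately show ?thesis
      using sub UV by (intro group.subgroupI V.M.a_group)
        (auto simp: VectorSpace.subspace_def a_inv_def[symmetric] intro: submodule.zero_closed submodule.m_closed)
  qed
  have qa: "quot_action V U act x (U +>\<^bsub>V\<^esub> w) = U +>\<^bsub>V\<^esub> act x w" if "x \<in> S" "w \<in> carrier V" for x w
  proof -
    have "U +>\<^bsub>V\<^esub> act x w' = U +>\<^bsub>V\<^esub> act x w" if w': "w' \<in> U +>\<^bsub>V\<^esub> w" for w'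
    proof -
      obtain u where u: "u \<in> U" "w' = u \<oplus>\<^bsub>V\<^esub> w" using w' by (auto simp: a_r_coset_def')
      have "act x w' = act x u \<oplus>\<^bsub>V\<^esub> act x w"
        using u \<open>x \<in> S\<close> \<open>w \<in> carrier V\<close> UV by (auto simp: act_add_right SL)
      then have "act x w' \<in> U +>\<^bsub>V\<^esub> act x w"
        using SU[OF \<open>x \<in> S\<close> u(1)] unfolding a_r_coset_def' by blast
      then show ?thesis
        by (rule V.M.a_repr_independence[symmetric, OF _ act_closed[OF SL[OF \<open>x \<in> S\<close>] \<open>w \<in> carrier V\<close>] Usg])
    qed
    moreover have "w \<in> U +>\<^bsub>V\<^esub> w"
      using that(2) submodule.zero_closed[of class_ring U V] sub
      by (force simp: a_r_coset_def' VectorSpace.subspace_def)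
    ultimately show ?thesis unfolding quot_action_def by blast
  qed
  note vq = vectorspace_quot_space[OF sub]
  have carr: "carrier (quot_space V U) = (\<lambda>w. U +>\<^bsub>V\<^esub> w) ` carrier V"
    by (auto simp: quot_space_def A_RCOSETS_def')
  have "abelian_subgroup U V"
    by (rule abelian_subgroupI3[OF additive_subgroup.intro[OF Usg] V.M.abelian_group_axioms])
  then interpret U: abelian_subgroup U V .
  have add: "(U +>\<^bsub>V\<^esub> x) \<oplus>\<^bsub>quot_space V U\<^esub> (U +>\<^bsub>V\<^esub> w) = U +>\<^bsub>V\<^esub> (x \<oplus>\<^bsub>V\<^esub> w)"
    if "x \<in> carrier V" "w \<in> carrier V" for x w
    using that by (simp add: quot_space_def U.a_rcos_sum)
  have min: "(U +>\<^bsub>V\<^esub> x) \<ominus>\<^bsub>quot_space V U\<^esub> (U +>\<^bsub>V\<^esub> w) = U +>\<^bsub>V\<^esub> (x \<ominus>\<^bsub>V\<^esub> w)"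
    if "x \<in> carrier V" "w \<in> carrier V" for x w
  proof -
    have "(U +>\<^bsub>V\<^esub> w) \<in> carrier (quot_space V U)" using that carr by auto
    from vs_facts(9)[OF vq(1) this] have "\<ominus>\<^bsub>quot_space V U\<^esub> (U +>\<^bsub>V\<^esub> w) = U +>\<^bsub>V\<^esub> (\<ominus>\<^bsub>V\<^esub> w)"
      using vq(2)[OF that(2), of "-1"] vs_facts(9)[OF vectorspace_V that(2)] by simp
    then show ?thesis using that by (simp add: a_minus_def add)
  qed
  note c2 = vs_facts(2)[OF vectorspace_V]
  have "lie_module (L\<lparr>carrier := S\<rparr>) (quot_space V U) (quot_action V U act)"
  proof (rule lie_module.intro[OF la], rule lie_module_axioms.intro, goal_cases)
    case 1 show ?case by (rule vq(1))
  next
    case (2 x w) then show ?case unfolding carr by (auto simp: qa SL act_closed)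
  next
    case (3 x y w) 
    then have "x \<oplus>\<^bsub>L\<^esub> y \<in> S" using subS by (auto simp: VectorSpace.subspace_def intro: submodule.m_closed)
    with 3 show ?case unfolding carr by (elim imageE, hypsubst) (simp add: qa add act_add_left SL act_closed)
  next
    case (4 x w z) then show ?case unfolding carr
      by (elim imageE, hypsubst) (simp add: qa add act_add_right SL act_closed)
  next
    case (5 x w c)
    then have "c \<odot>\<^bsub>L\<^esub> x \<in> S" using submodule.smult_closed[of class_ring S L c x] subS by (auto simp: VectorSpace.subspace_def)
    with 5 show ?case unfolding carr by (elim imageE, hypsubst) (simp add: qa vq(2) act_smult_left SL act_closed)
  next
    case (6 x w c) then show ?case unfolding carr
      by (elim imageE, hypsubst) (simp add: qa vq(2) c2 act_smult_right SL act_closed)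
  next
    case (7 x y w)
    then have "lie_bracket L x y \<in> S" using Sb by simp
    with 7 show ?case unfolding carr
      by (elim imageE, hypsubst) (simp add: qa min act_bracket SL act_closed)
  qed
  then show ?thesis by (simp add: lie_stabiliser_def S_def U_def)
qed

lemma lie_module_theta:
  assumes V: "vectorspace class_ring (V :: ('a::field, 'v, 'e) module_scheme)"
    and mult: "has_multiplicities V m \<zeta> r \<theta>"
  shows "lie_module (graded_part V \<zeta> \<theta> 0) (graded_part V \<zeta> \<theta> 1) (lie_bracket (gl V))"
proof -
  obtain s where s: "s \<in> GL V" and \<theta>: "\<theta> = GL_conj V s"
    using mult by (auto simp: has_multiplicities_def)
  interpret V: vectorspace class_ring V by fact
  have gc: "f \<in> carrier (gl V) \<longleftrightarrow> f \<in> extensional (carrier V) \<and> (\<forall>v\<in>carrier V. f v \<in> carrier V)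
     \<and> (\<forall>v\<in>carrier V. \<forall>w\<in>carrier V. f (v \<oplus>\<^bsub>V\<^esub> w) = f v \<oplus>\<^bsub>V\<^esub> f w)
     \<and> (\<forall>c. \<forall>v\<in>carrier V. f (c \<odot>\<^bsub>V\<^esub> v) = c \<odot>\<^bsub>V\<^esub> f v)" for f
    unfolding gl_def hom_space_def module_hom_def by auto
  interpret G: lie_algebra "gl V" by (rule lie_algebra_gl[OF V])
  interpret GV: vectorspace class_ring "gl V" by (rule G.vectorspace_L)
  have ops: "f \<oplus>\<^bsub>gl V\<^esub> g = (\<lambda>v\<in>carrier V. f v \<oplus>\<^bsub>V\<^esub> g v)"
    "c \<odot>\<^bsub>gl V\<^esub> f = (\<lambda>v\<in>carrier V. c \<odot>\<^bsub>V\<^esub> f v)"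
    "\<zero>\<^bsub>gl V\<^esub> = (\<lambda>v\<in>carrier V. \<zero>\<^bsub>V\<^esub>)"
    "lie_bracket (gl V) f g = (\<lambda>v\<in>carrier V. f (g v) \<ominus>\<^bsub>V\<^esub> g (f v))" for f g c
    by (simp_all add: gl_def hom_space_def)
  define t where "t = inv_into (carrier V) s"
  have bij: "bij_betw s (carrier V) (carrier V)" and sg: "s \<in> carrier (gl V)" using s by (auto simp: GL_def)
  have tc: "t v \<in> carrier V" if "v \<in> carrier V" for v
    using that bij inv_into_into[of v s "carrier V"] by (auto simp: t_def bij_betw_def)
  have ts: "t (s v) = v" if "v \<in> carrier V" for v
    using that bij by (simp add: t_def bij_betw_inv_into_left)
  have sD: "s v \<in> carrier V" "s (v \<oplus>\<^bsub>V\<^esub> w) = s v \<oplus>\<^bsub>V\<^esub> s w" "s (c \<odot>\<^bsub>V\<^esub> v) = c \<odot>\<^bsub>V\<^esub> s v"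
    if "v \<in> carrier V" "w \<in> carrier V" for v w c using sg that gc by auto
  have th: "\<theta> f = (\<lambda>v\<in>carrier V. s (f (t v)))" if "f \<in> carrier (gl V)" for f
    using that by (simp add: \<theta> GL_conj_def t_def)
  have fc: "f v \<in> carrier V" if "f \<in> carrier (gl V)" "v \<in> carrier V" for f v using that gc by auto
  have eig: "\<theta> f = c \<odot>\<^bsub>gl V\<^esub> f \<longleftrightarrow> (\<forall>v\<in>carrier V. s (f v) = c \<odot>\<^bsub>V\<^esub> f (s v))"
    if f: "f \<in> carrier (gl V)" for f c
  proof
    assume e: "\<theta> f = c \<odot>\<^bsub>gl V\<^esub> f"
    show "\<forall>v\<in>carrier V. s (f v) = c \<odot>\<^bsub>V\<^esub> f (s v)"
    proof
      fix v assume v: "v \<in> carrier V"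
      show "s (f v) = c \<odot>\<^bsub>V\<^esub> f (s v)"
        using fun_cong[OF e, of "s v"] sD(1)[OF v v] by (simp add: th[OF f] ops ts v)
    qed
  next
    assume e: "\<forall>v\<in>carrier V. s (f v) = c \<odot>\<^bsub>V\<^esub> f (s v)"
    have st: "s (t v) = v" if "v \<in> carrier V" for v
      using that bij by (simp add: t_def bij_betw_inv_into_right)
    show "\<theta> f = c \<odot>\<^bsub>gl V\<^esub> f"
      using e tc st by (auto simp: th[OF f] ops intro!: restrict_ext)
  qed
  define E where "E c = {f \<in> carrier (gl V). \<theta> f = c \<odot>\<^bsub>gl V\<^esub> f}" for c
  have E: "f \<in> E c \<longleftrightarrow> f \<in> carrier (gl V) \<and> (\<forall>v\<in>carrier V. s (f v) = c \<odot>\<^bsub>V\<^esub> f (s v))" for f c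
    using eig by (auto simp: E_def)
  note F = vs_facts[OF V]
  have comm: "a \<odot>\<^bsub>V\<^esub> (b \<odot>\<^bsub>V\<^esub> x) = b \<odot>\<^bsub>V\<^esub> (a \<odot>\<^bsub>V\<^esub> x)" if "x \<in> carrier V" for a b x
    using F(5)[OF that] by (metis mult.commute)
  have s0: "s \<zero>\<^bsub>V\<^esub> = \<zero>\<^bsub>V\<^esub>" using sD(3)[of "\<zero>\<^bsub>V\<^esub>" "\<zero>\<^bsub>V\<^esub>" 0] F(8)[OF sD(1)[of "\<zero>\<^bsub>V\<^esub>" "\<zero>\<^bsub>V\<^esub>"]] F(7) by simp
  have subE: "VectorSpace.subspace class_ring (E c) (gl V)" for c
  proof -
    have "submodule class_ring (E c) (gl V)"
    proof (rule submodule.intro, goal_cases)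
      case 1 show ?case by (rule GV.module_axioms)
    next
      case 2 show ?case by (auto simp: E)
    next
      case (3 f g) 
      then have "f \<oplus>\<^bsub>gl V\<^esub> g \<in> carrier (gl V)" by (auto simp: E)
      with 3 show ?case unfolding E by (auto simp: ops sD fc F)
    next
      case 4 show ?case unfolding E using GV.M.zero_closed by (auto simp: ops sD(1) s0 F)
    next
      case (5 a f)
      then have "a \<odot>\<^bsub>gl V\<^esub> f \<in> carrier (gl V)" using vs_facts(2)[OF G.vectorspace_L] by (auto simp: E)
      with 5 show ?case unfolding E by (auto simp: ops sD fc comm)
    qed
    then show ?thesis using G.vectorspace_L by (simp add: VectorSpace.subspace_def)
  qed
  have sm: "s (v \<ominus>\<^bsub>V\<^esub> w) = s v \<ominus>\<^bsub>V\<^esub> s w" if "v \<in> carrier V" "w \<in> carrier V" for v w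
  proof -
    have "s (\<ominus>\<^bsub>V\<^esub> w) = \<ominus>\<^bsub>V\<^esub> s w"
      using sD(3)[OF that(2,2), of "-1"] F(9)[OF that(2)] F(9)[OF sD(1)[OF that(2,2)]] by simp
    then show ?thesis using that sD(2)[OF that(1), of "\<ominus>\<^bsub>V\<^esub> w"] by (simp add: a_minus_def)
  qed
  have cm: "c \<odot>\<^bsub>V\<^esub> (v \<ominus>\<^bsub>V\<^esub> w) = c \<odot>\<^bsub>V\<^esub> v \<ominus>\<^bsub>V\<^esub> c \<odot>\<^bsub>V\<^esub> w" if "v \<in> carrier V" "w \<in> carrier V" for c v w
    using that F(9)[of w] F(9)[of "c \<odot>\<^bsub>V\<^esub> w"] comm[of w c "-1"] by (simp add: a_minus_def F(2,4))
  have br: "lie_bracket (gl V) f g \<in> E c" if fg: "f \<in> E 1" "g \<in> E c" for f g c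
  proof -
    have "lie_bracket (gl V) f g \<in> carrier (gl V)" using that G.bracket_closed by (auto simp: E)
    moreover have "s (f (g v) \<ominus>\<^bsub>V\<^esub> g (f v)) = c \<odot>\<^bsub>V\<^esub> (f (g (s v)) \<ominus>\<^bsub>V\<^esub> g (f (s v)))" if v: "v \<in> carrier V" for v
    proof -
      have fE: "s (f w) = f (s w)" if "w \<in> carrier V" for w
        using fg(1) that by (auto simp: E F(6) fc sD(1))
      have gE: "s (g w) = c \<odot>\<^bsub>V\<^esub> g (s w)" if "w \<in> carrier V" for w
        using fg(2) that by (auto simp: E)
      have f3: "f (c \<odot>\<^bsub>V\<^esub> w) = c \<odot>\<^bsub>V\<^esub> f w" if "w \<in> carrier V" for w
        using fg(1) that by (auto simp: E gc)
      have cc: "f w \<in> carrier V" "g w \<in> carrier V" "s w \<in> carrier V" if "w \<in> carrier V" for w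
        using fg that by (auto simp: E fc sD(1))
      show ?thesis using v by (simp add: sm cc fE gE f3 cm)
    qed
    ultimately show ?thesis unfolding E by (simp add: ops sD(1))
  qed
  have "lie_module ((gl V)\<lparr>carrier := E 1\<rparr>) ((gl V)\<lparr>carrier := E \<zeta>\<rparr>) (lie_bracket (gl V))"
    by (rule restrict_carrier_lie_module[OF lie_algebra_gl[OF V] subE subE]) (auto intro: br)
  then show ?thesis by (simp add: graded_part_def E_def)
qed

end

theory Submission
  imports Defs
begin

text \<open>
  Write \<open>k\<close> for the least multiplicity and \<open>g\<^sub>1 = \<Oplus> Hom (V\<^sub>i, V\<^sub>i\<^sub>+\<^sub>1)\<close>. The trace form identifies the
  dual of \<open>g\<^sub>1\<close> with \<open>g\<^sub>-\<^sub>1\<close>. The index of \<open>g\<^sub>0\<close> on it is at most \<open>k\<close>, because the centraliser in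
  \<open>g\<^sub>-\<^sub>1\<close> of a suitable diagonal \<open>\<xi> \<in> g\<^sub>1\<close> has dimension at most \<open>k\<close>. For \<open>v \<in> g\<^sub>1\<close> the dual of the
  slice \<open>g\<^sub>1 / [g\<^sub>0, v]\<close> is the centraliser \<open>Z\<close> of \<open>v\<close> in \<open>g\<^sub>-\<^sub>1\<close>, and its index is the minimum over
  linear forms \<open>\<zeta>\<close> on \<open>Z\<close> of the dimension of \<open>{w \<in> Z. \<zeta> [x, w] = 0 for all x in the stabiliser of v}\<close>.

  A cyclic shift moves three consecutive multiplicities \<open>\<ge> 2\<close> to the levels \<open>m - 2, m - 1, 0\<close>. Let
  \<open>v\<close> consist of \<open>k - 2\<close> cycles with distinct nonzero eigenvalues and two Jordan blocks
  \<open>0 \<rightarrow> 1 \<rightarrow> \<dots> \<rightarrow> m - 2\<close> and \<open>m - 2 \<rightarrow> m - 1 \<rightarrow> 0\<close>, and vanish on the remaining basis vectors. Then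
  every \<open>\<zeta>\<close> admits \<open>k + 1\<close> independent elements \<open>w\<close>: one for each cycle; one combination of the
  two homomorphisms between the blocks, which have opposite weights; and, for each block, one
  supported on the path of killed vectors leading from its last level around to its first level.
  For \<open>k = 1\<close> there are no cycles, and the path closing the second block is not needed.
\<close>

section \<open>Finite-dimensional spaces with coordinates\<close>

text \<open>An upper bound on an index needs one well chosen form, but a lower bound must serve
  every form. The invariant elements are therefore built from the given \<zeta>, and they are
  counted by exhibiting for each of them an entry at which it alone is nonzero. The two Jordan
  blocks share exactly the levels m - 2 and 0, so the interior of the path from the end of one block
  back to its start consists of levels that meet only the other block. On the levels 1, ..., m - 3
  the vector of the first block is both hit and moved on by v; this isolates it, in rows and in
  columns, in every stabiliser element. For m >= 4 this range is nonempty, and the homomorphisms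
  between the blocks rely on such isolation at the levels m - 3 and 1. The second block lies on the
  three levels with multiplicity at least 2, so it exists even when k = 1. Its return path crosses
  the levels 1, ..., m - 3, where a second vector is guaranteed by k >= 2.\<close>

lemma nontrivial_kernel_vector:
  fixes A :: "'i \<Rightarrow> 'j \<Rightarrow> 'a::field"
  assumes "finite I" and "finite J" and "card I < card J"
  shows "\<exists>c. (\<exists>j\<in>J. c j \<noteq> 0) \<and> (\<forall>i\<in>I. (\<Sum>j\<in>J. A i j * c j) = 0)"
  using assms
proof (induction I arbitrary: J A rule: finite_induct)
  case empty
  then obtain j where "j \<in> J" by (metis card_gt_0_iff card.empty ex_in_conv)
  then show ?case by (intro exI[of _ "\<lambda>_. 1"]) auto
next
  case (insert i0 I)
  show ?case
  proof (cases "\<exists>j0\<in>J. A i0 j0 \<noteq> 0")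
    case False
    obtain c where c: "\<exists>j\<in>J. c j \<noteq> 0" "\<forall>i\<in>I. (\<Sum>j\<in>J. A i j * c j) = 0"
      using insert.IH[of J A] insert.prems insert.hyps by auto
    then show ?thesis using False by (intro exI[of _ c]) auto
  next
    case True
    then obtain j0 where j0: "j0 \<in> J" "A i0 j0 \<noteq> 0" by blast
    define J' where "J' = J - {j0}"
    have J': "finite J'" "card I < card J'" "j0 \<notin> J'" "J = insert j0 J'"
      using insert.prems insert.hyps j0 by (auto simp: J'_def)
    obtain c where c: "\<exists>j\<in>J'. c j \<noteq> 0"
      "\<And>i. i \<in> I \<Longrightarrow> (\<Sum>j\<in>J'. (A i j - A i j0 * A i0 j / A i0 j0) * c j) = 0"
      using insert.IH[OF J'(1,2), of "\<lambda>i j. A i j - A i j0 * A i0 j / A i0 j0"] by blast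
    define S where "S = (\<Sum>j\<in>J'. A i0 j * c j)"
    \<comment> \<open>The value at \<open>j0\<close> is forced by equation \<open>i0\<close>; the
      matrix given to the induction hypothesis is the system with the unknown \<open>j0\<close>
      eliminated.\<close>
    define c' where "c' j = (if j = j0 then - S / A i0 j0 else c j)" for j
    have split: "(\<Sum>j\<in>J. A i j * c' j) = (\<Sum>j\<in>J'. A i j * c j) - A i j0 * S / A i0 j0" for i
    proof -
      have "(\<Sum>j\<in>J'. A i j * c' j) = (\<Sum>j\<in>J'. A i j * c j)"
        using J'(3) by (intro sum.cong) (auto simp: c'_def)
      then show ?thesis using J'(1,3) unfolding J'(4) by (simp add: c'_def)
    qed
    have "(\<Sum>j\<in>J'. (A i j - A i j0 * A i0 j / A i0 j0) * c j)
        = (\<Sum>j\<in>J'. A i j * c j) - A i j0 * S / A i0 j0" for i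
      unfolding S_def
      by (simp add: sum_distrib_left sum_divide_distrib sum_subtractf[symmetric] algebra_simps)
    then have "\<forall>i\<in>insert i0 I. (\<Sum>j\<in>J. A i j * c' j) = 0"
      using c(2) j0(2) unfolding split by (auto simp: S_def)
    moreover have "\<exists>j\<in>J. c' j \<noteq> 0" using c(1) J'(3,4) by (auto simp: c'_def)
    ultimately show ?thesis by blast
  qed
qed

text \<open>Unlike membership in \<open>dual_space\<close>, this does not ask for extensionality, so
  evaluations \<open>\<lambda>f. f v\<close> and restrictions to a smaller carrier qualify as they
  are.\<close>

definition linear_on :: "('a::field, 'v, 'e) module_scheme \<Rightarrow> ('v \<Rightarrow> 'a) \<Rightarrow> bool"
  where
  "linear_on E f \<longleftrightarrow>
    (\<forall>v\<in>carrier E. \<forall>w\<in>carrier E. f (v \<oplus>\<^bsub>E\<^esub> w) = f v + f w) \<and>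
    (\<forall>c. \<forall>v\<in>carrier E. f (c \<odot>\<^bsub>E\<^esub> v) = c * f v)"

text \<open>A basis together with its dual basis: independence is encoded by \<open>co_B\<close> and
  spanning by \<open>co_separates\<close>. The free index type lets matrix units be indexed by pairs
  of positions.\<close>

locale frame =
  fixes E :: "('a::field, 'v, 'e) module_scheme" (structure)
    and I :: "'i set" and B :: "'i \<Rightarrow> 'v" and co :: "'i \<Rightarrow> 'v \<Rightarrow> 'a"
  assumes vs: "vectorspace class_ring E"
    and finite_I: "finite I"
    and B_closed: "i \<in> I \<Longrightarrow> B i \<in> carrier E"
    and linear_co: "i \<in> I \<Longrightarrow> linear_on E (co i)"
    and co_B: "\<lbrakk>i \<in> I; j \<in> I\<rbrakk> \<Longrightarrow> co i (B j) = (if i = j then 1 else 0)"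
    and co_separates: "\<lbrakk>w \<in> carrier E; \<And>i. i \<in> I \<Longrightarrow> co i w = 0\<rbrakk> \<Longrightarrow> w = \<zero>"

lemma linear_onD:
  assumes "linear_on E f"
  shows "v \<in> carrier E \<Longrightarrow> w \<in> carrier E \<Longrightarrow> f (v \<oplus>\<^bsub>E\<^esub> w) = f v + f w"
    and "v \<in> carrier E \<Longrightarrow> f (c \<odot>\<^bsub>E\<^esub> v) = c * f v"
  using assms by (auto simp: linear_on_def)

lemma linear_on_zero:
  assumes "vectorspace class_ring E" and "linear_on E f"
  shows "f \<zero>\<^bsub>E\<^esub> = 0"
proof -
  interpret E: vectorspace class_ring E by fact
  show ?thesis
    using linear_onD(2)[OF assms(2), of "\<zero>\<^bsub>E\<^esub>" 0] vs_facts(7)[OF assms(1)] by simp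
qed

lemma linear_on_diff:
  assumes "vectorspace class_ring E" and "linear_on E f"
    and v: "v \<in> carrier E" and w: "w \<in> carrier E"
  shows "f (v \<ominus>\<^bsub>E\<^esub> w) = f v - f w"
proof -
  interpret E: vectorspace class_ring E by fact
  have "v \<ominus>\<^bsub>E\<^esub> w = v \<oplus>\<^bsub>E\<^esub> (-1) \<odot>\<^bsub>E\<^esub> w"
    using vs_facts(9)[OF assms(1) w] by (simp add: a_minus_def)
  then show ?thesis
    using linear_onD[OF assms(2)] v w vs_facts(2)[OF assms(1) w] by simp
qed

lemma linear_on_finsum:
  assumes E: "vectorspace class_ring E" and f: "linear_on E f" and "finite S"
    and "\<And>i. i \<in> S \<Longrightarrow> g i \<in> carrier E"
  shows "f (\<Oplus>\<^bsub>E\<^esub>i\<in>S. g i) = (\<Sum>i\<in>S. f (g i))"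
proof -
  interpret E: vectorspace class_ring E by fact
  show ?thesis
    using assms(3,4)
  proof (induction S rule: finite_induct)
    case empty
    then show ?case by (simp add: linear_on_zero[OF E f])
  next
    case (insert x S)
    then have g: "g \<in> S \<rightarrow> carrier E" by auto
    show ?case using insert g by (simp add: linear_onD(1)[OF f])
  qed
qed

context frame
begin

sublocale vectorspace class_ring E by (rule vs)

lemma smult_mem [simp]: "w \<in> carrier E \<Longrightarrow> c \<odot>\<^bsub>E\<^esub> w \<in> carrier E"
  by (rule vs_facts(2)[OF vs])

definition vec :: "('i \<Rightarrow> 'a) \<Rightarrow> 'v"
  where "vec c = (\<Oplus>\<^bsub>E\<^esub>i\<in>I. c i \<odot>\<^bsub>E\<^esub> B i)"

lemma vec_closed [simp]: "vec c \<in> carrier E"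
  unfolding vec_def by (rule M.finsum_closed) (auto simp: B_closed)

lemma linear_vec:
  assumes "linear_on E f"
  shows "f (vec c) = (\<Sum>i\<in>I. c i * f (B i))"
  unfolding vec_def
  by (subst linear_on_finsum[OF vs assms finite_I])
    (auto simp: B_closed linear_onD(2)[OF assms] intro!: sum.cong)

lemma co_vec: "i \<in> I \<Longrightarrow> co i (vec c) = c i"
  by (simp add: linear_vec linear_co co_B finite_I sum.delta mult.commute[of "c _"]
      if_distrib[of "\<lambda>x. x * _"] cong: if_cong)

lemma co_eqI:
  assumes "v \<in> carrier E" "w \<in> carrier E" "\<And>i. i \<in> I \<Longrightarrow> co i v = co i w"
  shows "v = w"
proof -
  have "v \<ominus>\<^bsub>E\<^esub> w = \<zero>\<^bsub>E\<^esub>"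
    using assms by (intro co_separates) (auto simp: linear_on_diff[OF vs linear_co])
  then show ?thesis using assms(1,2) M.minus_equality M.r_neg
    by (metis M.add.inv_closed M.minus_minus a_minus_def M.a_comm)
qed

lemma vec_co:
  assumes "w \<in> carrier E"
  shows "vec (\<lambda>i. co i w) = w"
  by (rule co_eqI) (auto simp: assms co_vec)

lemma linear_expand:
  assumes "linear_on E f" and "w \<in> carrier E"
  shows "f w = (\<Sum>i\<in>I. co i w * f (B i))"
  using linear_vec[OF assms(1), of "\<lambda>i. co i w"] vec_co[OF assms(2)] by simp

end

lemma frame_exists:
  fixes E :: "('a::field, 'v, 'e) module_scheme"
  assumes E: "vectorspace class_ring E" and "vectorspace.fin_dim class_ring E"
  shows "\<exists>B co. frame E {..<vdim E} B co"
proof -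
  interpret E: vectorspace class_ring E by fact
  obtain S where S: "finite S" "E.basis S"
    using E.finite_basis_exists assms(2) by blast
  have dim: "vdim E = card S" by (rule E.dim_basis[OF S])
  have SE: "S \<subseteq> carrier E" using S by (simp add: E.basis_def)
  obtain h where h: "bij_betw h {..<card S} S"
    using ex_bij_betw_nat_finite[OF S(1)] by (auto simp: atLeast0LessThan)
  have ex1: "\<exists>!a. a \<in> S \<rightarrow>\<^sub>E UNIV \<and> E.lincomb a S = w" if "w \<in> carrier E" for w
    using E.basis_criterion[OF S(1) SE] S(2) that by simp
  define cf where "cf w = (THE a. a \<in> S \<rightarrow>\<^sub>E UNIV \<and> E.lincomb a S = w)" for w
  have cf: "cf w \<in> S \<rightarrow>\<^sub>E UNIV" "E.lincomb (cf w) S = w" if "w \<in> carrier E" for w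
    using theI'[OF ex1[OF that]] by (auto simp: cf_def)
  have cfI: "cf w = a" if "a \<in> S \<rightarrow>\<^sub>E UNIV" "E.lincomb a S = w" for w a
  proof -
    have "w \<in> carrier E" using that E.lincomb_closed[OF SE, of a] by auto
    then show ?thesis using ex1 cf that by blast
  qed
  \<comment> \<open>The uniqueness criterion speaks about extensional coefficient functions, whereas
    \<open>lincomb\<close> only sees the values on \<open>S\<close>.\<close>
  have res: "E.lincomb (restrict a S) S = E.lincomb a S" for a
    unfolding E.lincomb_def using SE
    by (intro E.M.finsum_cong') (auto intro!: vs_facts(2)[OF E])
  have cfI': "cf (E.lincomb a S) = restrict a S" for a
    by (rule cfI) (auto simp: res)
  have add: "cf (v \<oplus>\<^bsub>E\<^esub> w) b = cf v b + cf w b"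
    if "v \<in> carrier E" "w \<in> carrier E" "b \<in> S" for v w b
  proof -
    have "E.lincomb (\<lambda>x. cf v x + cf w x) S = v \<oplus>\<^bsub>E\<^esub> w"
      using E.lincomb_sum[OF S(1) SE, of "cf v" "cf w"] cf that by simp
    then show ?thesis using cfI'[of "\<lambda>x. cf v x + cf w x"] that(3) by simp
  qed
  have smult: "cf (c \<odot>\<^bsub>E\<^esub> v) b = c * cf v b" if "v \<in> carrier E" "b \<in> S" for c v b
  proof -
    have "E.lincomb (\<lambda>x. c * cf v x) S = c \<odot>\<^bsub>E\<^esub> v"
      using E.lincomb_smult[OF SE, of "cf v" c] cf that by simp
    then show ?thesis using cfI'[of "\<lambda>x. c * cf v x"] that(2) by simp
  qed
  have delta: "cf b = (\<lambda>x\<in>S. if x = b then 1 else 0)" if "b \<in> S" for b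
  proof (rule cfI)
    show "E.lincomb (\<lambda>x\<in>S. if x = b then 1 else 0) S = b"
    proof -
      have "E.lincomb (\<lambda>x\<in>S. if x = b then 1 else 0) S
          = (\<Oplus>\<^bsub>E\<^esub>x\<in>S. if b = x then b else \<zero>\<^bsub>E\<^esub>)"
        unfolding E.lincomb_def using SE that
        by (intro E.M.finsum_cong') (auto simp: vs_facts(6,8)[OF E])
      also have "\<dots> = b"
        using E.M.finsum_singleton[OF that S(1), of "\<lambda>_. b"] SE that by auto
      finally show ?thesis .
    qed
  qed auto
  have "frame E {..<vdim E} h (\<lambda>i w. cf w (h i))"
  proof (rule frame.intro)
    show "vectorspace class_ring E" by fact
  next
    fix i assume "i \<in> {..<vdim E}"
    then have hi: "h i \<in> S" using h dim by (auto simp: bij_betw_def)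
    show "h i \<in> carrier E" using hi SE by auto
    show "linear_on E (\<lambda>w. cf w (h i))" using hi by (auto simp: linear_on_def add smult)
  next
    fix i j assume "i \<in> {..<vdim E}" "j \<in> {..<vdim E}"
    then have "h i \<in> S" "h j \<in> S" "h i = h j \<longleftrightarrow> i = j"
      using h dim by (auto simp: bij_betw_def inj_on_def)
    then show "cf (h j) (h i) = (if i = j then 1 else 0)" by (simp add: delta)
  next
    fix w assume w: "w \<in> carrier E" and 0: "\<And>i. i \<in> {..<vdim E} \<Longrightarrow> cf w (h i) = 0"
    have "cf w b = 0" if "b \<in> S" for b
    proof -
      obtain i where "i < card S" "b = h i"
        using h \<open>b \<in> S\<close> unfolding bij_betw_def by (metis imageE lessThan_iff)
      then show ?thesis using 0[of i] dim by simp
    qed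
    then have "E.lincomb (cf w) S = (\<Oplus>\<^bsub>E\<^esub>b\<in>S. \<zero>\<^bsub>E\<^esub>)"
      unfolding E.lincomb_def using SE
      by (intro E.M.finsum_cong') (auto simp: vs_facts(8)[OF E])
    then show "w = \<zero>\<^bsub>E\<^esub>" using cf(2)[OF w] by simp
  qed auto
  then show ?thesis by (intro exI)
qed

text \<open>An independent set with more elements than there are functionals has a nontrivial
  combination killed by all of them, hence equal to zero. Finite dimension belongs to the conclusion
  because it is not known beforehand for the duals, orbits and subspaces to which this is
  applied.\<close>

lemma dim_le_card_separating:
  fixes E :: "('a::field, 'v, 'e) module_scheme" and \<phi> :: "'j \<Rightarrow> 'v \<Rightarrow> 'a"
  assumes E: "vectorspace class_ring E" and J: "finite J"
    and lin: "\<And>j. j \<in> J \<Longrightarrow> linear_on E (\<phi> j)"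
    and sep: "\<And>w. \<lbrakk>w \<in> carrier E; \<And>j. j \<in> J \<Longrightarrow> \<phi> j w = 0\<rbrakk> \<Longrightarrow> w = \<zero>\<^bsub>E\<^esub>"
  shows "vectorspace.fin_dim class_ring E" and "vdim E \<le> card J"
proof -
  interpret E: vectorspace class_ring E by fact
  have bound: "card S \<le> card J" if S: "finite S" "S \<subseteq> carrier E" "E.lin_indpt S" for S
  proof (rule ccontr)
    assume "\<not> card S \<le> card J"
    then obtain c where c: "\<exists>s\<in>S. c s \<noteq> 0" "\<And>j. j \<in> J \<Longrightarrow> (\<Sum>s\<in>S. \<phi> j s * c s) = 0"
      using nontrivial_kernel_vector[OF J S(1), of \<phi>] by auto
    have "E.lincomb c S = \<zero>\<^bsub>E\<^esub>"
    proof (rule sep)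
      show "E.lincomb c S \<in> carrier E" using S(2) by (intro E.lincomb_closed) auto
      fix j assume j: "j \<in> J"
      have "\<phi> j (E.lincomb c S) = (\<Sum>s\<in>S. \<phi> j (c s \<odot>\<^bsub>E\<^esub> s))"
        unfolding E.lincomb_def using S(1,2)
        by (intro linear_on_finsum[OF E lin[OF j]]) (auto intro!: vs_facts(2)[OF E])
      also have "\<dots> = (\<Sum>s\<in>S. \<phi> j s * c s)"
        using S(2) by (intro sum.cong) (auto simp: linear_onD(2)[OF lin[OF j]])
      finally show "\<phi> j (E.lincomb c S) = 0" using c(2)[OF j] by simp
    qed
    then have "E.lin_dep S" using c(1) S(1) unfolding E.lin_dep_def by auto
    then show False using S(3) by simp
  qed
  have bound': "finite S \<and> card S \<le> card J" if "S \<subseteq> carrier E \<and> E.lin_indpt S" for S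
  proof (cases "finite S")
    case False
    \<comment> \<open>An infinite independent set is excluded through a finite subset just above the
      bound.\<close>
    then obtain T where T: "T \<subseteq> S" "finite T" "card T = Suc (card J)"
      using infinite_arbitrarily_large by blast
    have "E.lin_indpt T" using that T(1) E.subset_li_is_li by blast
    then show ?thesis using bound[of T] T that by auto
  qed (use that bound in auto)
  have "{} \<subseteq> carrier E \<and> E.lin_indpt {}" by (auto simp: E.lin_dep_def)
  from maximal_exists[of "\<lambda>S. S \<subseteq> carrier E \<and> E.lin_indpt S", OF bound' this]
  obtain S where S: "finite S" "maximal S (\<lambda>S. S \<subseteq> carrier E \<and> E.lin_indpt S)" by blast
  have bS: "E.basis S" by (rule E.max_li_is_basis[OF S(2)])
  then show "E.fin_dim" using S(1) by (auto simp: E.fin_dim_def E.basis_def)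
  show "vdim E \<le> card J"
    using E.dim_basis[OF S(1) bS] bound[OF S(1)] bS by (auto simp: E.basis_def)
qed

text \<open>The coordinates separate, which gives one inequality. For the other, too many vectors
  \<open>B i\<close>, written in a frame of size \<open>vdim E\<close>, would satisfy a nontrivial
  relation, which \<open>co\<close> excludes.\<close>

lemma (in frame) frame_dim: "vdim E = card I" "fin_dim"
proof -
  have le: fin_dim "vdim E \<le> card I"
    using dim_le_card_separating[OF vs finite_I, of co] linear_co co_separates by auto
  show "fin_dim" by (rule le(1))
  have "card I \<le> vdim E"
  proof (rule ccontr)
    assume "\<not> card I \<le> vdim E"
    obtain B' co' where "frame E {..<vdim E} B' co'"
      using frame_exists[OF vs le(1)] by blast
    then interpret F: frame E "{..<vdim E}" B' co' .
    obtain c where c: "\<exists>i\<in>I. c i \<noteq> 0" "\<And>j. j < vdim E \<Longrightarrow> (\<Sum>i\<in>I. co' j (B i) * c i) = 0"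
      using nontrivial_kernel_vector[of "{..<vdim E}" I "\<lambda>j i. co' j (B i)"] finite_I
        \<open>\<not> card I \<le> vdim E\<close> by auto
    have "vec c = \<zero>\<^bsub>E\<^esub>"
      using c(2) by (intro F.co_separates) (auto simp: linear_vec F.linear_co mult.commute)
    then show False using c(1) co_vec linear_on_zero[OF vs linear_co] by metis
  qed
  then show "vdim E = card I" using le(2) by simp
qed


section \<open>Dual spaces and evaluations\<close>

lemma carrier_dual_space:
  "f \<in> carrier (dual_space E) \<longleftrightarrow> f \<in> extensional (carrier E) \<and> linear_on E f"
  unfolding dual_space_def hom_space_def module_hom_def field_space_def linear_on_def by auto

lemma dual_space_ops:
  "f \<oplus>\<^bsub>dual_space E\<^esub> g = (\<lambda>v\<in>carrier E. f v + g v)"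
  "c \<odot>\<^bsub>dual_space E\<^esub> f = (\<lambda>v\<in>carrier E. c * f v)"
  "\<zero>\<^bsub>dual_space E\<^esub> = (\<lambda>v\<in>carrier E. 0)"
  by (simp_all add: dual_space_def hom_space_def field_space_def)

lemma linear_on_dual_eval:
  "v \<in> carrier E \<Longrightarrow> linear_on (dual_space E) (\<lambda>f. f v)"
  by (simp add: linear_on_def dual_space_ops)

lemma linear_on_carrier:
  "linear_on E f \<Longrightarrow> A \<subseteq> carrier E \<Longrightarrow> linear_on (E\<lparr>carrier := A\<rparr>) f"
  by (simp add: linear_on_def subset_iff)

lemma (in frame) dual_zeroI:
  assumes "f \<in> carrier (dual_space E)" and "\<And>i. i \<in> I \<Longrightarrow> f (B i) = 0"
  shows "f = \<zero>\<^bsub>dual_space E\<^esub>"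
proof (rule extensionalityI[of _ "carrier E"])
  fix w assume w: "w \<in> carrier E"
  have "linear_on E f" using assms(1) by (simp add: carrier_dual_space)
  then show "f w = \<zero>\<^bsub>dual_space E\<^esub> w"
    using assms(2) w by (simp add: linear_expand dual_space_ops)
qed (use assms(1) in \<open>auto simp: carrier_dual_space dual_space_ops\<close>)

section \<open>The index and annihilators of orbits\<close>

context lie_module
begin

lemma subspace_orbit:
  assumes v: "v \<in> carrier V"
  shows "VectorSpace.subspace class_ring (lie_orbit L act v) V"
proof -
  interpret V: vectorspace class_ring V by (rule vectorspace_V)
  interpret L: vectorspace class_ring L by (rule vectorspace_L)
  have act0: "act \<zero> v = \<zero>\<^bsub>V\<^esub>"
    using act_smult_left[of "\<zero>" v 0] v act_closed
    by (simp add: vs_facts(8)[OF vectorspace_V] vs_facts(7)[OF vectorspace_L])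
  have "submodule class_ring (lie_orbit L act v) V"
  proof (rule submodule.intro, goal_cases)
    case 1 show ?case by (rule V.module_axioms)
  next
    case 2 show ?case using v by (auto simp: lie_orbit_def act_closed)
  next
    case (3 x y) then show ?case
      using v by (auto simp: lie_orbit_def act_add_left[symmetric])
  next
    case 4 show ?case unfolding lie_orbit_def
      by (rule image_eqI[of _ _ "\<zero>"]) (simp_all add: act0)
  next
    case (5 c x) then show ?case
      using v by (auto simp: lie_orbit_def act_smult_left[symmetric] vs_facts(2)[OF vectorspace_L])
  qed
  then show ?thesis using vectorspace_V by (simp add: VectorSpace.subspace_def)
qed

text \<open>
  Both bounds on the index come from the equality of the codimension of \<open>L \<cdot> \<zeta>\<close> in the
  dual of \<open>V\<close> with the dimension of its annihilator \<open>{v. \<zeta> (x v) = 0 for all x}\<close>.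
\<close>

context
  fixes B :: "'i \<Rightarrow> 'v" and co and J :: "'i set"
  assumes fr: "frame V J B co"
begin

interpretation F: frame V J B co by (rule fr)

abbreviation dual_orbit :: "('v \<Rightarrow> 'a) \<Rightarrow> ('a, 'v \<Rightarrow> 'a) module"
  where "dual_orbit \<xi> \<equiv> (dual_space V)\<lparr>carrier := lie_orbit L (dual_action V act) \<xi>\<rparr>"

lemma dual_orbit:
  assumes "\<xi> \<in> carrier (dual_space V)"
  shows "vectorspace class_ring (dual_orbit \<xi>)"
    and "lie_orbit L (dual_action V act) \<xi> \<subseteq> carrier (dual_space V)"
    and "vectorspace.fin_dim class_ring (dual_orbit \<xi>)"
    and "vdim (dual_orbit \<xi>) \<le> card J"
proof -
  interpret D: lie_module L "dual_space V" "dual_action V act"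
    by (rule lie_module_dual) (rule lie_module_axioms)
  interpret DV: vectorspace class_ring "dual_space V" by (rule D.vectorspace_V)
  note sub = D.subspace_orbit[OF assms]
  show vs: "vectorspace class_ring (dual_orbit \<xi>)"
    by (rule DV.subspace_is_vs[OF sub])
  show incl: "lie_orbit L (dual_action V act) \<xi> \<subseteq> carrier (dual_space V)"
    using sub submodule.subset by (fastforce simp: VectorSpace.subspace_def)
  have lin: "linear_on (dual_orbit \<xi>) (\<lambda>f. f (B j))" if "j \<in> J" for j
    by (intro linear_on_carrier linear_on_dual_eval F.B_closed that incl)
  have sep: "w = \<zero>\<^bsub>dual_orbit \<xi>\<^esub>"
    if "w \<in> carrier (dual_orbit \<xi>)" "\<And>j. j \<in> J \<Longrightarrow> w (B j) = 0" for w
    using F.dual_zeroI[of w] that incl by auto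
  show "vectorspace.fin_dim class_ring (dual_orbit \<xi>)" "vdim (dual_orbit \<xi>) \<le> card J"
    using dim_le_card_separating[OF vs F.finite_I, of "\<lambda>j f. f (B j)"] lin sep by auto
qed

lemma zero_in_dual: "\<zero>\<^bsub>dual_space V\<^esub> \<in> carrier (dual_space V)"
proof -
  interpret DV: vectorspace class_ring "dual_space V"
    by (rule vectorspace_dual_space[OF vectorspace_V])
  show ?thesis by simp
qed

lemma finite_orbit_dims: "finite ((\<lambda>\<xi>. vdim (dual_orbit \<xi>)) ` carrier (dual_space V))"
proof (rule finite_subset[OF image_subsetI finite_atMost[of "card J"]])
  fix \<xi> assume "\<xi> \<in> carrier (dual_space V)"
  then show "vdim (dual_orbit \<xi>) \<in> {..card J}" unfolding atMost_iff by (rule dual_orbit(4))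
qed

text \<open>The basis of the orbit is kept together with the shape of its members, because
  \<open>lie_index_ge\<close> evaluates them at vectors annihilated by the orbit.\<close>

lemma dual_orbit_frame:
  assumes "\<xi> \<in> carrier (dual_space V)"
  obtains C d where "frame (dual_orbit \<xi>) {..<vdim (dual_orbit \<xi>)} C d"
    and "\<And>i. i < vdim (dual_orbit \<xi>) \<Longrightarrow>
      \<exists>x\<in>carrier L. C i = (\<lambda>v\<in>carrier V. - \<xi> (act x v))"
proof -
  obtain C d where C: "frame (dual_orbit \<xi>) {..<vdim (dual_orbit \<xi>)} C d"
    using frame_exists[OF dual_orbit(1,3)[OF assms]] by blast
  show ?thesis
  proof (rule that[OF C])
    fix i assume "i < vdim (dual_orbit \<xi>)"
    then show "\<exists>x\<in>carrier L. C i = (\<lambda>v\<in>carrier V. - \<xi> (act x v))"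
      using frame.B_closed[OF C, of i] by (auto simp: lie_orbit_def dual_action_def)
  qed
qed

text \<open>A single \<xi> suffices, since the dimension of its orbit is at most the maximum. A
  basis of the orbit and the \<open>\<phi> t\<close> together separate the points of
  \<open>V\<close>, so \<open>vdim V\<close> is at most the orbit dimension plus
  \<open>card K\<close>.\<close>

lemma lie_index_le:
  fixes \<phi> :: "'k \<Rightarrow> 'v \<Rightarrow> 'a"
  assumes \<xi>: "\<xi> \<in> carrier (dual_space V)" and K: "finite K"
    and lin: "\<And>t. t \<in> K \<Longrightarrow> linear_on V (\<phi> t)"
    and sep: "\<And>v. \<lbrakk>v \<in> carrier V; \<And>x. x \<in> carrier L \<Longrightarrow> \<xi> (act x v) = 0;
      \<And>t. t \<in> K \<Longrightarrow> \<phi> t v = 0\<rbrakk> \<Longrightarrow> v = \<zero>\<^bsub>V\<^esub>"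
  shows "lie_index L V act \<le> int (card K)"
proof -
  define N where "N = vdim (dual_orbit \<xi>)"
  obtain C d where C: "frame (dual_orbit \<xi>) {..<N} C d"
    using dual_orbit_frame[OF \<xi>] unfolding N_def by blast
  interpret C: frame "dual_orbit \<xi>" "{..<N}" C d by (rule C)
  define \<psi> where "\<psi> s = (case s of Inl i \<Rightarrow> C i | Inr t \<Rightarrow> \<phi> t)" for s
  have "vdim V \<le> card (Inl ` {..<N} \<union> Inr ` K)"
  proof (rule dim_le_card_separating(2)[OF vectorspace_V, of _ \<psi>])
    show "finite (Inl ` {..<N} \<union> Inr ` K)" using K by simp
    show "linear_on V (\<psi> s)" if "s \<in> Inl ` {..<N} \<union> Inr ` K" for s
    proof (cases s)
      case (Inl i)
      then have "C i \<in> carrier (dual_orbit \<xi>)" using that by (intro C.B_closed) auto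
      then show ?thesis
        using Inl dual_orbit(2)[OF \<xi>] by (auto simp: \<psi>_def carrier_dual_space)
    qed (use that lin in \<open>auto simp: \<psi>_def\<close>)
    fix v assume v: "v \<in> carrier V" and 0: "\<And>s. s \<in> Inl ` {..<N} \<union> Inr ` K \<Longrightarrow> \<psi> s v = 0"
    have C0: "C i v = 0" if "i < N" for i
      using 0[of "Inl i"] that by (simp add: \<psi>_def InlI)
    have \<phi>0: "\<phi> t v = 0" if "t \<in> K" for t
      using 0[of "Inr t"] that by (simp add: \<psi>_def InrI)
    show "v = \<zero>\<^bsub>V\<^esub>"
    proof (rule sep[OF v _ \<phi>0])
      fix x assume x: "x \<in> carrier L"
      define f where "f = (\<lambda>v\<in>carrier V. - \<xi> (act x v))"
      have f: "f \<in> carrier (dual_orbit \<xi>)"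
        using x by (auto simp: f_def lie_orbit_def dual_action_def)
      have "linear_on (dual_orbit \<xi>) (\<lambda>f. f v)"
        by (intro linear_on_carrier linear_on_dual_eval v dual_orbit(2)[OF \<xi>])
      from C.linear_expand[OF this f] have "f v = 0" using C0 by simp
      then show "\<xi> (act x v) = 0" using v by (simp add: f_def)
    qed
  qed
  also have "card (Inl ` {..<N} \<union> Inr ` K) = N + card K"
    using K by (subst card_Un_disjoint) (auto simp: card_image)
  finally have "vdim V \<le> N + card K" .
  moreover have "N \<le> (MAX \<xi>\<in>carrier (dual_space V). vdim (dual_orbit \<xi>))"
    unfolding N_def using \<xi> finite_orbit_dims by (intro Max_ge) auto
  ultimately show ?thesis unfolding lie_index_def by linarith
qed

text \<open>The functionals \<open>g t\<close> witness that the annihilated vectors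
  \<open>z t\<close> are independent. They are demanded for every \<xi>, as the maximum may be
  attained at any form.\<close>

lemma lie_index_ge:
  assumes inv: "\<And>\<xi>. \<xi> \<in> carrier (dual_space V) \<Longrightarrow>
      \<exists>z g. \<forall>t<n. z t \<in> carrier V \<and> (\<forall>x\<in>carrier L. \<xi> (act x (z t)) = 0) \<and>
        linear_on V (g t) \<and> (\<forall>s<n. g t (z s) = 0 \<longleftrightarrow> s \<noteq> t)"
  shows "int n \<le> lie_index L V act"
proof -
  have bound: "vdim (dual_orbit \<xi>) + n \<le> vdim V" if \<xi>: "\<xi> \<in> carrier (dual_space V)" for \<xi>
  proof (rule ccontr)
    define N where "N = vdim (dual_orbit \<xi>)"
    assume "\<not> vdim (dual_orbit \<xi>) + n \<le> vdim V"
    then have less: "vdim V < N + n" by (simp add: N_def)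
    obtain C d where C: "frame (dual_orbit \<xi>) {..<N} C d"
      and Cx: "\<And>i. i < N \<Longrightarrow> \<exists>x\<in>carrier L. C i = (\<lambda>v\<in>carrier V. - \<xi> (act x v))"
      using dual_orbit_frame[OF \<xi>] unfolding N_def by blast
    interpret C: frame "dual_orbit \<xi>" "{..<N}" C d by (rule C)
    obtain z g where zg: "\<forall>t<n. z t \<in> carrier V \<and> (\<forall>x\<in>carrier L. \<xi> (act x (z t)) = 0) \<and>
        linear_on V (g t) \<and> (\<forall>s<n. g t (z s) = 0 \<longleftrightarrow> s \<noteq> t)"
      using inv[OF \<xi>] by (elim exE)
    then have z: "\<And>t. t < n \<Longrightarrow> z t \<in> carrier V"
        "\<And>t x. t < n \<Longrightarrow> x \<in> carrier L \<Longrightarrow> \<xi> (act x (z t)) = 0"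
      and g: "\<And>t. t < n \<Longrightarrow> linear_on V (g t)"
        "\<And>s t. s < n \<Longrightarrow> t < n \<Longrightarrow> g t (z s) = 0 \<longleftrightarrow> s \<noteq> t"
      by simp_all
    \<comment> \<open>If the orbit were too large, its basis and the \<open>g t\<close> would be
      more than \<open>vdim V\<close> functionals and so satisfy a relation. Evaluation at
      \<open>z t\<close> kills the orbit part and isolates the coefficient of \<open>g t\<close>;
      what is left is a relation inside the basis of the orbit.\<close>
    define \<psi> where "\<psi> s = (if s < N then C s else g (s - N))" for s
    have lin: "linear_on V (\<psi> s)" if "s < N + n" for s
    proof (cases "s < N")
      case True
      then have "C s \<in> carrier (dual_orbit \<xi>)" by (intro C.B_closed) auto
      then show ?thesis
        using True dual_orbit(2)[OF \<xi>] by (auto simp: \<psi>_def carrier_dual_space)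
    qed (use that g in \<open>auto simp: \<psi>_def\<close>)
    obtain c where c: "\<exists>s<N + n. c s \<noteq> 0"
      "\<And>j. j \<in> J \<Longrightarrow> (\<Sum>s<N + n. \<psi> s (B j) * c s) = 0"
      using nontrivial_kernel_vector[of J "{..<N + n}" "\<lambda>j s. \<psi> s (B j)"] F.finite_I less
        F.frame_dim(1) by (auto simp: lessThan_iff)
    have comb: "(\<Sum>s<N + n. c s * \<psi> s v) = 0" if v: "v \<in> carrier V" for v
    proof -
      have "(\<Sum>s<N + n. c s * \<psi> s v) = (\<Sum>s<N + n. \<Sum>j\<in>J. c s * (co j v * \<psi> s (B j)))"
        by (intro sum.cong refl)
          (subst F.linear_expand[OF lin v], auto simp: sum_distrib_left)
      also have "\<dots> = (\<Sum>j\<in>J. co j v * (\<Sum>s<N + n. \<psi> s (B j) * c s))"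
        by (subst sum.swap) (simp add: sum_distrib_left mult.commute mult.left_commute)
      finally show ?thesis using c(2) by simp
    qed
    have split: "(\<Sum>s<N + n. h s) = (\<Sum>s<N. h s) + (\<Sum>t<n. h (N + t))" for h :: "nat \<Rightarrow> 'a"
      by (induction n) (simp_all add: add.assoc)
    have gz: "c (N + t) = 0" if t: "t < n" for t
    proof -
      have "(\<Sum>s<N. c s * \<psi> s (z t)) = 0"
      proof (rule sum.neutral, rule ballI)
        fix s assume "s \<in> {..<N}"
        then obtain x where "x \<in> carrier L" "C s = (\<lambda>v\<in>carrier V. - \<xi> (act x v))"
          using Cx by blast
        then show "c s * \<psi> s (z t) = 0" using \<open>s \<in> {..<N}\<close> z t by (simp add: \<psi>_def)
      qed
      moreover have "(\<Sum>u<n. c (N + u) * \<psi> (N + u) (z t)) = c (N + t) * g t (z t)"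
      proof -
        have "(\<Sum>u<n. c (N + u) * \<psi> (N + u) (z t)) = (\<Sum>u\<in>{t}. c (N + u) * g u (z t))"
          using t g(2)[OF t] by (intro sum.mono_neutral_cong_right) (auto simp: \<psi>_def)
        then show ?thesis by simp
      qed
      ultimately have "c (N + t) * g t (z t) = 0"
        using comb[OF z(1)[OF t]] by (simp add: split)
      then show ?thesis using g(2)[OF t t] by simp
    qed
    have "C.vec c = \<zero>\<^bsub>dual_orbit \<xi>\<^esub>"
    proof -
      have mem: "C.vec c \<in> carrier (dual_space V)"
        using C.vec_closed dual_orbit(2)[OF \<xi>] by auto
      have "C.vec c (B j) = 0" if "j \<in> J" for j
      proof -
        have "linear_on (dual_orbit \<xi>) (\<lambda>f. f (B j))"
          by (intro linear_on_carrier linear_on_dual_eval F.B_closed that dual_orbit(2)[OF \<xi>])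
        from C.linear_vec[OF this, of c] have "C.vec c (B j) = (\<Sum>s<N. c s * \<psi> s (B j))"
          by (simp add: \<psi>_def)
        also have "\<dots> = 0"
          using comb[OF F.B_closed[OF that]] gz by (simp add: split)
        finally show ?thesis .
      qed
      from F.dual_zeroI[OF mem this] show ?thesis by simp
    qed
    then have "c s = 0" if "s < N" for s
      using C.co_vec[of s c] linear_on_zero[OF C.vs C.linear_co, of s] that by simp
    then have "c s = 0" if "s < N + n" for s
      using gz[of "s - N"] that by (cases "s < N") auto
    then show False using c(1) by blast
  qed
  define M where "M = (MAX \<xi>\<in>carrier (dual_space V). vdim (dual_orbit \<xi>))"
  have "M \<in> (\<lambda>\<xi>. vdim (dual_orbit \<xi>)) ` carrier (dual_space V)"
    unfolding M_def using finite_orbit_dims zero_in_dual by (intro Max_in) auto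
  then obtain \<xi> where \<xi>: "\<xi> \<in> carrier (dual_space V)" "M = vdim (dual_orbit \<xi>)"
    by (rule imageE) blast
  then have "M + n \<le> vdim V" using bound[OF \<xi>(1)] by simp
  then show ?thesis unfolding lie_index_def M_def[symmetric] by linarith
qed

end

end

section \<open>Matrices indexed by levels\<close>

text \<open>An index is a level and a position on that level; the row comes first. Quantifiers over
  such pairs are kept unsplit.\<close>

type_synonym 'a array = "nat \<times> nat \<Rightarrow> nat \<times> nat \<Rightarrow> 'a"

declare split_paired_All [simp del] split_paired_Ex [simp del]

locale levels =
  fixes m :: nat and r :: "nat \<Rightarrow> nat"
  assumes m_pos: "m > 0"
begin

definition I :: "(nat \<times> nat) set"
  where "I = {(i, j). i < m \<and> j < r i}"

lemma mem_I [simp]: "(i, j) \<in> I \<longleftrightarrow> i < m \<and> j < r i"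
  by (simp add: I_def)

lemma finite_I: "finite I"
proof -
  have "I = Sigma {..<m} (\<lambda>i. {..<r i})" by (auto simp: I_def)
  then show ?thesis by simp
qed

text \<open>The levels are cyclic and the position is kept. The result may leave \<open>I\<close>,
  as levels have different sizes; there the strip, that is the set of indices with a fixed position,
  breaks off.\<close>

definition up :: "nat \<times> nat \<Rightarrow> nat \<times> nat"
  where "up p = ((if Suc (fst p) < m then Suc (fst p) else 0), snd p)"

definition dn :: "nat \<times> nat \<Rightarrow> nat \<times> nat"
  where "dn p = ((if fst p = 0 then m - 1 else fst p - 1), snd p)"

lemma up_dn: "fst p < m \<Longrightarrow> up (dn p) = p"
  and dn_up: "fst p < m \<Longrightarrow> dn (up p) = p"
  by (auto simp: up_def dn_def prod_eq_iff)

lemma fst_up_less [simp]: "fst (up p) < m"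
  and snd_up [simp]: "snd (up p) = snd p" and snd_dn [simp]: "snd (dn p) = snd p"
  using m_pos by (auto simp: up_def dn_def)

lemma fst_dn_less [simp]: "fst p < m \<Longrightarrow> fst (dn p) < m"
  by (auto simp: dn_def)

lemma I_less: "p \<in> I \<Longrightarrow> fst p < m"
  by (cases p) simp

lemma up_eq_iff: "fst p < m \<Longrightarrow> fst q < m \<Longrightarrow> up p = q \<longleftrightarrow> p = dn q"
  using up_dn dn_up by metis

lemma up_iter: "fst p < m \<Longrightarrow> (up ^^ t) p = ((fst p + t) mod m, snd p)"
proof (induction t)
  case (Suc t)
  have "(fst p + t) mod m < m" using m_pos by simp
  then have "Suc ((fst p + t) mod m) < m \<or> Suc ((fst p + t) mod m) = m" by linarith
  then show ?case using Suc by (auto simp: up_def mod_Suc prod_eq_iff)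
qed (simp add: prod_eq_iff)

lemma dn_iter_up: "fst p < m \<Longrightarrow> (dn ^^ t) ((up ^^ t) p) = p"
proof (induction t arbitrary: p)
  case (Suc t)
  have "(dn ^^ Suc t) ((up ^^ Suc t) p) = dn ((dn ^^ t) ((up ^^ t) (up p)))"
    by (simp add: funpow_swap1)
  also have "\<dots> = p" using Suc.IH[of "up p"] Suc.prems by (simp add: dn_up)
  finally show ?case .
qed simp

lemma up_iter_m: "fst p < m \<Longrightarrow> (up ^^ m) p = p"
  by (simp add: up_iter prod_eq_iff)

lemma dn_iter_m: "fst p < m \<Longrightarrow> (dn ^^ m) p = p"
  using dn_iter_up[of p m] up_iter_m[of p] by simp

lemma up_iter_reaches:
  assumes "fst p < m" "i < m"
  obtains t where "(up ^^ t) p = (i, snd p)"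
proof
  show "(up ^^ (i + m - fst p)) p = (i, snd p)"
    using assms by (simp add: up_iter)
qed

lemma dn_iter_reaches:
  assumes "fst p < m" "i < m"
  obtains t where "(dn ^^ t) p = (i, snd p)"
proof -
  obtain t where "(up ^^ t) (i, snd p) = p"
    using up_iter_reaches[of "(i, snd p)" "fst p"] assms by auto
  then have "(dn ^^ t) p = (i, snd p)"
    using dn_iter_up[of "(i, snd p)" t] assms by simp
  then show thesis by (rule that)
qed

text \<open>A weighted shift along the strips: the basis vector at \<open>b\<close> goes to
  \<open>n b\<close> times the one at \<open>up b\<close>. Under \<open>valid n\<close> no arrow
  starts or ends at a missing position.\<close>

definition strip :: "(nat \<times> nat \<Rightarrow> 'a::field) \<Rightarrow> 'a array"
  where "strip n a b = (if a = up b then n b else 0)"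

definition valid :: "(nat \<times> nat \<Rightarrow> 'a::field) \<Rightarrow> bool"
  where "valid n \<longleftrightarrow> (\<forall>b. n b \<noteq> 0 \<longrightarrow> b \<in> I \<and> up b \<in> I)"

text \<open>\<open>comm n A\<close> is the entrywise form of \<open>A\<close> commuting with \<open>strip n\<close>.\<close>

definition comm :: "(nat \<times> nat \<Rightarrow> 'a::field) \<Rightarrow> 'a array \<Rightarrow> bool"
  where "comm n A \<longleftrightarrow> (\<forall>a\<in>I. \<forall>b\<in>I. A a (up b) * n b = n (dn a) * A (dn a) b)"

definition deg0 :: "'a::field array \<Rightarrow> bool"
  where "deg0 A \<longleftrightarrow> (\<forall>a b. A a b \<noteq> 0 \<longrightarrow> a \<in> I \<and> b \<in> I \<and> fst a = fst b)"

text \<open>Degree -1: each level is mapped to the preceding one, so that the trace pairs these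
  arrays with those of \<open>deg1\<close>.\<close>

definition degm :: "'a::field array \<Rightarrow> bool"
  where "degm A \<longleftrightarrow> (\<forall>a b. A a b \<noteq> 0 \<longrightarrow> a \<in> I \<and> b \<in> I \<and> fst a = fst (dn b))"

definition deg1 :: "'a::field array \<Rightarrow> bool"
  where "deg1 A \<longleftrightarrow> (\<forall>a b. A a b \<noteq> 0 \<longrightarrow> a \<in> I \<and> b \<in> I \<and> fst a = fst (up b))"

definition mm :: "'a::field array \<Rightarrow> 'a array \<Rightarrow> 'a array"
  where "mm A A' a b = (\<Sum>c\<in>I. A a c * A' c b)"

definition com :: "'a::field array \<Rightarrow> 'a array \<Rightarrow> 'a array"
  where "com A A' a b = mm A A' a b - mm A' A a b"

lemma mm_strip_right:
  assumes "valid n"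
  shows "mm A (strip n) a b = A a (up b) * n b"
proof (cases "up b \<in> I")
  case True
  have "mm A (strip n) a b = (\<Sum>c\<in>I. if c = up b then A a (up b) * n b else 0)"
    unfolding mm_def strip_def by (intro sum.cong) auto
  then show ?thesis using True finite_I by simp
next
  case False
  then have "n b = 0" using assms by (auto simp: valid_def)
  then show ?thesis unfolding mm_def strip_def by (auto intro!: sum.neutral)
qed

lemma mm_strip_left:
  assumes "valid n" "fst a < m"
  shows "mm (strip n) A a b = n (dn a) * A (dn a) b"
proof -
  have "mm (strip n) A a b = (\<Sum>c\<in>I. if c = dn a then n (dn a) * A (dn a) b else 0)"
    unfolding mm_def strip_def using assms(2) up_eq_iff[of _ a] I_less
    by (intro sum.cong) auto
  also have "\<dots> = n (dn a) * A (dn a) b"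
    using assms(1) finite_I by (auto simp: valid_def)
  finally show ?thesis .
qed

text \<open>\<open>comm\<close> tests positions in \<open>I\<close> only. Elsewhere both products
  vanish, by \<open>valid n\<close> and by the support of \<open>A\<close>.\<close>

lemma comm_iff:
  assumes "valid n" and "\<And>a b. A a b \<noteq> 0 \<Longrightarrow> a \<in> I \<and> b \<in> I"
  shows "comm n A \<longleftrightarrow> (\<forall>a b. com A (strip n) a b = 0)"
proof
  assume c: "comm n A"
  show "\<forall>a b. com A (strip n) a b = 0"
  proof (intro allI)
    fix a b
    show "com A (strip n) a b = 0"
    proof (cases "fst a < m")
      case False
      then have "a \<notin> I" using I_less by blast
      have "A a c = 0" for c using assms(2)[of a c] \<open>a \<notin> I\<close> by blast
      moreover have "strip n a c = 0" for c using False fst_up_less[of c] by (auto simp: strip_def)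
      ultimately show ?thesis by (simp add: com_def mm_def)
    next
      case True
      have "A a (up b) * n b = n (dn a) * A (dn a) b"
      proof (cases "a \<in> I \<and> b \<in> I")
        case False
        then consider "a \<notin> I" | "b \<notin> I" by blast
        then show ?thesis
        proof cases
          case 1
          then have "n (dn a) = 0" using assms(1) up_dn[OF True] by (auto simp: valid_def)
          moreover have "A a (up b) = 0" using 1 assms(2) by blast
          ultimately show ?thesis by simp
        next
          case 2
          have "A (dn a) b = 0" using 2 assms(2) by blast
          moreover have "n b = 0" using 2 assms(1) by (auto simp: valid_def)
          ultimately show ?thesis by simp
        qed
      qed (use c in \<open>auto simp: comm_def\<close>)
      then show ?thesis
        by (simp add: com_def mm_strip_left[OF assms(1) True] mm_strip_right[OF assms(1)])
    qed
  qed
next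
  assume "\<forall>a b. com A (strip n) a b = 0"
  then show "comm n A"
    using I_less by (auto simp: comm_def com_def mm_strip_left[OF assms(1)] mm_strip_right[OF assms(1)])
qed

lemma strip_deg1: "valid n \<Longrightarrow> deg1 (strip n)"
  by (auto simp: valid_def deg1_def strip_def)

text \<open>Commuting with a weighted shift ties an entry to the one a step back on both strips. If
  the arrow into the column index exists, a nonzero entry forces the arrow into the row index and a
  nonzero earlier entry. In \<open>comm_forw\<close> rows and columns exchange their roles.\<close>

lemma comm_back:
  assumes "valid n" "comm n A" "a \<in> I" "b \<in> I" "n (dn b) \<noteq> 0"
  shows "A a b * n (dn b) = n (dn a) * A (dn a) (dn b)"
proof -
  have "A a (up (dn b)) * n (dn b) = n (dn a) * A (dn a) (dn b)"
    using assms by (auto simp: comm_def valid_def)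
  then show ?thesis using assms(4) by (simp add: up_dn I_less)
qed

lemma comm_forw:
  assumes "valid n" "comm n A" "a \<in> I" "b \<in> I" "n a \<noteq> 0"
  shows "A (up a) (up b) * n b = n a * A a b"
proof -
  have "A (up a) (up b) * n b = n (dn (up a)) * A (dn (up a)) b"
    using assms by (auto simp: comm_def valid_def)
  then show ?thesis using assms(3) by (simp add: dn_up I_less)
qed

text \<open>Under \<open>H\<close> a nonzero entry between the strips \<open>l\<close> and
  \<open>j\<close> can be pushed back forever, so it travels around all levels. Hence both strips
  are complete cycles, and comparing the weights collected in one full turn gives the equality of
  m-th powers; \<open>cc\<close> is the common weight of the arrows of a strip.\<close>

lemma cycle_back:
  fixes A :: "'a::field array"
  assumes v: "valid n" and c: "comm n A"
    and H: "\<And>a b. \<lbrakk>a \<in> I; b \<in> I; snd a = l; snd b = j; A a b \<noteq> 0\<rbrakk> \<Longrightarrow> n (dn b) \<noteq> 0"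
    and const: "\<And>p. n p \<noteq> 0 \<Longrightarrow> n p = cc (snd p)"
    and ab: "a \<in> I" "b \<in> I" "snd a = l" "snd b = j" "A a b \<noteq> 0"
  shows "(\<forall>i<m. n (i, l) \<noteq> 0 \<and> n (i, j) \<noteq> 0) \<and> cc l ^ m = cc j ^ m"
proof -
  have step: "dn a \<in> I \<and> dn b \<in> I \<and> A (dn a) (dn b) \<noteq> 0 \<and> n (dn a) \<noteq> 0 \<and> n (dn b) \<noteq> 0 \<and>
      cc j * A a b = cc l * A (dn a) (dn b)"
    if ab: "a \<in> I" "b \<in> I" "snd a = l" "snd b = j" "A a b \<noteq> 0" for a b
  proof -
    have nb: "n (dn b) \<noteq> 0" by (rule H[OF ab])
    have eq: "A a b * n (dn b) = n (dn a) * A (dn a) (dn b)"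
      by (rule comm_back[OF v c ab(1,2) nb])
    then have nz: "n (dn a) \<noteq> 0" "A (dn a) (dn b) \<noteq> 0" using nb ab(5) by auto
    have "n (dn a) = cc l" "n (dn b) = cc j" using const[OF nb] const[OF nz(1)] ab by auto
    then show ?thesis using eq nz nb v by (auto simp: valid_def mult.commute)
  qed
  have iter: "(dn ^^ t) a \<in> I \<and> (dn ^^ t) b \<in> I \<and> A ((dn ^^ t) a) ((dn ^^ t) b) \<noteq> 0 \<and>
      snd ((dn ^^ t) a) = l \<and> snd ((dn ^^ t) b) = j \<and>
      cc j ^ t * A a b = cc l ^ t * A ((dn ^^ t) a) ((dn ^^ t) b)" for t
  proof (induction t)
    case (Suc t)
    from step[of "(dn ^^ t) a" "(dn ^^ t) b"] Suc show ?case
      by (simp add: algebra_simps)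
  qed (use ab in simp)
  have "n (i, l) \<noteq> 0 \<and> n (i, j) \<noteq> 0" if i: "i < m" for i
  proof -
    have lv: "fst (up (i, l)) < m" "fst a < m" "fst b < m" using I_less ab by auto
    obtain t where t: "(dn ^^ t) a = up (i, l)"
      using dn_iter_reaches[OF lv(2) lv(1)] ab(3) by (metis prod.collapse snd_conv snd_up)
    obtain t' where t': "(dn ^^ t') b = up (i, j)"
      using dn_iter_reaches[OF lv(3) fst_up_less[of "(i, j)"]] ab(4) by (metis prod.collapse snd_conv snd_up)
    have "n (dn (up (i, l))) \<noteq> 0" "n (dn (up (i, j))) \<noteq> 0"
      using step[of "(dn ^^ t) a" "(dn ^^ t) b"] iter[of t] t
        step[of "(dn ^^ t') a" "(dn ^^ t') b"] iter[of t'] t' by auto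
    then show ?thesis using i by (simp add: dn_up)
  qed
  moreover have "cc l ^ m = cc j ^ m"
    using iter[of m] ab I_less by (auto simp: dn_iter_m)
  ultimately show ?thesis by blast
qed

lemma cycle_forw:
  fixes A :: "'a::field array"
  assumes v: "valid n" and c: "comm n A"
    and H: "\<And>a b. \<lbrakk>a \<in> I; b \<in> I; snd a = l; snd b = j; A a b \<noteq> 0\<rbrakk> \<Longrightarrow> n a \<noteq> 0"
    and const: "\<And>p. n p \<noteq> 0 \<Longrightarrow> n p = cc (snd p)"
    and ab: "a \<in> I" "b \<in> I" "snd a = l" "snd b = j" "A a b \<noteq> 0"
  shows "(\<forall>i<m. n (i, l) \<noteq> 0 \<and> n (i, j) \<noteq> 0) \<and> cc l ^ m = cc j ^ m"
proof -
  have step: "up a \<in> I \<and> up b \<in> I \<and> A (up a) (up b) \<noteq> 0 \<and> n a \<noteq> 0 \<and> n b \<noteq> 0 \<and>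
      cc l * A a b = cc j * A (up a) (up b)"
    if ab: "a \<in> I" "b \<in> I" "snd a = l" "snd b = j" "A a b \<noteq> 0" for a b
  proof -
    have na: "n a \<noteq> 0" by (rule H[OF ab])
    have eq: "A (up a) (up b) * n b = n a * A a b"
      by (rule comm_forw[OF v c ab(1,2) na])
    then have nz: "n b \<noteq> 0" "A (up a) (up b) \<noteq> 0" using na ab(5) by auto
    have "n a = cc l" "n b = cc j" using const[OF na] const[OF nz(1)] ab by auto
    then show ?thesis using eq nz na v by (auto simp: valid_def mult.commute)
  qed
  have iter: "(up ^^ t) a \<in> I \<and> (up ^^ t) b \<in> I \<and> A ((up ^^ t) a) ((up ^^ t) b) \<noteq> 0 \<and>
      snd ((up ^^ t) a) = l \<and> snd ((up ^^ t) b) = j \<and>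
      cc l ^ t * A a b = cc j ^ t * A ((up ^^ t) a) ((up ^^ t) b)" for t
  proof (induction t)
    case (Suc t)
    from step[of "(up ^^ t) a" "(up ^^ t) b"] Suc show ?case
      by (simp add: algebra_simps)
  qed (use ab in simp)
  have "n (i, l) \<noteq> 0 \<and> n (i, j) \<noteq> 0" if i: "i < m" for i
  proof -
    obtain t where t: "(up ^^ t) a = (i, l)"
      using up_iter_reaches[of a i] i ab I_less by metis
    obtain t' where t': "(up ^^ t') b = (i, j)"
      using up_iter_reaches[of b i] i ab I_less by metis
    show ?thesis
      using step[of "(up ^^ t) a" "(up ^^ t) b"] iter[of t] t
        step[of "(up ^^ t') a" "(up ^^ t') b"] iter[of t'] t' by auto
  qed
  moreover have "cc l ^ m = cc j ^ m"
    using iter[of m] ab I_less by (auto simp: up_iter_m)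
  ultimately show ?thesis by blast
qed

text \<open>
  The generic element of degree 1: all composable strips, with distinct eigenvalues on the
  strips that close up to cycles.
\<close>

definition gen_coeff :: "nat \<times> nat \<Rightarrow> 'a::field_char_0"
  where "gen_coeff p = (if p \<in> I \<and> up p \<in> I then of_nat (Suc (snd p)) else 0)"

lemma valid_gen: "valid (gen_coeff :: nat \<times> nat \<Rightarrow> 'a::field_char_0)"
  by (auto simp: valid_def gen_coeff_def)

lemma gen_coeff_nz: "(gen_coeff p :: 'a::field_char_0) \<noteq> 0 \<longleftrightarrow> p \<in> I \<and> up p \<in> I"
  by (simp add: gen_coeff_def del: of_nat_Suc)

text \<open>Levels are nested: a position that exists on a level brings all smaller ones with it. So
  a nonzero entry from strip \<open>j\<close> to strip \<open>l\<close> can always be pushed on,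
  backwards if \<open>j \<le> l\<close> and forwards if \<open>l < j\<close>. By the cycle lemmas
  both strips are complete cycles, and their weights have equal m-th powers, whence
  \<open>l = j\<close>. Along one cycle the entries are constant and show up at level 0, where the
  assumptions make them vanish.\<close>

lemma generic_centraliser:
  fixes W :: "'a::field_char_0 array"
  assumes W: "degm W" "comm gen_coeff W"
    and k: "\<And>j. (\<forall>i<m. j < r i) \<Longrightarrow> j < k"
    and 0: "\<And>j. j < k \<Longrightarrow> W (dn (0, j)) (0, j) = 0"
  shows "W a b = 0"
proof (rule ccontr)
  assume nz: "W a b \<noteq> 0"
  obtain i j where b: "b = (i, j)" by fastforce
  obtain i' l where a: "a = (i', l)" by fastforce
  have ab: "a \<in> I" "b \<in> I" "snd a = l" "snd b = j"
    using nz W(1) a b by (auto simp: degm_def simp del: mem_I)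
  have const: "gen_coeff p = of_nat (Suc (snd p))" if "(gen_coeff p :: 'a) \<noteq> 0" for p
    using that by (auto simp: gen_coeff_def split: if_splits)
  have shape: "a \<in> I \<and> b \<in> I \<and> fst a = fst (dn b)" if "W a b \<noteq> 0" for a b
    using that W(1) by (auto simp: degm_def)
  note cyc = cycle_back[OF valid_gen W(2), of l j "\<lambda>j. of_nat (Suc j)"]
    cycle_forw[OF valid_gen W(2), of l j "\<lambda>j. of_nat (Suc j)"]
  have "(\<forall>i<m. (gen_coeff (i, l) :: 'a) \<noteq> 0 \<and> (gen_coeff (i, j) :: 'a) \<noteq> 0) \<and>
      (of_nat (Suc l) :: 'a) ^ m = of_nat (Suc j) ^ m"
  proof (cases "j \<le> l")
    case True
    show ?thesis
    proof (rule cyc(1)[OF _ const ab nz])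
      fix a b assume *: "a \<in> I" "b \<in> I" "snd a = l" "snd b = j" "W a b \<noteq> 0"
      then have "dn b \<in> I"
        using shape[OF *(5)] True I_less by (cases a; cases b) (auto simp: dn_def I_def)
      then show "(gen_coeff (dn b) :: 'a) \<noteq> 0"
        using * I_less[of b] by (auto simp: gen_coeff_nz up_dn simp del: mem_I)
    qed
  next
    case False
    show ?thesis
    proof (rule cyc(2)[OF _ const ab nz])
      fix a b assume *: "a \<in> I" "b \<in> I" "snd a = l" "snd b = j" "W a b \<noteq> 0"
      then have "up a = (fst b, l)"
        using shape[OF *(5)] up_dn[of b] I_less[of b]
        by (cases a; cases b) (simp add: up_def dn_def split: if_splits)
      then have "up a \<in> I" using * False by (cases b) simp
      then show "(gen_coeff a :: 'a) \<noteq> 0"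
        using * by (simp add: gen_coeff_nz del: mem_I)
    qed
  qed
  \<comment> \<open>In characteristic zero the equality of m-th powers is an equality of natural
    numbers, where it determines the base.\<close>
  then have all: "\<forall>i<m. (gen_coeff (i, j) :: 'a) \<noteq> 0" "Suc l ^ m = Suc j ^ m"
    unfolding of_nat_power[symmetric] of_nat_eq_iff by blast+
  have lj: "l = j" using all(2) m_pos power_eq_iff_eq_base[of m "Suc l" "Suc j"] by simp
  have "\<forall>i<m. j < r i" using all(1) by (simp add: gen_coeff_nz)
  then have jk: "j < k" by (rule k)
  have const_W: "W ((dn ^^ t) a) ((dn ^^ t) b) = W a b \<and> (dn ^^ t) a \<in> I \<and> (dn ^^ t) b \<in> I" for t
  proof (induction t)
    case (Suc t)
    let ?a = "(dn ^^ t) a" and ?b = "(dn ^^ t) b"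
    have s: "snd ?a = j" "snd ?b = j" using ab lj by (induction t) auto
    have lt: "fst ?a < m" "fst ?b < m" using Suc I_less by auto
    have nz': "(gen_coeff (dn ?a) :: 'a) \<noteq> 0" "(gen_coeff (dn ?b) :: 'a) \<noteq> 0"
      using all(1) fst_dn_less[OF lt(1)] fst_dn_less[OF lt(2)] s by (metis prod.collapse snd_dn)+
    have "W ?a ?b * gen_coeff (dn ?b) = gen_coeff (dn ?a) * W (dn ?a) (dn ?b)"
      using Suc nz' by (intro comm_back[OF valid_gen W(2)]) auto
    moreover have "(gen_coeff (dn ?a) :: 'a) = gen_coeff (dn ?b)"
      unfolding const[OF nz'(1)] const[OF nz'(2)] by (simp only: snd_dn s)
    ultimately show ?case using Suc nz' valid_gen[where ?'a = 'a] by (auto simp: valid_def)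
  qed (use ab in simp)
  obtain t where t: "(dn ^^ t) b = (0, j)"
    using dn_iter_reaches[of b 0] ab m_pos I_less by metis
  have "snd ((dn ^^ t) a) = j" using ab lj by (induction t) auto
  moreover have "fst ((dn ^^ t) a) = fst (dn (0, j))"
    using shape[of "(dn ^^ t) a" "(dn ^^ t) b"] const_W[of t] nz t by auto
  ultimately have "(dn ^^ t) a = dn (0, j)" by (simp add: prod_eq_iff)
  then show False using const_W[of t] 0[OF jk] nz t by simp
qed

section \<open>Invariants of the stabiliser\<close>

text \<open>The space Z of the overview, for v given by \<open>strip n\<close>. The stabiliser of
  the same v in degree 0 is \<open>stab n\<close>.\<close>

definition cent :: "(nat \<times> nat \<Rightarrow> 'a::field) \<Rightarrow> 'a array set"
  where "cent n = {w. degm w \<and> comm n w}"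

definition stab :: "(nat \<times> nat \<Rightarrow> 'a::field) \<Rightarrow> 'a array set"
  where "stab n = {x. deg0 x \<and> comm n x}"

text \<open>Linearity is asked on \<open>cent n\<close> only: the form will come from the dual of
  the slice, and it is the elements of the centraliser that give functionals there.\<close>

definition linear_cent :: "(nat \<times> nat \<Rightarrow> 'a::field) \<Rightarrow> ('a array \<Rightarrow> 'a) \<Rightarrow> bool"
  where
  "linear_cent n \<zeta> \<longleftrightarrow>
    (\<forall>w\<in>cent n. \<forall>w'\<in>cent n. \<zeta> (\<lambda>a b. w a b + w' a b) = \<zeta> w + \<zeta> w') \<and>
    (\<forall>c. \<forall>w\<in>cent n. \<zeta> (\<lambda>a b. c * w a b) = c * \<zeta> w)"

text \<open>Inside Z, the annihilator of the orbit of \<zeta> under the stabiliser; its dimension is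
  what the index of the slice counts.\<close>

definition inv_under :: "(nat \<times> nat \<Rightarrow> 'a::field) \<Rightarrow> ('a array \<Rightarrow> 'a) \<Rightarrow> 'a array \<Rightarrow> bool"
  where "inv_under n \<zeta> w \<longleftrightarrow> w \<in> cent n \<and> (\<forall>x\<in>stab n. \<zeta> (com x w) = 0)"

definition unit :: "nat \<times> nat \<Rightarrow> nat \<times> nat \<Rightarrow> 'a::field array"
  where "unit p q a b = (if a = p \<and> b = q then 1 else 0)"

lemma cent_zero: "(\<lambda>a b. 0) \<in> cent n"
  by (simp add: cent_def degm_def comm_def)

lemma cent_add:
  assumes "w \<in> cent n" "w' \<in> cent n"
  shows "(\<lambda>a b. w a b + w' a b) \<in> cent n"
proof -
  have "a \<in> I \<and> b \<in> I \<and> fst a = fst (dn b)" if "w a b + w' a b \<noteq> 0" for a b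
  proof -
    from that have "w a b \<noteq> 0 \<or> w' a b \<noteq> 0" by auto
    then show ?thesis using assms unfolding cent_def degm_def by blast
  qed
  then show ?thesis using assms by (simp add: cent_def degm_def comm_def algebra_simps)
qed

lemma cent_scale: "w \<in> cent n \<Longrightarrow> (\<lambda>a b. c * w a b) \<in> cent n"
  by (auto simp: cent_def degm_def comm_def algebra_simps)

lemma linear_cent_zero: "linear_cent n \<zeta> \<Longrightarrow> \<zeta> (\<lambda>a b. 0) = 0"
proof -
  assume "linear_cent n \<zeta>"
  then have "\<forall>c. \<forall>w\<in>cent n. \<zeta> (\<lambda>a b. c * w a b) = c * \<zeta> w" by (simp add: linear_cent_def)
  from this[rule_format, OF cent_zero, of 0] show ?thesis by simp
qed

lemma cent_lincomb:
  assumes lin: "linear_cent n \<zeta>" and "finite P" and "\<And>p. p \<in> P \<Longrightarrow> u p \<in> cent n"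
  shows "(\<lambda>a b. \<Sum>p\<in>P. c p * u p a b) \<in> cent n \<and>
    \<zeta> (\<lambda>a b. \<Sum>p\<in>P. c p * u p a b) = (\<Sum>p\<in>P. c p * \<zeta> (u p))"
  using assms(2,3)
proof (induction P rule: finite_induct)
  case empty
  then show ?case using cent_zero linear_cent_zero[OF lin] by simp
next
  case (insert q P)
  define W where "W = (\<lambda>a b. \<Sum>p\<in>P. c p * u p a b)"
  have W: "W \<in> cent n" "\<zeta> W = (\<Sum>p\<in>P. c p * \<zeta> (u p))"
    using insert by (auto simp: W_def)
  have q: "u q \<in> cent n" using insert by auto
  have e: "(\<lambda>a b. \<Sum>p\<in>insert q P. c p * u p a b) = (\<lambda>a b. c q * u q a b + W a b)"
    using insert by (simp add: W_def)
  have "\<zeta> (\<lambda>a b. c q * u q a b + W a b) = \<zeta> (\<lambda>a b. c q * u q a b) + \<zeta> W"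
    using lin cent_scale[OF q] W(1) by (simp add: linear_cent_def)
  also have "\<zeta> (\<lambda>a b. c q * u q a b) = c q * \<zeta> (u q)"
    using lin q by (simp add: linear_cent_def)
  finally show ?case
    unfolding e using cent_add[OF cent_scale[OF q] W(1)] W(2) insert by simp
qed

text \<open>The matrix unit takes \<open>q\<close> to \<open>p\<close>. Both products with
  \<open>strip n\<close> vanish: \<open>p\<close> is killed since \<open>n p = 0\<close>, and
  nothing arrives at \<open>q\<close> since \<open>n (dn q) = 0\<close>.\<close>

lemma unit_cent:
  assumes v: "valid n" and pq: "p \<in> I" "q \<in> I" "fst p = fst (dn q)" "n p = 0" "n (dn q) = 0"
  shows "unit p q \<in> cent n"
proof -
  have "unit p q a (up b) * n b = n (dn a) * unit p q (dn a) b" if "a \<in> I" "b \<in> I" for a b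
  proof -
    have "unit p q a (up b) * n b = 0"
      using pq(5) dn_up[OF I_less[OF that(2)]] by (auto simp: unit_def)
    moreover have "n (dn a) * unit p q (dn a) b = 0"
      using pq(4) by (auto simp: unit_def)
    ultimately show ?thesis by (simp only:)
  qed
  moreover have "degm (unit p q :: 'a array)" using pq by (simp add: degm_def unit_def)
  ultimately show ?thesis by (simp add: cent_def comm_def)
qed

lemma mm_unit:
  assumes "p \<in> I" "q \<in> I"
  shows "mm x (unit p q) a b = (if b = q then x a p else 0)"
    and "mm (unit p q) x a b = (if a = p then x q b else 0)"
proof -
  have "mm x (unit p q) a b = (\<Sum>c\<in>I. if c = p then (if b = q then x a p else 0) else 0)"
    unfolding mm_def unit_def by (intro sum.cong) auto
  then show "mm x (unit p q) a b = (if b = q then x a p else 0)" using assms finite_I by simp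
  have "mm (unit p q) x a b = (\<Sum>c\<in>I. if c = q then (if a = p then x q b else 0) else 0)"
    unfolding mm_def unit_def by (intro sum.cong) auto
  then show "mm (unit p q) x a b = (if a = p then x q b else 0)" using assms finite_I by simp
qed

lemma com_lincomb:
  "com x (\<lambda>a b. \<Sum>p\<in>P. c p * u p a b) = (\<lambda>a b. \<Sum>p\<in>P. c p * com x (u p) a b)"
proof (intro ext)
  fix a b
  have "mm x (\<lambda>a b. \<Sum>p\<in>P. c p * u p a b) a b = (\<Sum>p\<in>P. c p * mm x (u p) a b)"
    unfolding mm_def by (simp add: sum_distrib_left mult.left_commute) (rule sum.swap)
  moreover have "mm (\<lambda>a b. \<Sum>p\<in>P. c p * u p a b) x a b = (\<Sum>p\<in>P. c p * mm (u p) x a b)"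
    unfolding mm_def
    by (simp add: sum_distrib_left sum_distrib_right mult.assoc) (rule sum.swap)
  ultimately show "com x (\<lambda>a b. \<Sum>p\<in>P. c p * u p a b) a b = (\<Sum>p\<in>P. c p * com x (u p) a b)"
    by (simp add: com_def sum_subtractf[symmetric] right_diff_distrib)
qed

text \<open>
  Along a path of levels carrying subspaces \<open>T 0, \<dots>, T N\<close> that the stabiliser preserves, with
  \<open>T 0\<close> and \<open>T N\<close> lines on which it acts by the same scalar, \<open>\<zeta>\<close> restricts to maps
  \<open>\<eta>\<^sub>i : T (i - 1) \<rightarrow> T i\<close>. Pushing a vector \<open>\<alpha>\<close> forward along the \<open>\<eta>\<^sub>i\<close> until it dies and pulling
  a covector \<open>\<beta>\<close> back from there, the rank one maps \<open>\<alpha>\<^sub>i\<^sub>-\<^sub>1 \<otimes> \<beta>\<^sub>i : T i \<rightarrow> T (i - 1)\<close> add up to an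
  invariant element, since \<open>\<zeta> (com x w)\<close> telescopes.
\<close>

lemma chain_invariant:
  fixes n :: "nat \<times> nat \<Rightarrow> 'a::field" and T :: "nat \<Rightarrow> nat set"
  assumes v: "valid n" and lin: "linear_cent n \<zeta>"
    and N: "N \<ge> 1" and inj: "inj_on lev {..N}"
    and succ: "\<And>i j. \<lbrakk>1 \<le> i; i \<le> N\<rbrakk> \<Longrightarrow> dn (lev i, j) = (lev (i - 1), j)"
    and fin: "\<And>i. i \<le> N \<Longrightarrow> finite (T i)" and ne: "\<And>i. i \<le> N \<Longrightarrow> T i \<noteq> {}"
    and ends: "T 0 = {\<tau>}" "T N = {\<tau>'}"
    and TI: "\<And>i j. \<lbrakk>i \<le> N; j \<in> T i\<rbrakk> \<Longrightarrow> (lev i, j) \<in> I"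
    and n0: "\<And>i l. \<lbrakk>i < N; l \<in> T i\<rbrakk> \<Longrightarrow> n (lev i, l) = 0"
    and n0': "\<And>i j. \<lbrakk>i < N; j \<in> T (Suc i)\<rbrakk> \<Longrightarrow> n (lev i, j) = 0"
    and col: "\<And>x i l l'. \<lbrakk>x \<in> stab n; i < N; l \<in> T i; l' \<notin> T i\<rbrakk> \<Longrightarrow> x (lev i, l') (lev i, l) = 0"
    and row: "\<And>x i j j'. \<lbrakk>x \<in> stab n; i < N; j \<in> T (Suc i); j' \<notin> T (Suc i)\<rbrakk> \<Longrightarrow>
      x (lev (Suc i), j) (lev (Suc i), j') = 0"
    and scalar: "\<And>x. x \<in> stab n \<Longrightarrow> x (lev 0, \<tau>) (lev 0, \<tau>) = x (lev N, \<tau>') (lev N, \<tau>')"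
  shows "\<exists>w. inv_under n \<zeta> w \<and> (\<exists>a b. w a b \<noteq> 0) \<and>
    (\<forall>a b. w a b \<noteq> 0 \<longrightarrow> (\<exists>i<N. \<exists>l\<in>T i. \<exists>j\<in>T (Suc i). a = (lev i, l) \<and> b = (lev (Suc i), j)))"
proof -
  define U :: "nat \<times> nat \<times> nat \<Rightarrow> 'a array"
    where "U = (\<lambda>(i, l, j). unit (lev i, l) (lev (Suc i), j))"
  \<comment> \<open>The matrix unit leads from level \<open>Suc i\<close> back to level
    \<open>i\<close>; the values of \<zeta> on these units are the entries of a map in the opposite
    direction.\<close>
  define \<eta> where "\<eta> i l j = \<zeta> (U (i, l, j))" for i l j
  have Uc: "U (i, l, j) \<in> cent n" if "i < N" "l \<in> T i" "j \<in> T (Suc i)" for i l j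
  proof -
    have "dn (lev (Suc i), j) = (lev i, j)" using succ[of "Suc i" j] that by simp
    then show ?thesis
      unfolding U_def prod.case using that
      by (intro unit_cent[OF v]) (simp_all add: TI n0 n0' del: mem_I)
  qed
  define \<alpha> where "\<alpha> = rec_nat (\<lambda>_. 1) (\<lambda>i f j. \<Sum>l\<in>T i. \<eta> i l j * f l)"
  have \<alpha>0: "\<alpha> 0 l = 1" and \<alpha>S: "\<alpha> (Suc i) j = (\<Sum>l\<in>T i. \<eta> i l j * \<alpha> i l)" for i j l
    by (simp_all add: \<alpha>_def)
  \<comment> \<open>The search starts at 1 because \<open>\<alpha> 0\<close> is nonzero. Thus
    \<open>\<alpha> (M - 1)\<close> does not vanish on \<open>T (M - 1)\<close>, which makes
    \<open>w\<close> nonzero.\<close>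
  define M where "M = (LEAST i. 1 \<le> i \<and> (i = N \<or> (\<forall>j\<in>T i. \<alpha> i j = 0)))"
  have M: "1 \<le> M" "M = N \<or> (\<forall>j\<in>T M. \<alpha> M j = 0)" "M \<le> N"
    using LeastI[of "\<lambda>i. 1 \<le> i \<and> (i = N \<or> (\<forall>j\<in>T i. \<alpha> i j = 0))" N]
      Least_le[of "\<lambda>i. 1 \<le> i \<and> (i = N \<or> (\<forall>j\<in>T i. \<alpha> i j = 0))" N] N
    unfolding M_def by auto
  have last: "\<exists>l\<in>T (M - 1). \<alpha> (M - 1) l \<noteq> 0"
  proof (cases "M = 1")
    case True
    then show ?thesis using ne[of 0] by (auto simp: \<alpha>0)
  next
    case False
    then have "\<not> (1 \<le> M - 1 \<and> (M - 1 = N \<or> (\<forall>j\<in>T (M - 1). \<alpha> (M - 1) j = 0)))"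
      using M(1) unfolding M_def by (intro not_less_Least) auto
    then show ?thesis using False M(1) by auto
  qed
  obtain j0 where j0: "j0 \<in> T M" using ne[of M] M(3) by auto
  \<comment> \<open>The covector is pulled back from \<open>M\<close>, so the recursion runs over
    the distance \<open>d\<close> to \<open>M\<close>. It starts with one coordinate function on
    \<open>T M\<close>.\<close>
  define \<beta>' where "\<beta>' = rec_nat (\<lambda>j. if j = j0 then 1 else 0)
      (\<lambda>d f l. \<Sum>j\<in>T (M - d). \<eta> (M - Suc d) l j * f j)"
  define \<beta> where "\<beta> i = \<beta>' (M - i)" for i
  have \<beta>M: "\<beta> M j = (if j = j0 then 1 else 0)" for j by (simp add: \<beta>_def \<beta>'_def)
  have \<beta>S: "\<beta> i l = (\<Sum>j\<in>T (Suc i). \<eta> i l j * \<beta> (Suc i) j)" if "i < M" for i l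
  proof -
    have "M - i = Suc (M - Suc i)" using that by simp
    then show ?thesis using that by (simp add: \<beta>_def \<beta>'_def)
  qed
  define P where "P = (SIGMA i:{..<M}. T i \<times> T (Suc i))"
  have finP: "finite P" using fin M(3) unfolding P_def by (intro finite_SigmaI finite_cartesian_product) auto
  define cf where "cf = (\<lambda>(i, l, j). \<alpha> i l * \<beta> (Suc i) j)"
  define w where "w = (\<lambda>a b. \<Sum>p\<in>P. cf p * U p a b)"
  have UP: "U p \<in> cent n" if "p \<in> P" for p
    using that Uc M(3) by (auto simp: P_def)
  have wc: "w \<in> cent n"
    using cent_lincomb[where u = U and c = cf, OF lin finP UP] unfolding w_def by blast
  have supp: "\<exists>i<N. \<exists>l\<in>T i. \<exists>j\<in>T (Suc i). a = (lev i, l) \<and> b = (lev (Suc i), j)"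
    if "w a b \<noteq> 0" for a b
  proof -
    obtain p where "p \<in> P" "cf p * U p a b \<noteq> 0"
      using \<open>w a b \<noteq> 0\<close> unfolding w_def by (meson sum.not_neutral_contains_not_neutral)
    then show ?thesis using M(3) by (auto simp: P_def U_def unit_def split: if_splits intro: less_le_trans)
  qed
  have nonzero: "\<exists>a b. w a b \<noteq> 0"
  proof -
    obtain l where l: "l \<in> T (M - 1)" "\<alpha> (M - 1) l \<noteq> 0" using last by blast
    have M1: "Suc (M - 1) = M" using M(1) by simp
    define q where "q = (M - 1, l, j0)"
    have qP: "q \<in> P" using l j0 M(1) M1 by (simp add: q_def P_def)
    have "w (lev (M - 1), l) (lev M, j0) = (\<Sum>p\<in>P. if p = q then cf p else 0)"
      unfolding w_def
    proof (intro sum.cong refl)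
      fix p assume p: "p \<in> P"
      obtain i l' j' where ip: "p = (i, l', j')" by (cases p)
      then have i: "i \<le> N" "Suc i \<le> N" using p M(3) by (auto simp: P_def)
      have "lev i = lev (M - 1) \<longleftrightarrow> i = M - 1"
        using inj_onD[OF inj] i M(3) by fastforce
      moreover have "lev (Suc i) = lev M \<longleftrightarrow> Suc i = M"
        using inj_onD[OF inj] i M(3) by fastforce
      ultimately show "cf p * U p (lev (M - 1), l) (lev M, j0) = (if p = q then cf p else 0)"
        using M1 by (auto simp: ip q_def U_def unit_def)
    qed
    then have "w (lev (M - 1), l) (lev M, j0) = cf q" using finP qP by simp
    also have "\<dots> \<noteq> 0" using l M1 \<beta>M by (simp add: cf_def q_def)
    finally show ?thesis by blast
  qed
  have inv: "\<zeta> (com x w) = 0" if x: "x \<in> stab n" for x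
  proof -
    define X where "X i l l' = x (lev i, l) (lev i, l')" for i l l'
    \<comment> \<open>The two halves of the commutator of \<open>x\<close> with a matrix unit. By
      \<open>col\<close> and \<open>row\<close> each half is a combination of the units
      \<open>U\<close>, so each lies in \<open>cent n\<close> and \<zeta> applies to it
      separately.\<close>
    define D1 :: "nat \<times> nat \<times> nat \<Rightarrow> 'a array"
      where "D1 = (\<lambda>(i, l, j) a b. \<Sum>l'\<in>T i. X i l' l * U (i, l', j) a b)"
    define D2 :: "nat \<times> nat \<times> nat \<Rightarrow> 'a array"
      where "D2 = (\<lambda>(i, l, j) a b. \<Sum>j'\<in>T (Suc i). X (Suc i) j j' * U (i, l, j') a b)"
    have deg: "a \<in> I \<and> b \<in> I \<and> fst a = fst b" if "x a b \<noteq> 0" for a b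
      using x that by (auto simp: stab_def deg0_def)
    have D: "com x (U p) = (\<lambda>a b. D1 p a b + (-1) * D2 p a b)"
      "D1 p \<in> cent n" "D2 p \<in> cent n"
      "\<zeta> (D1 p) = (case p of (i, l, j) \<Rightarrow> \<Sum>l'\<in>T i. X i l' l * \<eta> i l' j)"
      "\<zeta> (D2 p) = (case p of (i, l, j) \<Rightarrow> \<Sum>j'\<in>T (Suc i). X (Suc i) j j' * \<eta> i l j')"
      if p: "p \<in> P" for p
    proof -
      obtain i l j where ip: "p = (i, l, j)" by (cases p)
      then have i: "i < N" "l \<in> T i" "j \<in> T (Suc i)" "i < M" using p M(3) by (auto simp: P_def)
      have I: "(lev i, l) \<in> I" "(lev (Suc i), j) \<in> I"
        using TI[of i l] TI[of "Suc i" j] i by auto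
      have c1: "D1 p a b = (if b = (lev (Suc i), j) then x a (lev i, l) else 0)" for a b
      proof (cases "b = (lev (Suc i), j) \<and> fst a = lev i \<and> snd a \<in> T i")
        case True
        have "D1 p a b = (\<Sum>l'\<in>T i. if l' = snd a then X i l' l else 0)"
          unfolding D1_def ip prod.case U_def using True
          by (intro sum.cong) (auto simp: unit_def prod_eq_iff)
        then show ?thesis using True fin[of i] i by (simp add: X_def)  (metis prod.collapse)
      next
        case False
        have "D1 p a b = 0"
          unfolding D1_def ip prod.case U_def using False
          by (intro sum.neutral) (auto simp: unit_def)
        moreover have "x a (lev i, l) = 0" if "b = (lev (Suc i), j)"
        proof (rule ccontr)
          assume nz: "x a (lev i, l) \<noteq> 0"
          then have "fst a = lev i" using deg by fastforce
          then have "snd a \<notin> T i" "a = (lev i, snd a)" using False that by (auto simp: prod_eq_iff)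
          then show False using col[OF x i(1,2), of "snd a"] nz by simp
        qed
        ultimately show ?thesis by simp
      qed
      have c2: "D2 p a b = (if a = (lev i, l) then x (lev (Suc i), j) b else 0)" for a b
      proof (cases "a = (lev i, l) \<and> fst b = lev (Suc i) \<and> snd b \<in> T (Suc i)")
        case True
        have "D2 p a b = (\<Sum>j'\<in>T (Suc i). if j' = snd b then X (Suc i) j j' else 0)"
          unfolding D2_def ip prod.case U_def using True
          by (intro sum.cong) (auto simp: unit_def prod_eq_iff)
        then show ?thesis using True fin[of "Suc i"] i by (simp add: X_def) (metis prod.collapse)
      next
        case False
        have "D2 p a b = 0"
          unfolding D2_def ip prod.case U_def using False
          by (intro sum.neutral) (auto simp: unit_def)
        moreover have "x (lev (Suc i), j) b = 0" if "a = (lev i, l)"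
        proof (rule ccontr)
          assume nz: "x (lev (Suc i), j) b \<noteq> 0"
          then have "fst b = lev (Suc i)" using deg by fastforce
          then have "snd b \<notin> T (Suc i)" "b = (lev (Suc i), snd b)"
            using False that by (auto simp: prod_eq_iff)
          then show False using row[OF x i(1,3), of "snd b"] nz by simp
        qed
        ultimately show ?thesis by simp
      qed
      show "com x (U p) = (\<lambda>a b. D1 p a b + (-1) * D2 p a b)"
        by (intro ext) (simp add: com_def c1 c2, simp add: ip U_def mm_unit[OF I])
      have "D1 p \<in> cent n \<and> \<zeta> (D1 p) = (\<Sum>l'\<in>T i. X i l' l * \<zeta> (U (i, l', j)))"
        unfolding D1_def ip prod.case using i fin[of i]
        by (intro cent_lincomb[OF lin] Uc) auto
      then show "D1 p \<in> cent n"
        "\<zeta> (D1 p) = (case p of (i, l, j) \<Rightarrow> \<Sum>l'\<in>T i. X i l' l * \<eta> i l' j)"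
        by (simp_all add: ip \<eta>_def)
      have "D2 p \<in> cent n \<and> \<zeta> (D2 p) = (\<Sum>j'\<in>T (Suc i). X (Suc i) j j' * \<zeta> (U (i, l, j')))"
        unfolding D2_def ip prod.case using i fin[of "Suc i"]
        by (intro cent_lincomb[OF lin] Uc) auto
      then show "D2 p \<in> cent n"
        "\<zeta> (D2 p) = (case p of (i, l, j) \<Rightarrow> \<Sum>j'\<in>T (Suc i). X (Suc i) j j' * \<eta> i l j')"
        by (simp_all add: ip \<eta>_def)
    qed
    have CU: "com x (U p) \<in> cent n" "\<zeta> (com x (U p)) = \<zeta> (D1 p) - \<zeta> (D2 p)" if p: "p \<in> P" for p
    proof -
      define D' where "D' = (\<lambda>a b. (-1) * D2 p a b)"
      have D': "D' \<in> cent n" unfolding D'_def by (rule cent_scale[OF D(3)[OF p]])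
      have e: "com x (U p) = (\<lambda>a b. D1 p a b + D' a b)" using D(1)[OF p] by (simp add: D'_def)
      show "com x (U p) \<in> cent n" unfolding e by (rule cent_add[OF D(2)[OF p] D'])
      have "\<zeta> (com x (U p)) = \<zeta> (D1 p) + \<zeta> D'"
        unfolding e using lin D(2)[OF p] D' by (simp add: linear_cent_def)
      also have "\<zeta> D' = (-1) * \<zeta> (D2 p)"
        unfolding D'_def using lin D(3)[OF p] unfolding linear_cent_def by blast
      finally show "\<zeta> (com x (U p)) = \<zeta> (D1 p) - \<zeta> (D2 p)" by simp
    qed
    \<comment> \<open>The covector \<open>\<beta> i\<close> evaluated at \<open>x\<close> applied to
      \<open>\<alpha> i\<close>. The two halves of the commutator at step \<open>i\<close>
      contribute \<open>Q i\<close> and \<open>Q (Suc i)\<close>.\<close>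
    define Q where "Q i = (\<Sum>l\<in>T i. \<Sum>l'\<in>T i. \<beta> i l' * X i l' l * \<alpha> i l)" for i
    have "\<zeta> (com x w) = (\<Sum>p\<in>P. cf p * \<zeta> (com x (U p)))"
      unfolding w_def com_lincomb using cent_lincomb[where u = "\<lambda>p. com x (U p)" and c = cf, OF lin finP CU(1)] by blast
    also have "\<dots> = (\<Sum>p\<in>P. cf p * (\<zeta> (D1 p) - \<zeta> (D2 p)))"
      by (intro sum.cong) (simp_all add: CU)
    also have "\<dots> = (\<Sum>(i, l, j)\<in>P. \<alpha> i l * \<beta> (Suc i) j *
        ((\<Sum>l'\<in>T i. X i l' l * \<eta> i l' j) - (\<Sum>j'\<in>T (Suc i). X (Suc i) j j' * \<eta> i l j')))"
      by (intro sum.cong) (auto simp: D cf_def)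
    also have "\<dots> = (\<Sum>i<M. \<Sum>(l, j)\<in>T i \<times> T (Suc i). \<alpha> i l * \<beta> (Suc i) j *
        ((\<Sum>l'\<in>T i. X i l' l * \<eta> i l' j) - (\<Sum>j'\<in>T (Suc i). X (Suc i) j j' * \<eta> i l j')))"
      unfolding P_def using fin M(3) by (subst sum.Sigma) auto
    also have "\<dots> = (\<Sum>i<M. Q i - Q (Suc i))"
    proof (intro sum.cong refl)
      fix i assume "i \<in> {..<M}"
      then have i: "i < M" by simp
      have "(\<Sum>(l, j)\<in>T i \<times> T (Suc i). \<alpha> i l * \<beta> (Suc i) j * (\<Sum>l'\<in>T i. X i l' l * \<eta> i l' j))
          = (\<Sum>l\<in>T i. \<Sum>j\<in>T (Suc i). \<Sum>l'\<in>T i. \<alpha> i l * \<beta> (Suc i) j * (X i l' l * \<eta> i l' j))"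
        by (simp add: sum.cartesian_product[symmetric] sum_distrib_left)
      also have "\<dots> = (\<Sum>l\<in>T i. \<Sum>l'\<in>T i. \<Sum>j\<in>T (Suc i). \<alpha> i l * \<beta> (Suc i) j * (X i l' l * \<eta> i l' j))"
        by (intro sum.cong refl sum.swap)
      also have "\<dots> = Q i"
        unfolding Q_def using i
        by (intro sum.cong refl) (simp add: \<beta>S sum_distrib_left sum_distrib_right mult_ac)
      finally have 1: "(\<Sum>(l, j)\<in>T i \<times> T (Suc i). \<alpha> i l * \<beta> (Suc i) j *
          (\<Sum>l'\<in>T i. X i l' l * \<eta> i l' j)) = Q i" .
      have "(\<Sum>(l, j)\<in>T i \<times> T (Suc i). \<alpha> i l * \<beta> (Suc i) j * (\<Sum>j'\<in>T (Suc i). X (Suc i) j j' * \<eta> i l j'))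
          = (\<Sum>l\<in>T i. \<Sum>j\<in>T (Suc i). \<Sum>j'\<in>T (Suc i). \<alpha> i l * \<beta> (Suc i) j * (X (Suc i) j j' * \<eta> i l j'))"
        by (simp add: sum.cartesian_product[symmetric] sum_distrib_left)
      also have "\<dots> = (\<Sum>j\<in>T (Suc i). \<Sum>l\<in>T i. \<Sum>j'\<in>T (Suc i). \<alpha> i l * \<beta> (Suc i) j * (X (Suc i) j j' * \<eta> i l j'))"
        by (rule sum.swap)
      also have "\<dots> = (\<Sum>j\<in>T (Suc i). \<Sum>j'\<in>T (Suc i). \<Sum>l\<in>T i. \<alpha> i l * \<beta> (Suc i) j * (X (Suc i) j j' * \<eta> i l j'))"
        by (intro sum.cong refl sum.swap)
      also have "\<dots> = (\<Sum>j\<in>T (Suc i). \<Sum>j'\<in>T (Suc i). \<beta> (Suc i) j * X (Suc i) j j' * \<alpha> (Suc i) j')"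
        by (intro sum.cong refl) (simp add: \<alpha>S sum_distrib_left sum_distrib_right mult_ac)
      also have "\<dots> = Q (Suc i)" unfolding Q_def by (rule sum.swap)
      finally have 2: "(\<Sum>(l, j)\<in>T i \<times> T (Suc i). \<alpha> i l * \<beta> (Suc i) j *
          (\<Sum>j'\<in>T (Suc i). X (Suc i) j j' * \<eta> i l j')) = Q (Suc i)" .
      show "(\<Sum>(l, j)\<in>T i \<times> T (Suc i). \<alpha> i l * \<beta> (Suc i) j *
          ((\<Sum>l'\<in>T i. X i l' l * \<eta> i l' j) - (\<Sum>j'\<in>T (Suc i). X (Suc i) j j' * \<eta> i l j'))) = Q i - Q (Suc i)"
        unfolding 1[symmetric] 2[symmetric] sum_subtractf[symmetric]
        by (intro sum.cong refl) (auto simp: right_diff_distrib)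
    qed
    also have "\<dots> = Q 0 - Q M"
      using sum_lessThan_telescope'[of Q M] by simp
    also have "Q 0 - Q M = 0"
    proof -
      \<comment> \<open>The pairing of covector and vector is the same on all levels up to
        \<open>M\<close>. On the line \<open>T 0\<close> the element \<open>x\<close> is a scalar,
        so \<open>Q 0\<close> is that scalar times \<open>R 0\<close>. At \<open>M\<close> either
        \<open>\<alpha> M\<close> vanishes, and then both terms are zero, or \<open>M = N\<close>
        and the scalar is the same.\<close>
      define R where "R i = (\<Sum>l\<in>T i. \<beta> i l * \<alpha> i l)" for i
      have RS: "R i = R (Suc i)" if "i < M" for i
      proof -
        have "R i = (\<Sum>l\<in>T i. \<Sum>j\<in>T (Suc i). \<eta> i l j * \<beta> (Suc i) j * \<alpha> i l)"
          unfolding R_def using that by (simp add: \<beta>S sum_distrib_right)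
        also have "\<dots> = (\<Sum>j\<in>T (Suc i). \<Sum>l\<in>T i. \<eta> i l j * \<beta> (Suc i) j * \<alpha> i l)"
          by (rule sum.swap)
        also have "\<dots> = R (Suc i)"
          unfolding R_def by (simp add: \<alpha>S sum_distrib_left mult_ac)
        finally show ?thesis .
      qed
      have R: "i \<le> M \<Longrightarrow> R 0 = R i" for i
        by (induction i) (use RS in auto)
      have Q0: "Q 0 = X 0 \<tau> \<tau> * R 0" by (simp add: Q_def R_def ends)
      show ?thesis
      proof (cases "\<forall>j\<in>T M. \<alpha> M j = 0")
        case True
        then have "R M = 0" "Q M = 0" by (auto simp: R_def Q_def intro!: sum.neutral)
        then show ?thesis using Q0 R[of M] by simp
      next
        case False
        then have "M = N" using M(2) by blast
        then have "Q M = X N \<tau>' \<tau>' * R M" by (simp add: Q_def R_def ends)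
        moreover have "X N \<tau>' \<tau>' = X 0 \<tau> \<tau>" using scalar[OF x] by (simp add: X_def)
        ultimately show ?thesis using Q0 R[of M] by simp
      qed
    qed
    finally show ?thesis .
  qed
  show ?thesis using wc inv nonzero supp unfolding inv_under_def by blast
qed

section \<open>The trace form and its invariance\<close>

definition tr :: "'a::field array \<Rightarrow> 'a array \<Rightarrow> 'a"
  where "tr A A' = (\<Sum>a\<in>I. \<Sum>b\<in>I. A a b * A' b a)"

lemma tr_sym: "tr A A' = tr A' A"
  unfolding tr_def by (subst sum.swap) (simp add: mult.commute)

lemma tr_assoc: "tr A (mm A' A'') = tr (mm A A') A''"
proof -
  have "tr A (mm A' A'') = (\<Sum>a\<in>I. \<Sum>b\<in>I. \<Sum>c\<in>I. A a b * A' b c * A'' c a)"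
    unfolding tr_def mm_def by (simp add: sum_distrib_left mult.assoc)
  also have "\<dots> = (\<Sum>a\<in>I. \<Sum>c\<in>I. \<Sum>b\<in>I. A a b * A' b c * A'' c a)"
    by (intro sum.cong refl sum.swap)
  also have "\<dots> = tr (mm A A') A''"
    unfolding tr_def mm_def by (simp add: sum_distrib_right)
  finally show ?thesis .
qed

lemma tr_diff_right: "tr A (\<lambda>a b. A' a b - A'' a b) = tr A A' - tr A A''"
  and tr_diff_left: "tr (\<lambda>a b. A' a b - A'' a b) A = tr A' A - tr A'' A"
  by (simp_all add: tr_def algebra_simps sum_subtractf)

lemma com_eq: "com A A' = (\<lambda>a b. mm A A' a b - mm A' A a b)"
  by (intro ext) (simp add: com_def)

text \<open>Moving the bracket with \<open>x\<close> to the other argument turns the dual action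
  into a bracket. The variant \<open>tr_com'\<close> isolates \<open>x\<close> instead, which shows
  that a centraliser annihilates the tangent space.\<close>

lemma tr_com: "tr w (com x N) = - tr (com x w) N"
  unfolding com_eq tr_diff_right tr_diff_left
  using tr_assoc[of w x N] tr_assoc[of w N x] tr_sym[of "mm w N" x] tr_assoc[of x w N] by simp

lemma tr_com': "tr w (com x N) = - tr x (com w N)"
  unfolding com_eq tr_diff_right
  using tr_assoc[of w N x] tr_sym[of "mm w N" x] tr_sym[of w "mm x N"] tr_assoc[of x N w] tr_sym[of x "mm N w"]
    tr_sym[of "mm x N" w]
  by simp

lemma tr_unit:
  assumes "p \<in> I" "q \<in> I"
  shows "tr A (unit p q) = A q p"
proof -
  have "tr A (unit p q) = (\<Sum>a\<in>I. if a = q then (\<Sum>b\<in>I. if b = p then A a b else 0) else 0)"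
    unfolding tr_def unit_def by (intro sum.cong refl) (auto intro!: sum.neutral sum.cong)
  then show ?thesis using assms finite_I by simp
qed

end

section \<open>An element with too many invariants\<close>

locale bad_levels = levels m r
  for m :: nat and r :: "nat \<Rightarrow> nat" +
  fixes k :: nat
  assumes m4: "m \<ge> 4" and k1: "k \<ge> 1" and kr: "\<And>i. i < m \<Longrightarrow> k \<le> r i"
    and r2: "r (m - 2) \<ge> 2" "r (m - 1) \<ge> 2" "r 0 \<ge> 2"
begin

text \<open>
  The element violating the index equality. Strips \<open>2 \<le> j < k\<close> are cycles with distinct nonzero
  eigenvalues; strip \<open>0\<close> is the Jordan block \<open>0 \<rightarrow> 1 \<rightarrow> \<dots> \<rightarrow> m - 2\<close> and strip \<open>1\<close> is the
  Jordan block \<open>m - 2 \<rightarrow> m - 1 \<rightarrow> 0\<close>; all other basis vectors are killed.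
\<close>

definition bad_coeff :: "nat \<times> nat \<Rightarrow> 'a::field_char_0"
  where "bad_coeff p =
    (if p \<in> I \<and> up p \<in> I then
       if snd p = 0 then (if fst p + 3 \<le> m then 1 else 0)
       else if snd p = 1 then (if m \<le> fst p + 2 then 1 else 0)
       else if snd p < k then of_nat (snd p) else 0
     else 0)"

text \<open>Starting at 2 leaves the strips 0 and 1 to the Jordan blocks and makes the weights
  \<open>of_nat j\<close> nonzero.\<close>

definition cyc :: "nat \<Rightarrow> bool"
  where "cyc j \<longleftrightarrow> 2 \<le> j \<and> j < k"

lemma r1: "i < m \<Longrightarrow> 0 < r i"
  using kr[of i] k1 by simp

lemma valid_bad: "valid (bad_coeff :: nat \<times> nat \<Rightarrow> 'a::field_char_0)"
  by (auto simp: valid_def bad_coeff_def)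

text \<open>The arrows of the first block leave the levels 0, ..., m - 3, the last one arriving at m
  - 2; those of the second block, in \<open>bad1\<close>, leave m - 2 and m - 1. Position 0 exists
  on every level, and \<open>r2\<close> supplies position 1 on the three levels of the second
  block.\<close>

lemma bad0: "i < m \<Longrightarrow> (bad_coeff (i, 0) :: 'a::field_char_0) = (if i + 3 \<le> m then 1 else 0)"
  using m4 by (auto simp: bad_coeff_def up_def r1)

lemma bad1: "i < m \<Longrightarrow> (bad_coeff (i, 1) :: 'a::field_char_0) = (if m \<le> i + 2 then 1 else 0)"
proof -
  assume i: "i < m"
  have "i = m - 2 \<or> i = m - 1" if "m \<le> i + 2" using that i by linarith
  then show ?thesis
    using m4 i r2 Suc_diff_le[of 2 m] by (auto simp: bad_coeff_def up_def numeral_2_eq_2)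
qed

lemma bad_cyc: "i < m \<Longrightarrow> cyc j \<Longrightarrow> (bad_coeff (i, j) :: 'a::field_char_0) = of_nat j"
  using kr m_pos by (fastforce simp: bad_coeff_def up_def cyc_def intro: less_le_trans)

lemma bad_other: "\<not> cyc j \<Longrightarrow> j \<noteq> 0 \<Longrightarrow> j \<noteq> 1 \<Longrightarrow> (bad_coeff (i, j) :: 'a::field_char_0) = 0"
  by (auto simp: bad_coeff_def cyc_def)

section \<open>Entries of the elements of the stabiliser\<close>

context
  fixes x :: "'a::field_char_0 array"
  assumes x: "x \<in> stab bad_coeff"
begin

lemma x_supp: "x a b \<noteq> 0 \<Longrightarrow> a \<in> I \<and> b \<in> I \<and> fst a = fst b"
  and x_comm: "comm bad_coeff x"
  using x by (auto simp: stab_def deg0_def simp del: mem_I)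

text \<open>A commuting map preserves the kernel of the shift, so the image of a killed vector has
  no component along a vector that is moved on. Dually, \<open>back0\<close> says that the image of
  the shift is preserved.\<close>

lemma forw0:
  assumes "(bad_coeff (i, l) :: 'a) \<noteq> 0" "(bad_coeff (i, j) :: 'a) = 0"
  shows "x (i, l) (i, j) = 0"
proof (rule ccontr)
  assume "x (i, l) (i, j) \<noteq> 0"
  then have "(i, l) \<in> I" "(i, j) \<in> I" using x_supp by blast+
  from comm_forw[OF valid_bad x_comm this assms(1)] assms \<open>x (i, l) (i, j) \<noteq> 0\<close>
  show False by simp
qed

lemma back0:
  assumes "(bad_coeff (dn (i, j)) :: 'a) \<noteq> 0" "(bad_coeff (dn (i, l)) :: 'a) = 0"
  shows "x (i, l) (i, j) = 0"
proof (rule ccontr)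
  assume "x (i, l) (i, j) \<noteq> 0"
  then have "(i, l) \<in> I" "(i, j) \<in> I" using x_supp by blast+
  from comm_back[OF valid_bad x_comm this assms(1)] assms \<open>x (i, l) (i, j) \<noteq> 0\<close>
  show False by simp
qed

lemma diag_step:
  assumes "(bad_coeff p :: 'a) \<noteq> 0"
  shows "x (up p) (up p) = x p p"
proof -
  have "p \<in> I" using assms valid_bad[where ?'a = 'a] by (auto simp: valid_def)
  from comm_forw[OF valid_bad x_comm this this assms] show ?thesis using assms by simp
qed

text \<open>A nonzero entry joining a cycle to another strip can be pushed around, backwards or
  forwards according to the side on which the cycle stands. The other strip would then be a cycle as
  well, with the same m-th power of the weight, but the weights are distinct natural
  numbers.\<close>

lemma cyc_off:
  assumes "cyc l \<or> cyc j" "l \<noteq> j"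
  shows "x (i, l) (i, j) = 0"
proof (rule ccontr)
  assume nz: "x (i, l) (i, j) \<noteq> 0"
  then have I: "(i, l) \<in> I" "(i, j) \<in> I" using x_supp by blast+
  \<comment> \<open>The value 1 covers the arrows of both Jordan blocks, so that the weight depends
    on the strip alone.\<close>
  define cc :: "nat \<Rightarrow> 'a" where "cc j = (if cyc j then of_nat j else 1)" for j
  have const: "bad_coeff p = cc (snd p)" if "(bad_coeff p :: 'a) \<noteq> 0" for p
    using that by (auto simp: bad_coeff_def cc_def cyc_def split: if_splits)
  have "(\<forall>i<m. (bad_coeff (i, l) :: 'a) \<noteq> 0 \<and> (bad_coeff (i, j) :: 'a) \<noteq> 0) \<and> cc l ^ m = cc j ^ m"
  proof (cases "cyc j")
    case True
    show ?thesis
    proof (rule cycle_back[OF valid_bad x_comm _ const I _ _ nz])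
      fix a b :: "nat \<times> nat" assume "b \<in> I" "snd b = j"
      then have "dn b = (fst (dn b), j)" "fst (dn b) < m" using I_less by (auto simp: prod_eq_iff)
      then show "(bad_coeff (dn b) :: 'a) \<noteq> 0"
        using bad_cyc[where ?'a = 'a, OF _ True, of "fst (dn b)"] True by (auto simp: cyc_def)
    qed auto
  next
    case False
    then have l: "cyc l" using assms by simp
    show ?thesis
    proof (rule cycle_forw[OF valid_bad x_comm _ const I _ _ nz])
      fix a b :: "nat \<times> nat" assume "a \<in> I" "snd a = l"
      then have "a = (fst a, l)" "fst a < m" using I_less by (auto simp: prod_eq_iff)
      then show "(bad_coeff a :: 'a) \<noteq> 0"
        using bad_cyc[where ?'a = 'a, OF _ l, of "fst a"] l by (auto simp: cyc_def)
    qed auto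
  qed
  then have all: "\<And>i. i < m \<Longrightarrow> (bad_coeff (i, l) :: 'a) \<noteq> 0" "\<And>i. i < m \<Longrightarrow> (bad_coeff (i, j) :: 'a) \<noteq> 0"
    and eq: "cc l ^ m = cc j ^ m" by blast+
  have "cyc j'" if "\<And>i. i < m \<Longrightarrow> (bad_coeff (i, j') :: 'a) \<noteq> 0" for j'
    using that[of 0] that[of "m - 1"] bad0[where ?'a = 'a, of "m - 1"] bad1[where ?'a = 'a, of 0] bad_other[where ?'a = 'a, of j' 0] m4
    by (cases "j' = 0"; cases "j' = 1") auto
  then have "cyc l" "cyc j" using all by auto
  then have "l ^ m = j ^ m"
    using eq unfolding cc_def by (simp flip: of_nat_power)
  then show False using assms(2) m_pos power_eq_iff_eq_base[of m l j] by simp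
qed

text \<open>Here \<open>q\<close> stands for the block on strip 0 and \<open>p\<close> for the one
  on strip 1. On the levels 0, ..., m - 3 the first block is moved on while every other non-cyclic
  vector is killed.\<close>

lemma row_q:
  assumes "i + 3 \<le> m" "j \<noteq> 0"
  shows "x (i, 0) (i, j) = 0"
proof (cases "cyc j")
  case True
  then show ?thesis using cyc_off[of 0 j] assms by simp
next
  case False
  have "(bad_coeff (i, 0) :: 'a) \<noteq> 0" using bad0[where ?'a = 'a, of i] assms by simp
  moreover have "(bad_coeff (i, j) :: 'a) = 0"
    using False bad_other[where ?'a = 'a, of j i] bad1[where ?'a = 'a, of i] assms by (cases "j = 1") auto
  ultimately show ?thesis by (rule forw0)
qed

text \<open>On the levels 1, ..., m - 2 the first block is hit by the shift while no other
  non-cyclic vector is.\<close>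

lemma col_q:
  assumes "1 \<le> i" "i + 2 \<le> m" "l \<noteq> 0"
  shows "x (i, l) (i, 0) = 0"
proof (cases "cyc l")
  case True
  then show ?thesis using cyc_off[of l 0] assms by simp
next
  case False
  have "(bad_coeff (dn (i, 0)) :: 'a) \<noteq> 0" using bad0[where ?'a = 'a, of "i - 1"] assms by (simp add: dn_def)
  moreover have "(bad_coeff (dn (i, l)) :: 'a) = 0"
    using False bad_other[where ?'a = 'a, of l "i - 1"] bad1[where ?'a = 'a, of "i - 1"] assms by (cases "l = 1") (auto simp: dn_def)
  ultimately show ?thesis by (rule back0)
qed

text \<open>Apart from the cycles, the second block alone is moved on at the levels m - 2 and m - 1,
  and it alone is hit at the levels m - 1 and 0; the latter gives \<open>col_p\<close>.\<close>

lemma row_p: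
  assumes "i = m - 2 \<or> i = m - 1" "j \<noteq> 1"
  shows "x (i, 1) (i, j) = 0"
proof (cases "cyc j")
  case True
  then show ?thesis using cyc_off[of 1 j] assms by simp
next
  case False
  have i: "i < m" "\<not> i + 3 \<le> m" "m \<le> i + 2" using assms(1) m4 by auto
  have "(bad_coeff (i, 1) :: 'a) \<noteq> 0" using bad1[where ?'a = 'a, of i] i by simp
  moreover have "(bad_coeff (i, j) :: 'a) = 0"
    using False bad_other[where ?'a = 'a, of j i] bad0[where ?'a = 'a, of i] assms i by (cases "j = 0") auto
  ultimately show ?thesis by (rule forw0)
qed

lemma col_p:
  assumes "i = m - 1 \<or> i = 0" "l \<noteq> 1"
  shows "x (i, l) (i, 1) = 0"
proof (cases "cyc l")
  case True
  then show ?thesis using cyc_off[of l 1] assms by simp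
next
  case False
  define i' where "i' = (if i = 0 then m - 1 else i - 1)"
  have i: "i' < m" "\<not> i' + 3 \<le> m" "m \<le> i' + 2" "dn (i, j) = (i', j)" for j
    using assms(1) m4 by (auto simp: i'_def dn_def)
  have "(bad_coeff (dn (i, 1)) :: 'a) \<noteq> 0" using bad1[where ?'a = 'a, of i'] i by simp
  moreover have "(bad_coeff (dn (i, l)) :: 'a) = 0"
    using False bad_other[where ?'a = 'a, of l i'] bad0[where ?'a = 'a, of i'] assms i by (cases "l = 0") auto
  ultimately show ?thesis by (rule back0)
qed

lemma diag_q: "i + 2 \<le> m \<Longrightarrow> x (i, 0) (i, 0) = x (0, 0) (0, 0)"
proof (induction i)
  case (Suc i)
  have "x (up (i, 0)) (up (i, 0)) = x (i, 0) (i, 0)"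
    using Suc bad0[where ?'a = 'a, of i] by (intro diag_step) auto
  moreover have "up (i, 0) = (Suc i, 0)" using Suc by (simp add: up_def)
  ultimately show ?case using Suc by simp
qed simp

lemma diag_p:
  "x (m - 1, 1) (m - 1, 1) = x (m - 2, 1) (m - 2, 1)"
  "x (0, 1) (0, 1) = x (m - 2, 1) (m - 2, 1)"
proof -
  have u: "up (m - 2, 1) = (m - 1, 1)" "up (m - 1, 1) = (0, 1)"
    using m4 by (auto simp: up_def)
  show 1: "x (m - 1, 1) (m - 1, 1) = x (m - 2, 1) (m - 2, 1)"
    using diag_step[of "(m - 2, 1)"] bad1[where ?'a = 'a, of "m - 2"] m4 unfolding u by auto
  show "x (0, 1) (0, 1) = x (m - 2, 1) (m - 2, 1)"
    using diag_step[of "(m - 1, 1)"] bad1[where ?'a = 'a, of "m - 1"] m4 1 unfolding u by auto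
qed

lemma diag_cyc:
  assumes "cyc j" "b \<in> I" "snd b = j"
  shows "x (dn b) (dn b) = x b b"
proof -
  have b: "fst (dn b) < m" "dn b = (fst (dn b), j)" "up (dn b) = b"
    using assms I_less[of b] by (auto simp: up_dn prod_eq_iff)
  have "(bad_coeff (dn b) :: 'a) \<noteq> 0"
    using bad_cyc[where ?'a = 'a, OF b(1) assms(1)] assms(1) b(2) by (simp add: cyc_def)
  from diag_step[OF this] show ?thesis using b(3) by simp
qed

text \<open>A matrix unit is a weight vector as soon as \<open>x\<close> is diagonal in the column
  of its target and in the row of its source.\<close>

lemma com_unit_diag:
  assumes pq: "p \<in> I" "q \<in> I" and col: "\<And>l. l \<noteq> snd p \<Longrightarrow> x (fst p, l) p = 0"
    and row: "\<And>j. j \<noteq> snd q \<Longrightarrow> x q (fst q, j) = 0"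
  shows "com x (unit p q) a b = (x p p - x q q) * unit p q a b"
proof -
  have "x a p = 0" if "a \<noteq> p"
    using x_supp[of a p] col[of "snd a"] that by (metis prod.collapse)
  moreover have "x q b = 0" if "b \<noteq> q"
    using x_supp[of q b] row[of "snd b"] that by (metis prod.collapse)
  ultimately show ?thesis by (auto simp: com_def mm_unit[OF pq] unit_def)
qed

end

text \<open>The second block ends at level 0 and starts at level m - 2, and its return path passes
  through the levels in between. There the vectors outside the first block and the cycles span a
  space preserved by the stabiliser, by \<open>row_q\<close> and \<open>col_q\<close>. The bound on
  \<open>k\<close> puts position 1 on each of these levels, so that the path is not interrupted. The
  description of the support serves to tell the invariants apart.\<close>

lemma chain_p_invariant:
  fixes \<zeta> :: "'a::field_char_0 array \<Rightarrow> 'a"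
  assumes lin: "linear_cent bad_coeff \<zeta>" and k2: "k \<ge> 2"
  shows "\<exists>w. inv_under bad_coeff \<zeta> w \<and> (\<exists>a b. w a b \<noteq> 0) \<and>
    (\<forall>a b. w a b \<noteq> 0 \<longrightarrow> snd a \<noteq> 0 \<and> snd b \<noteq> 0 \<and> \<not> cyc (snd b) \<and> fst a < m - 2 \<and> 0 < fst b \<and> fst b \<le> m - 2)"
proof -
  define T where "T i = (if i = 0 \<or> i = m - 2 then {1} else {j. j < r i \<and> j \<noteq> 0 \<and> \<not> cyc j})" for i
  have Tcyc: "j \<noteq> 0 \<and> \<not> cyc j" if "j \<in> T i" for i j
    using that by (auto simp: T_def cyc_def split: if_splits)
  have T0: "(bad_coeff (i, j) :: 'a) = 0" if "i + 2 < m" "j \<noteq> 0" "\<not> cyc j" for i j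
    using that bad_other[where ?'a = 'a, of j i] bad1[where ?'a = 'a, of i] by (cases "j = 1") auto
  have "\<exists>w. inv_under bad_coeff \<zeta> w \<and> (\<exists>a b. w a b \<noteq> 0) \<and>
    (\<forall>a b. w a b \<noteq> 0 \<longrightarrow> (\<exists>i<m - 2. \<exists>l\<in>T i. \<exists>j\<in>T (Suc i). a = (i, l) \<and> b = (Suc i, j)))"
  proof (rule chain_invariant[OF valid_bad lin, of "m - 2" "\<lambda>i. i" T 1 1])
    show "1 \<le> m - 2" using m4 by simp
    show "inj_on (\<lambda>i. i) {..m - 2}" by simp
    show "dn (i, j) = (i - 1, j)" if "1 \<le> i" for i j using that by (simp add: dn_def)
    show "finite (T i)" for i by (simp add: T_def)
    show "T i \<noteq> {}" if "i \<le> m - 2" for i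
    proof -
      have "1 < r i" using kr[of i] k2 that m4 by linarith
      then have "1 \<in> T i" by (simp add: T_def cyc_def)
      then show ?thesis by blast
    qed
    show "(i, j) \<in> I" if "i \<le> m - 2" "j \<in> T i" for i j
      using that m4 r2 by (auto simp: T_def split: if_splits)
    show "(bad_coeff (i, l) :: 'a) = 0" if "i < m - 2" "l \<in> T i" for i l
      using T0[of i l] Tcyc that by auto
    show "(bad_coeff (i, j) :: 'a) = 0" if "i < m - 2" "j \<in> T (Suc i)" for i j
      using T0[of i j] Tcyc that by auto
    fix x :: "'a array" assume x: "x \<in> stab bad_coeff"
    show "x (0, 1) (0, 1) = x (m - 2, 1) (m - 2, 1)" by (rule diag_p(2)[OF x])
    show "x (i, l') (i, l) = 0" if h: "i < m - 2" "l \<in> T i" "l' \<notin> T i" for i l l'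
    proof (cases "i = 0")
      case True
      then show ?thesis using col_p[OF x, of 0 l'] that by (simp add: T_def)
    next
      case False
      have l: "l \<noteq> 0" "\<not> cyc l" using Tcyc[OF that(2)] by auto
      consider "l' = 0" | "cyc l'" | "\<not> l' < r i"
        using h False by (auto simp: T_def)
      then show ?thesis
      proof cases
        case 1
        then show ?thesis using row_q[OF x, of i l] that l by simp
      next
        case 2
        then show ?thesis using cyc_off[OF x, of l' l i] l by auto
      next
        case 3
        then show ?thesis using x_supp[OF x, of "(i, l')" "(i, l)"] by auto
      qed
    qed
    show "x (Suc i, j) (Suc i, j') = 0" if h: "i < m - 2" "j \<in> T (Suc i)" "j' \<notin> T (Suc i)" for i j j'
    proof (cases "Suc i = m - 2")
      case True
      then show ?thesis using row_p[OF x, of "m - 2" j'] that by (simp add: T_def)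
    next
      case False
      have l: "j \<noteq> 0" "\<not> cyc j" using Tcyc[OF that(2)] by auto
      consider "j' = 0" | "cyc j'" | "\<not> j' < r (Suc i)"
        using h False by (auto simp: T_def)
      then show ?thesis
      proof cases
        case 1
        then show ?thesis using col_q[OF x, of "Suc i" j] that l by simp
      next
        case 2
        then show ?thesis using cyc_off[OF x, of j j' "Suc i"] l by auto
      next
        case 3
        then show ?thesis using x_supp[OF x, of "(Suc i, j)" "(Suc i, j')"] by auto
      qed
    qed
  qed (simp_all add: T_def)
  then show ?thesis
  proof (elim exE conjE, intro exI conjI)
    fix w assume "\<forall>a b. w a b \<noteq> (0::'a) \<longrightarrow> (\<exists>i<m - 2. \<exists>l\<in>T i. \<exists>j\<in>T (Suc i). a = (i, l) \<and> b = (Suc i, j))"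
    then show "\<forall>a b. w a b \<noteq> 0 \<longrightarrow> snd a \<noteq> 0 \<and> snd b \<noteq> 0 \<and> \<not> cyc (snd b) \<and> fst a < m - 2 \<and> 0 < fst b \<and> fst b \<le> m - 2"
      using Tcyc by fastforce
  qed
qed

text \<open>The return path of the first block is m - 2, m - 1, 0, hence two steps and the
  relabelling \<open>lev\<close>. At level m - 1 the vectors outside the second block and the cycles
  are preserved, and position 0 is always among them, whatever \<open>k\<close> is.\<close>

lemma chain_q_invariant:
  fixes \<zeta> :: "'a::field_char_0 array \<Rightarrow> 'a"
  assumes lin: "linear_cent bad_coeff \<zeta>"
  shows "\<exists>w. inv_under bad_coeff \<zeta> w \<and> (\<exists>a b. w a b \<noteq> 0) \<and>
    (\<forall>a b. w a b \<noteq> 0 \<longrightarrow>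
      a = (m - 2, 0) \<and> fst b = m - 1 \<and> snd b \<noteq> 1 \<and> \<not> cyc (snd b) \<or>
      fst a = m - 1 \<and> snd a \<noteq> 1 \<and> b = (0, 0))"
proof -
  define lev where "lev i = (if i = 0 then m - 2 else if i = 1 then m - 1 else 0)" for i :: nat
  define S where "S = {j. j < r (m - 1) \<and> j \<noteq> 1 \<and> \<not> cyc j}"
  define T where "T i = (if i = 1 then S else {0})" for i :: nat
  have Scyc: "j < r (m - 1)" "j \<noteq> 1" "\<not> cyc j" if "j \<in> S" for j using that by (auto simp: S_def)
  have i2: "i = 0 \<or> i = 1" if "i < 2" for i :: nat using that by auto
  have i3: "i = 0 \<or> i = 1 \<or> i = 2" if "i \<le> 2" for i :: nat using that by auto
  have Tc: "\<not> cyc j \<and> j \<noteq> 1" if "j \<in> T i" for i j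
    using that Scyc by (auto simp: T_def cyc_def split: if_splits)
  have T0: "(bad_coeff (lev i, j) :: 'a) = 0" if "i < 2" "j \<noteq> 1" "\<not> cyc j" for i j
    using that bad_other[where ?'a = 'a, of j "lev i"] bad0[where ?'a = 'a, of "lev i"] m4 by (cases "j = 0") (auto simp: lev_def)
  have "\<exists>w. inv_under bad_coeff \<zeta> w \<and> (\<exists>a b. w a b \<noteq> 0) \<and>
    (\<forall>a b. w a b \<noteq> 0 \<longrightarrow> (\<exists>i<2. \<exists>l\<in>T i. \<exists>j\<in>T (Suc i). a = (lev i, l) \<and> b = (lev (Suc i), j)))"
  proof (rule chain_invariant[OF valid_bad lin, of 2 lev T 0 0])
    show "inj_on lev {..2}" using m4 by (auto simp: inj_on_def lev_def)
    show "dn (lev i, j) = (lev (i - 1), j)" if "1 \<le> i" "i \<le> 2" for i j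
      using i3[OF that(2)] that(1) m4 by (auto simp: lev_def dn_def)
    show "finite (T i)" for i by (simp add: T_def S_def)
    show "T i \<noteq> {}" for i
    proof -
      have "0 \<in> T i" using r2 by (simp add: T_def S_def cyc_def)
      then show ?thesis by blast
    qed
    show "(lev i, j) \<in> I" if "i \<le> 2" "j \<in> T i" for i j
      using i3[OF that(1)] that(2) m4 r2 Scyc by (auto simp: T_def lev_def)
    show "(bad_coeff (lev i, l) :: 'a) = 0" if "i < 2" "l \<in> T i" for i l
      using T0[of i l] Tc that by auto
    show "(bad_coeff (lev i, j) :: 'a) = 0" if "i < 2" "j \<in> T (Suc i)" for i j
      using T0[of i j] Tc that by auto
    fix x :: "'a array" assume x: "x \<in> stab bad_coeff"
    show "x (lev 0, 0) (lev 0, 0) = x (lev 2, 0) (lev 2, 0)"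
      using diag_q[OF x, of "m - 2"] m4 by (simp add: lev_def)
    \<comment> \<open>At level m - 1 the second block is both hit and moved on, so it splits off on
      either side of the diagonal.\<close>
    have mid: "x (m - 1, l') (m - 1, l) = 0" if h: "l \<in> S \<and> l' \<notin> S \<or> l \<notin> S \<and> l' \<in> S" for l l'
    proof -
      consider "l' = 1" "l \<noteq> 1" | "l = 1" "l' \<noteq> 1" | "cyc l \<or> cyc l'" "l \<noteq> l'"
        | "\<not> l' < r (m - 1) \<or> \<not> l < r (m - 1)"
        using h by (auto simp: S_def)
      then show ?thesis
      proof cases
        case 1 then show ?thesis using row_p[OF x, of "m - 1" l] by simp
      next
        case 2 then show ?thesis using col_p[OF x, of "m - 1" l'] by simp
      next
        case 3 then show ?thesis using cyc_off[OF x, of l' l] by blast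
      next
        case 4 then show ?thesis using x_supp[OF x, of "(m - 1, l')" "(m - 1, l)"] by auto
      qed
    qed
    show "x (lev i, l') (lev i, l) = 0" if "i < 2" "l \<in> T i" "l' \<notin> T i" for i l l'
      using i2[OF that(1)]
    proof
      assume "i = 0"
      then show ?thesis using col_q[OF x, of "m - 2" l'] that m4 by (simp add: T_def lev_def)
    next
      assume "i = 1"
      then show ?thesis using mid that by (simp add: T_def lev_def)
    qed
    show "x (lev (Suc i), j) (lev (Suc i), j') = 0"
      if "i < 2" "j \<in> T (Suc i)" "j' \<notin> T (Suc i)" for i j j'
      using i2[OF that(1)]
    proof
      assume "i = 0"
      then show ?thesis using mid that by (simp add: T_def lev_def)
    next
      assume "i = 1"
      then show ?thesis using row_q[OF x, of 0 j'] that m4 by (simp add: T_def lev_def)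
    qed
  qed (simp_all add: T_def)
  then show ?thesis
  proof (elim exE conjE, intro exI conjI)
    fix w assume w: "\<forall>a b. w a b \<noteq> (0::'a) \<longrightarrow> (\<exists>i<2. \<exists>l\<in>T i. \<exists>j\<in>T (Suc i). a = (lev i, l) \<and> b = (lev (Suc i), j))"
    show "\<forall>a b. w a b \<noteq> 0 \<longrightarrow>
      a = (m - 2, 0) \<and> fst b = m - 1 \<and> snd b \<noteq> 1 \<and> \<not> cyc (snd b) \<or>
      fst a = m - 1 \<and> snd a \<noteq> 1 \<and> b = (0, 0)"
    proof (intro allI impI)
      fix a b assume "w a b \<noteq> 0"
      then obtain i l j where i: "i < 2" "l \<in> T i" "j \<in> T (Suc i)" "a = (lev i, l)" "b = (lev (Suc i), j)"
        using w by blast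
      show "a = (m - 2, 0) \<and> fst b = m - 1 \<and> snd b \<noteq> 1 \<and> \<not> cyc (snd b) \<or>
        fst a = m - 1 \<and> snd a \<noteq> 1 \<and> b = (0, 0)"
        using i2[OF i(1)]
      proof
        assume "i = 0"
        then show ?thesis using i(2-) Scyc[of j] by (auto simp: T_def lev_def)
      next
        assume "i = 1"
        then show ?thesis using i(2-) Scyc[of l] by (auto simp: T_def lev_def)
      qed
    qed
  qed
qed

text \<open>On cycle \<open>j\<close> the shift is \<open>j\<close> times a permutation of basis
  vectors; this is the inverse permutation, extended by zero.\<close>

definition loop :: "nat \<Rightarrow> 'a::field_char_0 array"
  where "loop j a b = (if b \<in> I \<and> snd b = j \<and> a = dn b then 1 else 0)"

text \<open>An element of the stabiliser is a scalar on the cycle and has no entries joining it to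
  other strips, so it commutes with \<open>loop j\<close>: the bracket is zero before \<zeta> is
  applied.\<close>

lemma loop_invariant:
  fixes \<zeta> :: "'a::field_char_0 array \<Rightarrow> 'a"
  assumes lin: "linear_cent bad_coeff \<zeta>" and j: "cyc j"
  shows "inv_under bad_coeff \<zeta> (loop j)"
proof -
  have jI: "p \<in> I" if "fst p < m" "snd p = j" for p
    using kr[OF that(1)] that j by (cases p) (auto simp: cyc_def)
  have deg: "degm (loop j :: 'a array)"
    using jI I_less by (auto simp: degm_def loop_def)
  have "loop j a (up b) * bad_coeff b = bad_coeff (dn a) * (loop j (dn a) b :: 'a)"
    if ab: "a \<in> I" "b \<in> I" for a b
  proof -
    have lt: "fst a < m" "fst b < m" using ab I_less by auto
    have 1: "loop j a (up b) = (if snd b = j \<and> a = b then 1 else (0::'a))"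
      using jI[of "up b"] lt by (auto simp: loop_def dn_up)
    have 2: "loop j (dn a) b = (if snd b = j \<and> a = b then 1 else (0::'a))"
    proof -
      have "dn a = dn b \<longleftrightarrow> a = b" using up_dn[OF lt(1)] up_dn[OF lt(2)] by metis
      then show ?thesis using ab by (auto simp: loop_def)
    qed
    have "bad_coeff (dn a) = (of_nat j :: 'a)" "bad_coeff a = (of_nat j :: 'a)" if "snd a = j"
      using bad_cyc[where ?'a = 'a, of "fst a" j] bad_cyc[where ?'a = 'a, of "fst (dn a)" j] lt j that
      by (metis fst_dn_less prod.collapse snd_dn)+
    then show ?thesis unfolding 1 2 by auto
  qed
  then have c: "loop j \<in> cent (bad_coeff :: _ \<Rightarrow> 'a)" using deg by (simp add: cent_def comm_def)
  have "com x (loop j) a b = 0" if x: "x \<in> stab bad_coeff" for x :: "'a array" and a b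
  proof -
    have off: "x p q = 0" if "p \<noteq> q" "snd p = j \<or> snd q = j" for p q
    proof (rule ccontr)
      assume "x p q \<noteq> 0"
      then have "fst p = fst q" using x_supp[OF x] by blast
      then show False
        using cyc_off[OF x, of "snd p" "snd q" "fst p"] that j \<open>x p q \<noteq> 0\<close>
        by (metis prod.collapse)
    qed
    have "mm x (loop j) a b = (\<Sum>c\<in>I. if c = dn b then (if b \<in> I \<and> snd b = j then x a c else 0) else 0)"
      unfolding mm_def by (intro sum.cong) (auto simp: loop_def)
    also have "\<dots> = (if b \<in> I \<and> snd b = j then x a (dn b) else 0)"
      using finite_I jI[of "dn b"] I_less[of b] by auto
    also have "\<dots> = (if b \<in> I \<and> snd b = j \<and> a = dn b then x b b else 0)"
      using off[of a "dn b"] diag_cyc[OF x j, of b] by auto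
    finally have 1: "mm x (loop j) a b = (if b \<in> I \<and> snd b = j \<and> a = dn b then x b b else 0)" .
    have "mm (loop j) x a b = (\<Sum>c\<in>I. if c = b then (if snd b = j \<and> a = dn b then x b b else 0) else 0)"
      unfolding mm_def using off[of _ b] by (intro sum.cong) (auto simp: loop_def)
    also have "\<dots> = (if b \<in> I \<and> snd b = j \<and> a = dn b then x b b else 0)"
      using finite_I by auto
    finally show ?thesis using 1 by (simp add: com_def)
  qed
  then have "com x (loop j) = (\<lambda>a b. 0)" if "x \<in> stab bad_coeff" for x :: "'a array"
    using that by (intro ext)
  then show ?thesis using c linear_cent_zero[OF lin] by (simp add: inv_under_def)
qed

text \<open>The homomorphism of degree -1 from the second block to the first: the vectors at m - 2
  and m - 1 go to those at m - 3 and m - 2, and the end of the block goes to zero. Conversely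
  \<open>cross_b\<close> takes the beginning of the first block to the end of the second.\<close>

definition cross_a :: "'a::field_char_0 array"
  where "cross_a a b = unit (m - 3, 0) (m - 2, 1) a b + unit (m - 2, 0) (m - 1, 1) a b"

definition cross_b :: "'a::field_char_0 array"
  where "cross_b a b = unit (m - 1, 1) (0, 0) a b + unit (0, 1) (1, 0) a b"

lemma com_add: "com x (\<lambda>a b. u a b + u' a b) a b = com x u a b + com x u' a b"
  by (simp add: com_def mm_def sum.distrib algebra_simps)

text \<open>
  The two homomorphisms between the Jordan blocks have opposite weights under the stabiliser,
  so some combination of them is always invariant.
\<close>

lemma cross_invariant:
  fixes \<zeta> :: "'a::field_char_0 array \<Rightarrow> 'a"
  assumes lin: "linear_cent bad_coeff \<zeta>"
  shows "\<exists>w. inv_under bad_coeff \<zeta> w \<and> (\<exists>a b. w a b \<noteq> 0) \<and>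
    (\<forall>a b. w a b \<noteq> 0 \<longrightarrow> (a, b) \<in> {((m - 3, 0), (m - 2, 1)), ((m - 2, 0), (m - 1, 1)),
      ((m - 1, 1), (0, 0)), ((0, 1), (1, 0))})"
proof -
  have I: "(m - 3, 0) \<in> I" "(m - 2, 0) \<in> I" "(m - 2, 1) \<in> I" "(m - 1, 1) \<in> I" "(0, 0) \<in> I"
    "(0, 1) \<in> I" "(1, 0) \<in> I"
    using m4 r2 r1 by auto
  have dnu: "dn (m - 2, j) = (m - 3, j)" "dn (m - 1, j) = (m - 2, j)" "dn (0, j) = (m - 1, j)"
    "dn (1, j) = (0, j)" for j using m4 by (auto simp: dn_def)
  have bc: "(bad_coeff (m - 3, 0) :: 'a) = 1" "(bad_coeff (m - 2, 0) :: 'a) = 0"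
    "(bad_coeff (m - 2, 1) :: 'a) = 1" "(bad_coeff (m - 3, 1) :: 'a) = 0"
    "(bad_coeff (m - 1, 1) :: 'a) = 1" "(bad_coeff (m - 1, 0) :: 'a) = 0"
    "(bad_coeff (0, 0) :: 'a) = 1" "(bad_coeff (0, 1) :: 'a) = 0"
    using m4 by (auto simp: bad0 bad1[simplified])
  have shift_r: "unit p q a (up b) * bad_coeff b = bad_coeff (dn q) * (unit p (dn q) a b :: 'a)"
    if "b \<in> I" "q \<in> I" for p q a b
    using up_eq_iff[of b q] I_less that by (auto simp: unit_def)
  have shift_l: "bad_coeff (dn a) * unit p q (dn a) b = bad_coeff p * (unit (up p) q a b :: 'a)"
    if "a \<in> I" "p \<in> I" for p q a b
    using up_eq_iff[of p a] I_less that by (auto simp: unit_def)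
  have upu: "up (m - 3, j) = (m - 2, j)" "up (m - 2, j) = (m - 1, j)" "up (m - 1, j) = (0, j)"
    "up (0, j) = (1, j)" for j using m4 by (auto simp: up_def)
  have ca: "cross_a \<in> cent (bad_coeff :: _ \<Rightarrow> 'a)"
  proof -
    have "degm (cross_a :: 'a array)"
      using I dnu by (auto simp: degm_def cross_a_def unit_def simp del: mem_I split: if_splits)
    moreover have "cross_a a (up b) * bad_coeff b = bad_coeff (dn a) * (cross_a (dn a) b :: 'a)"
      if ab: "a \<in> I" "b \<in> I" for a b
      using bc dnu upu m4
      by (simp only: cross_a_def distrib_left distrib_right shift_r[OF ab(2) I(3)] shift_r[OF ab(2) I(4)]
          shift_l[OF ab(1) I(1)] shift_l[OF ab(1) I(2)]) (simp only: mult_zero_left mult_1 add_0 add_0_right)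
    ultimately show ?thesis by (simp add: cent_def comm_def)
  qed
  have cb: "cross_b \<in> cent (bad_coeff :: _ \<Rightarrow> 'a)"
  proof -
    have "degm (cross_b :: 'a array)"
      using I dnu by (auto simp: degm_def cross_b_def unit_def simp del: mem_I split: if_splits)
    moreover have "cross_b a (up b) * bad_coeff b = bad_coeff (dn a) * (cross_b (dn a) b :: 'a)"
      if ab: "a \<in> I" "b \<in> I" for a b
      using bc dnu upu m4
      by (simp only: cross_b_def distrib_left distrib_right shift_r[OF ab(2) I(5)] shift_r[OF ab(2) I(7)]
          shift_l[OF ab(1) I(4)] shift_l[OF ab(1) I(6)]) (simp only: mult_zero_left mult_1 add_0 add_0_right)
    ultimately show ?thesis by (simp add: cent_def comm_def)
  qed
  \<comment> \<open>The difference of the scalars by which \<open>x\<close> acts on the two blocks.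
    That the summands are weight vectors uses \<open>col_q\<close> at level m - 3 and
    \<open>row_q\<close> at level 1; both calls rely on m >= 4.\<close>
  define wt where "wt x = x (0, 0) (0, 0) - x (m - 2, 1) (m - 2, 1)" for x :: "'a array"
  have coma: "com x cross_a = (\<lambda>a b. wt x * cross_a a b)" if x: "x \<in> stab bad_coeff" for x :: "'a array"
  proof (intro ext)
    fix a b
    have 1: "com x (unit (m - 3, 0) (m - 2, 1)) a b =
        (x (m - 3, 0) (m - 3, 0) - x (m - 2, 1) (m - 2, 1)) * unit (m - 3, 0) (m - 2, 1) a b"
      using col_q[OF x, of "m - 3"] row_p[OF x, of "m - 2"] m4
      by (intro com_unit_diag[OF x I(1) I(3)]) simp_all
    have 2: "com x (unit (m - 2, 0) (m - 1, 1)) a b =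
        (x (m - 2, 0) (m - 2, 0) - x (m - 1, 1) (m - 1, 1)) * unit (m - 2, 0) (m - 1, 1) a b"
      using col_q[OF x, of "m - 2"] row_p[OF x, of "m - 1"] m4
      by (intro com_unit_diag[OF x I(2) I(4)]) simp_all
    have d: "x (m - 3, 0) (m - 3, 0) = x (0, 0) (0, 0)" "x (m - 2, 0) (m - 2, 0) = x (0, 0) (0, 0)"
      using diag_q[OF x, of "m - 3"] diag_q[OF x, of "m - 2"] m4 by auto
    have e: "cross_a = (\<lambda>a b. unit (m - 3, 0) (m - 2, 1) a b + (unit (m - 2, 0) (m - 1, 1) a b :: 'a))"
      by (intro ext) (rule cross_a_def)
    show "com x cross_a a b = wt x * cross_a a b"
      unfolding e com_add 1 2 d diag_p(1)[OF x] wt_def by (rule distrib_left[symmetric])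
  qed
  have comb: "com x cross_b = (\<lambda>a b. (- wt x) * cross_b a b)" if x: "x \<in> stab bad_coeff" for x :: "'a array"
  proof (intro ext)
    fix a b
    have 1: "com x (unit (m - 1, 1) (0, 0)) a b =
        (x (m - 1, 1) (m - 1, 1) - x (0, 0) (0, 0)) * unit (m - 1, 1) (0, 0) a b"
      using col_p[OF x, of "m - 1"] row_q[OF x, of 0] m4
      by (intro com_unit_diag[OF x I(4) I(5)]) simp_all
    have 2: "com x (unit (0, 1) (1, 0)) a b =
        (x (0, 1) (0, 1) - x (1, 0) (1, 0)) * unit (0, 1) (1, 0) a b"
      using col_p[OF x, of 0] row_q[OF x, of 1] m4
      by (intro com_unit_diag[OF x I(6) I(7)]) simp_all
    have d: "x (1, 0) (1, 0) = x (0, 0) (0, 0)" using diag_q[OF x, of 1] m4 by auto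
    have e: "cross_b = (\<lambda>a b. unit (m - 1, 1) (0, 0) a b + (unit (0, 1) (1, 0) a b :: 'a))"
      by (intro ext) (rule cross_b_def)
    show "com x cross_b a b = (- wt x) * cross_b a b"
      unfolding e com_add 1 2 d diag_p[OF x] wt_def minus_diff_eq by (rule distrib_left[symmetric])
  qed
  have lin': "\<zeta> (\<lambda>a b. c * w a b + c' * w' a b) = c * \<zeta> w + c' * \<zeta> w'"
    if "w \<in> cent bad_coeff" "w' \<in> cent bad_coeff" for c c' w w'
    using lin that cent_scale[OF that(1), of c] cent_scale[OF that(2), of c']
    by (simp add: linear_cent_def)
  \<comment> \<open>The form takes \<open>com x w\<close> to \<open>wt x\<close> times
    \<open>c * \<zeta> cross_a - d * \<zeta> cross_b\<close>, so the crossed values cancel. If both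
    values vanish, every combination is invariant, and the value 1 keeps \<open>w\<close>
    nonzero.\<close>
  define c where "c = (if \<zeta> cross_a = 0 \<and> \<zeta> cross_b = 0 then 1 else \<zeta> cross_b)"
  define d where "d = \<zeta> cross_a"
  define w where "w = (\<lambda>a b. c * cross_a a b + d * (cross_b a b :: 'a))"
  have wc: "w \<in> cent bad_coeff"
    unfolding w_def by (rule cent_add[OF cent_scale[OF ca] cent_scale[OF cb]])
  have inv: "\<zeta> (com x w) = 0" if x: "x \<in> stab bad_coeff" for x
  proof -
    have "com x w a b = c * com x cross_a a b + d * com x cross_b a b" for a b
      by (simp add: com_def mm_def w_def sum_distrib_left sum.distrib algebra_simps)
    then have "com x w = (\<lambda>a b. (c * wt x) * cross_a a b + (- d * wt x) * cross_b a b)"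
      by (intro ext) (simp add: coma[OF x] comb[OF x] mult.assoc)
    then have "\<zeta> (com x w) = (c * wt x) * \<zeta> cross_a + (- d * wt x) * \<zeta> cross_b"
      by (simp only: lin'[OF ca cb])
    then show ?thesis by (auto simp: c_def d_def)
  qed
  have nz: "\<exists>a b. w a b \<noteq> 0"
  proof (cases "c = 0")
    case True
    then have "d \<noteq> 0" by (auto simp: c_def d_def split: if_splits)
    then have "w (m - 1, 1) (0, 0) \<noteq> 0" using True by (simp add: w_def cross_b_def unit_def)
    then show ?thesis by blast
  next
    case False
    then have "w (m - 3, 0) (m - 2, 1) \<noteq> 0"
      using m4 by (simp add: w_def cross_a_def cross_b_def unit_def)
    then show ?thesis by blast
  qed
  have supp: "(a, b) \<in> {((m - 3, 0), (m - 2, 1)), ((m - 2, 0), (m - 1, 1)),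
      ((m - 1, 1), (0, 0)), ((0, 1), (1, 0))}" if "w a b \<noteq> 0" for a b
  proof -
    have "cross_a a b \<noteq> (0::'a) \<or> cross_b a b \<noteq> (0::'a)"
      using that unfolding w_def by (metis add_0 mult_zero_right)
    then have "unit (m - 3, 0) (m - 2, 1) a b \<noteq> (0::'a) \<or> unit (m - 2, 0) (m - 1, 1) a b \<noteq> (0::'a) \<or>
        unit (m - 1, 1) (0, 0) a b \<noteq> (0::'a) \<or> unit (0, 1) (1, 0) a b \<noteq> (0::'a)"
      unfolding cross_a_def cross_b_def by (metis add_0)
    then show ?thesis unfolding unit_def insert_iff prod.inject by presburger
  qed
  show ?thesis
    using wc inv nz supp unfolding inv_under_def by (intro exI[of _ w] conjI) simp_all
qed

text \<open>Independence is recorded by positions: \<open>p t\<close> is one at which, among these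
  elements, only \<open>w t\<close> is nonzero. Such positions exist because the supports are
  disjoint.\<close>

lemma bad_invariants:
  fixes \<zeta> :: "'a::field_char_0 array \<Rightarrow> 'a"
  assumes lin: "linear_cent bad_coeff \<zeta>"
  shows "\<exists>w p. \<forall>t<Suc k. inv_under bad_coeff \<zeta> (w t) \<and>
    (\<forall>s<Suc k. w s (fst (p t)) (snd (p t)) = 0 \<longleftrightarrow> s \<noteq> t)"
proof -
  from cross_invariant[OF lin] obtain wc where wc0: "inv_under bad_coeff \<zeta> wc \<and> (\<exists>a b. wc a b \<noteq> 0) \<and>
    (\<forall>a b. wc a b \<noteq> 0 \<longrightarrow> (a, b) \<in> {((m - 3, 0), (m - 2, 1)), ((m - 2, 0), (m - 1, 1)),
      ((m - 1, 1), (0, 0)), ((0, 1), (1, 0))})"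
    by (rule exE)
  note wc = wc0[THEN conjunct1] wc0[THEN conjunct2, THEN conjunct1] wc0[THEN conjunct2, THEN conjunct2]
  from chain_q_invariant[OF lin] obtain wq where wq0: "inv_under bad_coeff \<zeta> wq \<and> (\<exists>a b. wq a b \<noteq> 0) \<and>
    (\<forall>a b. wq a b \<noteq> 0 \<longrightarrow> a = (m - 2, 0) \<and> fst b = m - 1 \<and> snd b \<noteq> 1 \<and> \<not> cyc (snd b) \<or>
      fst a = m - 1 \<and> snd a \<noteq> 1 \<and> b = (0, 0))"
    by (rule exE)
  note wq = wq0[THEN conjunct1] wq0[THEN conjunct2, THEN conjunct1] wq0[THEN conjunct2, THEN conjunct2]
  have "\<exists>wp. k \<ge> 2 \<longrightarrow> inv_under bad_coeff \<zeta> wp \<and> (\<exists>a b. wp a b \<noteq> 0) \<and>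
    (\<forall>a b. wp a b \<noteq> 0 \<longrightarrow> snd a \<noteq> 0 \<and> snd b \<noteq> 0 \<and> \<not> cyc (snd b) \<and> fst a < m - 2 \<and> 0 < fst b \<and> fst b \<le> m - 2)"
    using chain_p_invariant[OF lin] by blast
  then obtain wp where wp0: "k \<ge> 2 \<longrightarrow> inv_under bad_coeff \<zeta> wp \<and> (\<exists>a b. wp a b \<noteq> 0) \<and>
    (\<forall>a b. wp a b \<noteq> 0 \<longrightarrow> snd a \<noteq> 0 \<and> snd b \<noteq> 0 \<and> \<not> cyc (snd b) \<and> fst a < m - 2 \<and> 0 < fst b \<and> fst b \<le> m - 2)"
    by (rule exE)
  then have wp: "k \<ge> 2 \<Longrightarrow> inv_under bad_coeff \<zeta> wp" "k \<ge> 2 \<Longrightarrow> \<exists>a b. wp a b \<noteq> 0"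
    "\<And>a b. k \<ge> 2 \<Longrightarrow> wp a b \<noteq> 0 \<Longrightarrow>
      snd a \<noteq> 0 \<and> snd b \<noteq> 0 \<and> \<not> cyc (snd b) \<and> fst a < m - 2 \<and> 0 < fst b \<and> fst b \<le> m - 2"
    by simp_all
  \<comment> \<open>Number 0 is the combination of homomorphisms, 1 the path of the first block, 2,
    ..., k - 1 are the cycles, and k is the path of the second block. For \<open>k = 1\<close> the
    numbers 0 and 1 exhaust the list.\<close>
  define w :: "nat \<Rightarrow> 'a array"
    where "w t = (if t = 0 then wc else if t = 1 then wq else if t < k then loop t else wp)" for t
  have inv: "inv_under bad_coeff \<zeta> (w t)" if "t < Suc k" for t
    using that wc(1) wq(1) wp(1) loop_invariant[OF lin, of t] by (auto simp: w_def cyc_def)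
  have nz: "\<exists>a b. w t a b \<noteq> 0" if "t < Suc k" for t
  proof -
    have "loop t (dn (0, t)) (0, t) = (1::'a)" if "t < k"
      using that kr[of 0] m_pos by (simp add: loop_def)
    then have "\<exists>a b. loop t a b \<noteq> (0::'a)" if "t < k" using that by (metis one_neq_zero)
    then show ?thesis using that wc(2) wq(2) wp(2) by (auto simp: w_def)
  qed
  \<comment> \<open>A classification of positions under which every nonzero entry of
    \<open>w t\<close> receives the value \<open>t\<close>; this yields the disjointness of the
    supports.\<close>
  define tag where "tag a b =
    (if cyc (snd b) then snd b
     else if fst a < m - 2 \<and> snd a \<noteq> 0 \<and> snd b \<noteq> 0 then k
     else if a = (m - 2, 0) \<and> snd b \<noteq> 1 \<or> fst a = m - 1 \<and> snd a \<noteq> 1 then 1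
     else 0)" for a b :: "nat \<times> nat"
  have c01: "\<not> cyc 0" "\<not> cyc 1" by (auto simp: cyc_def)
  have tag_c: "tag a b = 0" if "wc a b \<noteq> 0" for a b
    using wc(3)[rule_format, OF that] m4 c01 by (auto simp: tag_def)
  have tag_q: "tag a b = 1" if "wq a b \<noteq> 0" for a b
    using wq(3)[rule_format, OF that] m4 c01 by (auto simp: tag_def)
  have tag_p: "tag a b = k" if "k \<ge> 2" "wp a b \<noteq> 0" for a b
    using wp(3)[OF that] by (simp add: tag_def)
  have tag_loop: "tag a b = t" if "cyc t" "loop t a b \<noteq> (0::'a)" for t a b
    using that by (auto simp: tag_def loop_def split: if_splits)
  have tag: "tag a b = t" if t: "t < Suc k" "w t a b \<noteq> 0" for t a b
  proof -
    have "t = 0 \<or> t = 1 \<or> cyc t \<or> t = k \<and> k \<ge> 2"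
      using t(1) unfolding cyc_def by linarith
    then consider "t = 0" | "t = 1" | "cyc t" | "t = k" "k \<ge> 2" by blast
    then show ?thesis
    proof cases
      case 1 then show ?thesis using t(2) tag_c[of a b] by (simp add: w_def)
    next
      case 2 then show ?thesis using t(2) tag_q[of a b] by (simp add: w_def)
    next
      case 3 then show ?thesis using t(2) tag_loop[of t a b] by (simp add: w_def cyc_def)
    next
      case 4 then show ?thesis using t(2) tag_p[of a b] by (simp add: w_def)
    qed
  qed
  have "\<exists>p. t < Suc k \<longrightarrow> w t (fst p) (snd p) \<noteq> 0" for t
    using nz[of t] by (metis fst_conv snd_conv)
  then have "\<exists>p. \<forall>t. t < Suc k \<longrightarrow> w t (fst (p t)) (snd (p t)) \<noteq> 0" by (intro choice allI)
  then obtain p where p: "\<forall>t. t < Suc k \<longrightarrow> w t (fst (p t)) (snd (p t)) \<noteq> 0" by (rule exE)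
  have "w s (fst (p t)) (snd (p t)) = 0 \<longleftrightarrow> s \<noteq> t" if st: "s < Suc k" "t < Suc k" for s t
  proof
    assume "w s (fst (p t)) (snd (p t)) = 0"
    then show "s \<noteq> t" using p st(2) by blast
  next
    assume "s \<noteq> t"
    then show "w s (fst (p t)) (snd (p t)) = 0"
      using tag[OF st(1), of "fst (p t)" "snd (p t)"] tag[OF st(2) p[rule_format, OF st(2)]] by metis
  qed
  then show ?thesis using inv by (intro exI[of _ w] exI[of _ p]) simp
qed

end

section \<open>The graded pieces in coordinates\<close>

locale framed_levels = levels m r + F: frame V "levels.I m r" B co
  for m :: nat and r :: "nat \<Rightarrow> nat" and V :: "('a::field_char_0, 'v) module"
    and B :: "nat \<times> nat \<Rightarrow> 'v" and co :: "nat \<times> nat \<Rightarrow> 'v \<Rightarrow> 'a"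
begin

lemma carrier_gl:
  "f \<in> carrier (gl V) \<longleftrightarrow> f \<in> extensional (carrier V) \<and> (\<forall>v\<in>carrier V. f v \<in> carrier V)
     \<and> (\<forall>v\<in>carrier V. \<forall>w\<in>carrier V. f (v \<oplus>\<^bsub>V\<^esub> w) = f v \<oplus>\<^bsub>V\<^esub> f w)
     \<and> (\<forall>c. \<forall>v\<in>carrier V. f (c \<odot>\<^bsub>V\<^esub> v) = c \<odot>\<^bsub>V\<^esub> f v)"
  unfolding gl_def hom_space_def module_hom_def by auto

lemma gl_ops:
  "f \<oplus>\<^bsub>gl V\<^esub> g = (\<lambda>v\<in>carrier V. f v \<oplus>\<^bsub>V\<^esub> g v)"
  "c \<odot>\<^bsub>gl V\<^esub> f = (\<lambda>v\<in>carrier V. c \<odot>\<^bsub>V\<^esub> f v)"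
  "\<zero>\<^bsub>gl V\<^esub> = (\<lambda>v\<in>carrier V. \<zero>\<^bsub>V\<^esub>)"
  "lie_bracket (gl V) f g = (\<lambda>v\<in>carrier V. f (g v) \<ominus>\<^bsub>V\<^esub> g (f v))"
  by (simp_all add: gl_def hom_space_def)

lemma gl_apply [simp]: "f \<in> carrier (gl V) \<Longrightarrow> v \<in> carrier V \<Longrightarrow> f v \<in> carrier V"
  by (simp add: carrier_gl)

lemma linear_co_gl:
  assumes "f \<in> carrier (gl V)" "a \<in> I"
  shows "linear_on V (\<lambda>w. co a (f w))"
  using assms F.linear_co[OF assms(2)] by (simp add: linear_on_def carrier_gl)

definition cf :: "('v \<Rightarrow> 'v) \<Rightarrow> 'a array"
  where "cf f a b = (if a \<in> I \<and> b \<in> I then co a (f (B b)) else 0)"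

lemma cf_supp: "cf f a b \<noteq> 0 \<Longrightarrow> a \<in> I \<and> b \<in> I"
  by (simp add: cf_def del: mem_I split: if_splits)

lemma co_apply:
  assumes "f \<in> carrier (gl V)" "a \<in> I" "w \<in> carrier V"
  shows "co a (f w) = (\<Sum>b\<in>I. cf f a b * co b w)"
  using F.linear_expand[OF linear_co_gl[OF assms(1,2)] assms(3)] assms(2)
  by (simp add: cf_def mult.commute)

lemma cf_inj:
  assumes "f \<in> carrier (gl V)" "g \<in> carrier (gl V)" "cf f = cf g"
  shows "f = g"
proof (rule extensionalityI[of _ "carrier V"])
  fix w assume w: "w \<in> carrier V"
  show "f w = g w"
    using assms w by (intro F.co_eqI) (auto simp: co_apply)
qed (use assms in \<open>auto simp: carrier_gl\<close>)

lemma cf_add: "f \<in> carrier (gl V) \<Longrightarrow> g \<in> carrier (gl V) \<Longrightarrow>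
    cf (f \<oplus>\<^bsub>gl V\<^esub> g) = (\<lambda>a b. cf f a b + cf g a b)"
  by (intro ext) (auto simp: cf_def gl_ops F.B_closed linear_onD[OF F.linear_co])

lemma cf_smult: "f \<in> carrier (gl V) \<Longrightarrow> cf (c \<odot>\<^bsub>gl V\<^esub> f) = (\<lambda>a b. c * cf f a b)"
  by (intro ext) (auto simp: cf_def gl_ops F.B_closed linear_onD[OF F.linear_co])

lemma cf_zero: "cf \<zero>\<^bsub>gl V\<^esub> = (\<lambda>a b. 0)"
  by (intro ext) (auto simp: cf_def gl_ops F.B_closed linear_on_zero[OF F.vs F.linear_co])

lemma cf_comp:
  assumes "f \<in> carrier (gl V)" "g \<in> carrier (gl V)" "a \<in> I" "b \<in> I"
  shows "co a (f (g (B b))) = mm (cf f) (cf g) a b"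
proof -
  have "co a (f (g (B b))) = (\<Sum>c\<in>I. cf f a c * co c (g (B b)))"
    using assms F.B_closed by (intro co_apply) auto
  also have "\<dots> = mm (cf f) (cf g) a b"
    unfolding mm_def using assms by (intro sum.cong) (auto simp: cf_def)
  finally show ?thesis .
qed

lemma cf_bracket:
  assumes "f \<in> carrier (gl V)" "g \<in> carrier (gl V)"
  shows "cf (lie_bracket (gl V) f g) = com (cf f) (cf g)"
proof (intro ext)
  fix a b
  show "cf (lie_bracket (gl V) f g) a b = com (cf f) (cf g) a b"
  proof (cases "a \<in> I \<and> b \<in> I")
    case True
    then show ?thesis using assms
      by (simp add: com_def cf_comp[symmetric]) (simp add: cf_def gl_ops F.B_closed linear_on_diff[OF F.vs F.linear_co])
  next
    case False
    then have "cf f' a c * cf g' c b = 0" for f' g' c by (auto simp: cf_def)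
    then show ?thesis using False by (auto simp: cf_def com_def mm_def)
  qed
qed

definition op :: "'a array \<Rightarrow> 'v \<Rightarrow> 'v"
  where "op M = (\<lambda>w\<in>carrier V. F.vec (\<lambda>a. \<Sum>b\<in>I. M a b * co b w))"

lemma co_op: "w \<in> carrier V \<Longrightarrow> a \<in> I \<Longrightarrow> co a (op M w) = (\<Sum>b\<in>I. M a b * co b w)"
  by (simp add: op_def F.co_vec)

lemma op_closed: "op M \<in> carrier (gl V)"
  unfolding carrier_gl
proof (intro conjI ballI allI)
  show "op M \<in> extensional (carrier V)" by (simp add: op_def)
  show cl: "op M v \<in> carrier V" if "v \<in> carrier V" for v using that by (simp add: op_def)
  show "op M (v \<oplus>\<^bsub>V\<^esub> w) = op M v \<oplus>\<^bsub>V\<^esub> op M w" if "v \<in> carrier V" "w \<in> carrier V" for v w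
    using that cl by (intro F.co_eqI)
      (auto simp: co_op linear_onD[OF F.linear_co] distrib_left sum.distrib)
  show "op M (c \<odot>\<^bsub>V\<^esub> v) = c \<odot>\<^bsub>V\<^esub> op M v" if "v \<in> carrier V" for c v
    using that cl by (intro F.co_eqI)
      (auto simp: co_op linear_onD[OF F.linear_co] sum_distrib_left mult_ac)
qed

lemma cf_op:
  assumes "\<And>a b. M a b \<noteq> 0 \<Longrightarrow> a \<in> I \<and> b \<in> I"
  shows "cf (op M) = M"
proof (intro ext)
  fix a b
  show "cf (op M) a b = M a b"
  proof (cases "a \<in> I \<and> b \<in> I")
    case True
    then have "cf (op M) a b = (\<Sum>c\<in>I. if c = b then M a c else 0)"
      unfolding cf_def using F.B_closed[of b]
      by (auto simp: co_op F.co_B intro!: sum.cong)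
    then show ?thesis using True finite_I by simp
  next
    case False
    then show ?thesis using assms[of a b] by (auto simp: cf_def)
  qed
qed

lemma cf_op_unit: "p \<in> I \<Longrightarrow> q \<in> I \<Longrightarrow> cf (op (unit p q)) = unit p q"
  by (rule cf_op) (auto simp: unit_def split: if_splits)

text \<open>The graded parts seen through coordinates, to be identified with
  \<open>graded_part\<close> in \<open>graded_parts\<close>; the index computations take place
  here.\<close>

abbreviation G0 :: "('a, 'v \<Rightarrow> 'v) lie_alg"
  where "G0 \<equiv> (gl V)\<lparr>carrier := {f \<in> carrier (gl V). deg0 (cf f)}\<rparr>"

abbreviation G1 :: "('a, 'v \<Rightarrow> 'v) lie_alg"
  where "G1 \<equiv> (gl V)\<lparr>carrier := {f \<in> carrier (gl V). deg1 (cf f)}\<rparr>"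

definition I1 :: "((nat \<times> nat) \<times> (nat \<times> nat)) set"
  where "I1 = {(p, q). p \<in> I \<and> q \<in> I \<and> fst p = fst (up q)}"

lemma finite_I1: "finite I1"
  by (rule finite_subset[of _ "I \<times> I"]) (auto simp: I1_def finite_I simp del: mem_I)

lemma unit_G1: "(p, q) \<in> I1 \<Longrightarrow> op (unit p q) \<in> carrier G1"
  by (auto simp: I1_def op_closed cf_op_unit deg1_def unit_def simp del: mem_I split: if_splits)

lemma unit_G0: "p \<in> I \<Longrightarrow> q \<in> I \<Longrightarrow> fst p = fst q \<Longrightarrow> op (unit p q) \<in> carrier G0"
  by (auto simp: op_closed cf_op_unit deg0_def unit_def simp del: mem_I split: if_splits)

lemma strip_G1:
  assumes "valid n"
  shows "op (strip n) \<in> carrier G1" and "cf (op (strip n)) = strip n"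
proof -
  have "a \<in> I \<and> b \<in> I" if "strip n a b \<noteq> 0" for a b
    using that assms by (auto simp: strip_def valid_def split: if_splits)
  then show "cf (op (strip n)) = strip n" by (rule cf_op)
  then show "op (strip n) \<in> carrier G1" using strip_deg1[OF assms] by (simp add: op_closed)
qed

end

text \<open>The module property is assumed here and is discharged in
  \<open>multiplicities_frame\<close>, where \<open>lie_module_theta\<close> is transported to
  coordinates.\<close>

locale graded_levels = framed_levels m r V B co
  for m :: nat and r :: "nat \<Rightarrow> nat" and V :: "('a::field_char_0, 'v) module"
    and B :: "nat \<times> nat \<Rightarrow> 'v" and co :: "nat \<times> nat \<Rightarrow> 'v \<Rightarrow> 'a" +
  assumes mod: "lie_module G0 G1 (lie_bracket (gl V))"
begin

sublocale M: lie_module G0 G1 "lie_bracket (gl V)" by (rule mod)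

lemma frame_G1: "frame G1 I1 (\<lambda>(p, q). op (unit p q)) (\<lambda>(p, q) f. cf f p q)"
proof (rule frame.intro)
  show "vectorspace class_ring G1" by (rule M.vectorspace_V)
  show "finite I1" by (rule finite_I1)
  show "(case i of (p, q) \<Rightarrow> op (unit p q)) \<in> carrier G1" if "i \<in> I1" for i
    using that unit_G1 by (cases i) simp
  show "linear_on G1 ((\<lambda>(p, q) f. cf f p q) i)" for i
    by (cases i) (auto simp: linear_on_def cf_add cf_smult)
  show "(\<lambda>(p, q) f. cf f p q) i (case j of (p, q) \<Rightarrow> op (unit p q)) = (if i = j then 1 else 0)"
    if "i \<in> I1" "j \<in> I1" for i j
    using that by (cases i; cases j) (auto simp: I1_def cf_op_unit unit_def simp del: mem_I)
  fix f assume f: "f \<in> carrier G1" and 0: "\<And>i. i \<in> I1 \<Longrightarrow> (\<lambda>(p, q) f. cf f p q) i f = 0"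
  have "cf f a b = 0" for a b
  proof (rule ccontr)
    assume nz: "cf f a b \<noteq> 0"
    then have "(a, b) \<in> I1" using f cf_supp by (auto simp: I1_def deg1_def simp del: mem_I)
    then show False using 0[of "(a, b)"] nz by simp
  qed
  then have "cf f = cf \<zero>\<^bsub>gl V\<^esub>" by (intro ext) (simp add: cf_zero)
  moreover have "\<zero>\<^bsub>gl V\<^esub> \<in> carrier (gl V)"
  proof -
    interpret G: lie_algebra "gl V" by (rule lie_algebra_gl[OF F.vs])
    interpret GV: vectorspace class_ring "gl V" by (rule G.vectorspace_L)
    show ?thesis by simp
  qed
  ultimately show "f = \<zero>\<^bsub>G1\<^esub>" using f cf_inj by simp
qed

interpretation FG: frame G1 I1 "\<lambda>(p, q). op (unit p q)" "\<lambda>(p, q) f. cf f p q"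
  by (rule frame_G1)

lemma frame_dual_G1: "\<exists>C d. frame (dual_space G1) {..<vdim (dual_space G1)} C d"
proof (rule frame_exists)
  show vs: "vectorspace class_ring (dual_space G1)" by (rule vectorspace_dual_space[OF M.vectorspace_V])
  show "vectorspace.fin_dim class_ring (dual_space G1)"
  proof (rule dim_le_card_separating(1)[OF vs finite_I1, of "\<lambda>i f. f (case i of (p, q) \<Rightarrow> op (unit p q))"])
    show "linear_on (dual_space G1) (\<lambda>f. f (case i of (p, q) \<Rightarrow> op (unit p q)))" if "i \<in> I1" for i
      by (rule linear_on_dual_eval[OF FG.B_closed[OF that]])
    fix f assume "f \<in> carrier (dual_space G1)" and "\<And>i. i \<in> I1 \<Longrightarrow> f (case i of (p, q) \<Rightarrow> op (unit p q)) = 0"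
    then show "f = \<zero>\<^bsub>dual_space G1\<^esub>" by (rule FG.dual_zeroI)
  qed
qed

text \<open>A functional on \<open>G1\<close> is the trace pairing with an array \<open>W\<close> of
  degree -1. Being annihilated by the whole orbit means that \<open>W\<close> commutes with the
  generic element, and by \<open>generic_centraliser\<close> such a \<open>W\<close> is determined
  by \<open>k\<close> of its entries.\<close>

lemma index_dual_le:
  assumes k: "\<And>j. (\<forall>i<m. j < r i) \<Longrightarrow> j < k" and kr: "\<And>i. i < m \<Longrightarrow> k \<le> r i"
  shows "lie_index G0 (dual_space G1) (dual_action G1 (lie_bracket (gl V))) \<le> int k"
proof -
  interpret D: lie_module G0 "dual_space G1" "dual_action G1 (lie_bracket (gl V))"
    by (rule lie_module_dual) (rule mod)
  obtain C d where fr: "frame (dual_space G1) {..<vdim (dual_space G1)} C d"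
    using frame_dual_G1 by (elim exE)
  define \<xi>0 where "\<xi>0 = op (strip gen_coeff)"
  have \<xi>0: "\<xi>0 \<in> carrier G1" "cf \<xi>0 = strip gen_coeff"
    using strip_G1[OF valid_gen] by (auto simp: \<xi>0_def)
  \<comment> \<open>The form on the dual of \<open>G1\<close> is evaluation at the generic
    element.\<close>
  define \<xi> where "\<xi> = (\<lambda>f\<in>carrier (dual_space G1). f \<xi>0)"
  have \<xi>: "\<xi> \<in> carrier (dual_space (dual_space G1))"
  proof -
    interpret DV: vectorspace class_ring "dual_space G1" by (rule D.vectorspace_V)
    have "linear_on (dual_space G1) \<xi>"
      using linear_on_dual_eval[OF \<xi>0(1)] vs_facts(2)[OF D.vectorspace_V]
      by (simp add: linear_on_def \<xi>_def)
    then show ?thesis by (simp add: carrier_dual_space[of _ "dual_space G1"] \<xi>_def)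
  qed
  have kI: "(0, j) \<in> I" "dn (0, j) \<in> I" if "j < k" for j
    using that kr[of 0] kr[of "fst (dn (0, j))"] m_pos by (auto simp: dn_def)
  have kI1: "((0, j), dn (0, j)) \<in> I1" if "j < k" for j
    using kI[OF that] m_pos up_dn[of "(0, j)"] by (simp add: I1_def)
  define \<phi> where "\<phi> j f = f (op (unit (0, j) (dn (0, j))))" for j and f :: "('v \<Rightarrow> 'v) \<Rightarrow> 'a"
  have "lie_index G0 (dual_space G1) (dual_action G1 (lie_bracket (gl V))) \<le> int (card {..<k})"
  proof (rule D.lie_index_le[OF fr \<xi>, of _ \<phi>])
    show "finite {..<k}" by simp
    show "linear_on (dual_space G1) (\<phi> t)" if "t \<in> {..<k}" for t
      unfolding \<phi>_def using that by (intro linear_on_dual_eval unit_G1 kI1) simp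
    fix f assume f: "f \<in> carrier (dual_space G1)"
      and inv: "\<And>x. x \<in> carrier G0 \<Longrightarrow> \<xi> (dual_action G1 (lie_bracket (gl V)) x f) = 0"
      and \<phi>0: "\<And>t. t \<in> {..<k} \<Longrightarrow> \<phi> t f = 0"
    have linf: "linear_on G1 f" using f by (simp add: carrier_dual_space)
    \<comment> \<open>The indices are transposed so that the functional becomes a trace.\<close>
    define W :: "'a array" where "W a b = (if (b, a) \<in> I1 then f (op (unit b a)) else 0)" for a b
    have dI1: "(b, a) \<in> I1 \<longleftrightarrow> a \<in> I \<and> b \<in> I \<and> fst a = fst (dn b)" for a b
    proof -
      have "fst b = fst (up a) \<longleftrightarrow> fst a = fst (dn b)" if "a \<in> I" "b \<in> I"
        using I_less[OF that(1)] I_less[OF that(2)] m_pos by (auto simp: up_def dn_def)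
      then show ?thesis by (auto simp: I1_def simp del: mem_I)
    qed
    have degW: "degm W" by (auto simp: degm_def W_def dI1 simp del: mem_I split: if_splits)
    have fW: "f N = tr W (cf N)" if N: "N \<in> carrier G1" for N
    proof -
      have "f N = (\<Sum>i\<in>I1. (case i of (p, q) \<Rightarrow> cf N p q * W q p))"
        using FG.linear_expand[OF linf N]
        by (auto simp: W_def split_beta intro!: sum.cong)
      also have "\<dots> = (\<Sum>(p, q)\<in>I \<times> I. cf N p q * W q p)"
        by (intro sum.mono_neutral_left) (auto simp: finite_I I1_def W_def simp del: mem_I split: if_splits)
      also have "\<dots> = tr (cf N) W" unfolding tr_def by (simp add: sum.cartesian_product)
      also have "\<dots> = tr W (cf N)" by (rule tr_sym)
      finally show ?thesis .
    qed
    \<comment> \<open>Entries of the commutator inside a level are tested by matrix units of degree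
      0; the others vanish for degree reasons.\<close>
    have entry: "com W (strip gen_coeff) a b = 0" if ab: "a \<in> I" "b \<in> I" for a b
    proof (cases "fst a = fst b")
      case True
      define x where "x = op (unit b a)"
      have x: "x \<in> carrier G0" "cf x = unit b a"
        using unit_G0[of b a] ab True by (auto simp: x_def cf_op_unit simp del: mem_I)
      have br: "lie_bracket (gl V) x \<xi>0 \<in> carrier G1" by (rule M.act_closed[OF x(1) \<xi>0(1)])
      have "dual_action G1 (lie_bracket (gl V)) x f \<in> carrier (dual_space G1)"
        by (rule D.act_closed[OF x(1) f])
      then have "f (lie_bracket (gl V) x \<xi>0) = 0"
        using inv[OF x(1)] \<xi>0(1) by (simp add: \<xi>_def dual_action_def)
      then have "tr W (com (unit b a) (strip gen_coeff)) = 0"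
        using fW[OF br] cf_bracket[of x \<xi>0] x \<xi>0 by simp
      then have "tr (unit b a) (com W (strip gen_coeff)) = 0"
        using tr_com'[of W "unit b a" "strip gen_coeff"] by simp
      then show ?thesis using tr_unit[OF ab(2,1)] tr_sym by metis
    next
      case False
      have lt: "fst a < m" "fst b < m" using ab I_less by auto
      have "W a (up b) = 0"
        using False degW dn_up[OF lt(2)] unfolding degm_def by metis
      moreover have "W (dn a) b = 0"
      proof (rule ccontr)
        assume "W (dn a) b \<noteq> 0"
        then have "fst (dn a) = fst (dn b)" using degW unfolding degm_def by blast
        then show False using False lt by (simp add: dn_def split: if_splits)
      qed
      ultimately show ?thesis using I_less[OF ab(1)]
        by (simp add: com_def mm_strip_right[OF valid_gen] mm_strip_left[OF valid_gen])
    qed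
    have comW: "comm gen_coeff W"
      using entry I_less
      by (auto simp: comm_def com_def mm_strip_right[OF valid_gen] mm_strip_left[OF valid_gen] simp del: mem_I)
    have "W a b = 0" for a b
    proof (rule generic_centraliser[OF degW comW k])
      show "W (dn (0, j)) (0, j) = 0" if "j < k" for j
        using \<phi>0[of j] that by (simp add: W_def \<phi>_def)
    qed
    then have "f (case i of (p, q) \<Rightarrow> op (unit p q)) = 0" if "i \<in> I1" for i
      using that by (cases i) (metis W_def case_prod_conv)
    then show "f = \<zero>\<^bsub>dual_space G1\<^esub>" by (rule FG.dual_zeroI[OF f])
  qed
  then show ?thesis by simp
qed

end

section \<open>The index on the slice\<close>

lemma subspace_abelian_subgroup:
  assumes "VectorSpace.subspace class_ring U (V :: ('a::field, 'v, 'e) module_scheme)"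
  shows "abelian_subgroup U V"
proof -
  have V: "vectorspace class_ring V" and sm: "submodule class_ring U V"
    using assms by (auto simp: VectorSpace.subspace_def)
  interpret V: vectorspace class_ring V by (rule V)
  have sub: "U \<subseteq> carrier V" using sm submodule.subset by blast
  have neg: "\<ominus>\<^bsub>V\<^esub> u \<in> U" if "u \<in> U" for u
    using submodule.smult_closed[OF sm, of "-1" u] that sub vs_facts(9)[OF V, of u] by auto
  have "additive_subgroup U V"
    by (rule additive_subgroup.intro, rule group.subgroupI[OF V.M.a_group])
      (use sub neg submodule.zero_closed[OF sm] submodule.m_closed[OF sm] in
        \<open>auto simp: a_inv_def[symmetric]\<close>)
  then show ?thesis by (rule abelian_subgroupI3) (rule V.M.abelian_group_axioms)
qed

context lie_module
begin

context
  fixes v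
  assumes v: "v \<in> carrier V"
begin

abbreviation Q where "Q \<equiv> quot_space V (lie_orbit L act v)"
abbreviation cs where "cs w \<equiv> lie_orbit L act v +>\<^bsub>V\<^esub> w"

lemma quot_carrier: "carrier Q = cs ` carrier V"
  by (auto simp: quot_space_def A_RCOSETS_def')

lemma quot_add: "w \<in> carrier V \<Longrightarrow> w' \<in> carrier V \<Longrightarrow> cs w \<oplus>\<^bsub>Q\<^esub> cs w' = cs (w \<oplus>\<^bsub>V\<^esub> w')"
proof -
  interpret U: abelian_subgroup "lie_orbit L act v" V
    by (rule subspace_abelian_subgroup[OF subspace_orbit[OF v]])
  show "w \<in> carrier V \<Longrightarrow> w' \<in> carrier V \<Longrightarrow> cs w \<oplus>\<^bsub>Q\<^esub> cs w' = cs (w \<oplus>\<^bsub>V\<^esub> w')"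
    by (simp add: quot_space_def U.a_rcos_sum)
qed

lemma quot_smult: "w \<in> carrier V \<Longrightarrow> c \<odot>\<^bsub>Q\<^esub> cs w = cs (c \<odot>\<^bsub>V\<^esub> w)"
  by (rule vectorspace_quot_space(2)[OF subspace_orbit[OF v]])

lemma coset_eqD:
  assumes "w \<in> carrier V" "w' \<in> carrier V" "cs w' = cs w"
  shows "\<exists>x\<in>carrier L. w' = act x v \<oplus>\<^bsub>V\<^esub> w"
proof -
  interpret U: abelian_subgroup "lie_orbit L act v" V
    by (rule subspace_abelian_subgroup[OF subspace_orbit[OF v]])
  have "w' \<in> cs w" using U.a_rcos_self[OF assms(2)] assms(3) by simp
  then show ?thesis by (auto simp: a_r_coset_def' lie_orbit_def)
qed

lemma coset_eqI:
  assumes "w \<in> carrier V" "x \<in> carrier L"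
  shows "cs (act x v \<oplus>\<^bsub>V\<^esub> w) = cs w"
proof -
  interpret V: vectorspace class_ring V by (rule vectorspace_V)
  interpret U: abelian_subgroup "lie_orbit L act v" V
    by (rule subspace_abelian_subgroup[OF subspace_orbit[OF v]])
  have "act x v \<oplus>\<^bsub>V\<^esub> w \<in> cs w" using assms(2) by (auto simp: a_r_coset_def' lie_orbit_def)
  then show ?thesis
    using V.M.a_repr_independence[OF _ assms(1) U.a_subgroup] by simp
qed

text \<open>For \<open>x\<close> in the stabiliser of \<open>v\<close>, x (y v) = [x, y] v stays in
  the orbit, so the class of x w depends only on the class of w.\<close>

lemma quot_action_coset:
  assumes x: "x \<in> carrier L" "act x v = \<zero>\<^bsub>V\<^esub>" and w: "w \<in> carrier V"
  shows "quot_action V (lie_orbit L act v) act x (cs w) = cs (act x w)"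
proof -
  interpret V: vectorspace class_ring V by (rule vectorspace_V)
  interpret U: abelian_subgroup "lie_orbit L act v" V
    by (rule subspace_abelian_subgroup[OF subspace_orbit[OF v]])
  have act0: "act y \<zero>\<^bsub>V\<^esub> = \<zero>\<^bsub>V\<^esub>" if "y \<in> carrier L" for y
    using act_smult_right[of y "\<zero>\<^bsub>V\<^esub>" 0] that act_closed
    by (simp add: vs_facts(7,8)[OF vectorspace_V])
  have "cs (act x w') = cs (act x w)" if w': "w' \<in> cs w" for w'
  proof -
    obtain y where y: "y \<in> carrier L" "w' = act y v \<oplus>\<^bsub>V\<^esub> w"
      using w' by (auto simp: a_r_coset_def' lie_orbit_def)
    have "act x (act y v) = act (lie_bracket L x y) v"
      using x y v by (simp add: act_bracket act0 a_minus_def act_closed)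
    then have "act x w' = act (lie_bracket L x y) v \<oplus>\<^bsub>V\<^esub> act x w"
      using x y v w by (simp add: act_add_right act_closed)
    then show ?thesis
      using coset_eqI[of "act x w" "lie_bracket L x y"] x y w by (simp add: act_closed bracket_closed)
  qed
  moreover have "w \<in> cs w" using w by (rule U.a_rcos_self)
  ultimately show ?thesis unfolding quot_action_def by blast
qed

end

end

locale bad_graded = graded_levels m r V B co + bad_levels m r k
  for m :: nat and r :: "nat \<Rightarrow> nat" and V :: "('a::field_char_0, 'v) module"
    and B :: "nat \<times> nat \<Rightarrow> 'v" and co :: "nat \<times> nat \<Rightarrow> 'v \<Rightarrow> 'a" and k :: nat
begin

interpretation FG: frame G1 I1 "\<lambda>(p, q). op (unit p q)" "\<lambda>(p, q) f. cf f p q"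
  by (rule frame_G1)

definition v0 :: "'v \<Rightarrow> 'v"
  where "v0 = op (strip bad_coeff)"

lemma v0: "v0 \<in> carrier G1" "cf v0 = strip bad_coeff"
  using strip_G1[OF valid_bad] by (auto simp: v0_def)

abbreviation br where "br \<equiv> lie_bracket (gl V)"
abbreviation U where "U \<equiv> lie_orbit G0 br v0"
abbreviation Q where "Q \<equiv> quot_space G1 U"
abbreviation cs where "cs w \<equiv> U +>\<^bsub>G1\<^esub> w"
abbreviation L' where "L' \<equiv> lie_stabiliser G0 G1 br v0"
abbreviation act' where "act' \<equiv> dual_action Q (quot_action G1 U br)"

lemmas qcarrier = M.quot_carrier[OF v0(1)]
lemmas qadd = M.quot_add[OF v0(1)]
lemmas qsmult = M.quot_smult[OF v0(1)]

lemma cs_mem: "N \<in> carrier G1 \<Longrightarrow> cs N \<in> carrier Q"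
  unfolding qcarrier by (rule imageI)

lemma mod': "lie_module L' (dual_space Q) act'"
  by (rule lie_module_dual, rule lie_module_quot[OF mod v0(1)])

sublocale D: lie_module L' "dual_space Q" act' by (rule mod')

lemma frame_dual_Q: "\<exists>C d. frame (dual_space Q) {..<vdim (dual_space Q)} C d"
proof (rule frame_exists)
  show vs: "vectorspace class_ring (dual_space Q)" by (rule D.vectorspace_V)
  show "vectorspace.fin_dim class_ring (dual_space Q)"
  proof (rule dim_le_card_separating(1)[OF vs finite_I1, of "\<lambda>i f. f (cs (case i of (p, q) \<Rightarrow> op (unit p q)))"])
    show "linear_on (dual_space Q) (\<lambda>f. f (cs (case i of (p, q) \<Rightarrow> op (unit p q))))" if "i \<in> I1" for i
      by (rule linear_on_dual_eval[OF cs_mem[OF FG.B_closed[OF that]]])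
    fix f assume f: "f \<in> carrier (dual_space Q)"
      and 0: "\<And>i. i \<in> I1 \<Longrightarrow> f (cs (case i of (p, q) \<Rightarrow> op (unit p q))) = 0"
    have lf: "linear_on Q f" "f \<in> extensional (carrier Q)"
      using f unfolding carrier_dual_space[of f Q] by auto
    have lin: "linear_on G1 (\<lambda>N. f (cs N))"
      unfolding linear_on_def
    proof (intro conjI ballI allI)
      fix N N' assume N: "N \<in> carrier G1" "N' \<in> carrier G1"
      show "f (cs (N \<oplus>\<^bsub>G1\<^esub> N')) = f (cs N) + f (cs N')"
        unfolding qadd[OF N, symmetric] by (rule linear_onD(1)[OF lf(1) cs_mem[OF N(1)] cs_mem[OF N(2)]])
    next
      fix c N assume N: "N \<in> carrier G1"
      show "f (cs (c \<odot>\<^bsub>G1\<^esub> N)) = c * f (cs N)"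
        unfolding qsmult[OF N, symmetric] by (rule linear_onD(2)[OF lf(1) cs_mem[OF N]])
    qed
    have fN: "f (cs N) = 0" if N: "N \<in> carrier G1" for N
      unfolding FG.linear_expand[OF lin N] by (intro sum.neutral ballI) (simp add: 0)
    show "f = \<zero>\<^bsub>dual_space Q\<^esub>"
    proof (rule extensionalityI[OF lf(2)])
      show "\<zero>\<^bsub>dual_space Q\<^esub> \<in> extensional (carrier Q)" by (simp add: dual_space_ops)
      fix X assume X: "X \<in> carrier Q"
      then obtain N where "N \<in> carrier G1" "X = cs N" unfolding qcarrier by (rule imageE) 
      then show "f X = \<zero>\<^bsub>dual_space Q\<^esub> X" using fN X by (simp add: dual_space_ops)
    qed
  qed
qed

section \<open>The centraliser as functionals on the slice\<close>

definition rep :: "('v \<Rightarrow> 'v) set \<Rightarrow> 'v \<Rightarrow> 'v"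
  where "rep X = (SOME N. N \<in> carrier G1 \<and> X = cs N)"

text \<open>The trace pairing with \<open>w\<close>, carried to the quotient through a chosen
  representative; for \<open>w\<close> in the centraliser the choice is immaterial by
  \<open>\<Phi>_coset\<close>.\<close>

definition \<Phi> :: "'a array \<Rightarrow> ('v \<Rightarrow> 'v) set \<Rightarrow> 'a"
  where "\<Phi> w = (\<lambda>X\<in>carrier Q. tr w (cf (rep X)))"

lemma rep:
  assumes "X \<in> carrier Q"
  shows "rep X \<in> carrier G1" and "cs (rep X) = X"
proof -
  obtain N where "N \<in> carrier G1" "X = cs N" using assms unfolding qcarrier by (rule imageE)
  then have "rep X \<in> carrier G1 \<and> X = cs (rep X)"
    unfolding rep_def by (intro someI[of "\<lambda>N. N \<in> carrier G1 \<and> X = cs N" N] conjI)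
  then show "rep X \<in> carrier G1" "cs (rep X) = X" by (rule conjunct1, metis)
qed

lemma tr_add_right: "tr w (\<lambda>a b. A a b + A' a b) = tr w A + tr w A'"
  and tr_add_left: "tr (\<lambda>a b. A a b + A' a b) w = tr A w + tr A' w"
  and tr_smult_right: "tr w (\<lambda>a b. c * A a b) = c * tr w A"
  and tr_smult_left: "tr (\<lambda>a b. c * A a b) w = c * tr A w"
  by (simp_all add: tr_def distrib_left distrib_right sum.distrib sum_distrib_left mult_ac)

lemma cent_com:
  fixes w :: "'a array"
  assumes "w \<in> cent bad_coeff"
  shows "com w (strip bad_coeff) = (\<lambda>a b. 0)"
proof -
  have "a \<in> I \<and> b \<in> I" if "w a b \<noteq> 0" for a b
    using assms that unfolding cent_def degm_def by blast
  then show ?thesis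
    using assms comm_iff[OF valid_bad, of w] by (intro ext) (auto simp: cent_def simp del: mem_I)
qed

text \<open>Two representatives differ by some [x, v0], and the trace of w [x, v0] is minus that of
  x [w, v0], which is zero.\<close>

lemma \<Phi>_coset:
  assumes w: "w \<in> cent bad_coeff" and N: "N \<in> carrier G1"
  shows "\<Phi> w (cs N) = tr w (cf N)"
proof -
  have R: "rep (cs N) \<in> carrier G1" "cs (rep (cs N)) = cs N" using rep[OF cs_mem[OF N]] .
  obtain x where x: "x \<in> carrier G0" "rep (cs N) = br x v0 \<oplus>\<^bsub>G1\<^esub> N"
    using M.coset_eqD[OF v0(1) N R] by (rule bexE)
  have b: "br x v0 \<in> carrier G1" by (rule M.act_closed[OF x(1) v0(1)])
  have "cf (rep (cs N)) = (\<lambda>a b. com (cf x) (strip bad_coeff) a b + cf N a b)"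
    using x b N v0 cf_add[of "br x v0" N] cf_bracket[of x v0] by simp
  then have "tr w (cf (rep (cs N))) = tr w (com (cf x) (strip bad_coeff)) + tr w (cf N)"
    by (simp add: tr_add_right)
  also have "tr w (com (cf x) (strip bad_coeff)) = - tr (cf x) (\<lambda>a b. 0)"
    unfolding tr_com' cent_com[OF w] ..
  also have "\<dots> = 0" by (simp add: tr_def)
  finally show ?thesis using cs_mem[OF N] by (simp add: \<Phi>_def)
qed

lemma \<Phi>_dual:
  assumes w: "w \<in> cent bad_coeff"
  shows "\<Phi> w \<in> carrier (dual_space Q)"
proof -
  have "linear_on Q (\<Phi> w)"
    unfolding linear_on_def
  proof (intro conjI ballI allI)
    fix X Y assume XY: "X \<in> carrier Q" "Y \<in> carrier Q"
    obtain N where N: "N \<in> carrier G1" "X = cs N" using XY(1) unfolding qcarrier by (rule imageE)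
    obtain N' where N': "N' \<in> carrier G1" "Y = cs N'" using XY(2) unfolding qcarrier by (rule imageE)
    have "N \<oplus>\<^bsub>G1\<^esub> N' \<in> carrier G1" by (rule FG.M.a_closed[OF N(1) N'(1)])
    from \<Phi>_coset[OF w this] show "\<Phi> w (X \<oplus>\<^bsub>Q\<^esub> Y) = \<Phi> w X + \<Phi> w Y"
      unfolding N(2) N'(2) qadd[OF N(1) N'(1)] \<Phi>_coset[OF w N(1)] \<Phi>_coset[OF w N'(1)]
      using N N' by (simp add: cf_add tr_add_right)
  next
    fix c X assume X: "X \<in> carrier Q"
    obtain N where N: "N \<in> carrier G1" "X = cs N" using X unfolding qcarrier by (rule imageE)
    have "c \<odot>\<^bsub>G1\<^esub> N \<in> carrier G1" by (rule FG.smult_mem[OF N(1)])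
    from \<Phi>_coset[OF w this] show "\<Phi> w (c \<odot>\<^bsub>Q\<^esub> X) = c * \<Phi> w X"
      unfolding N(2) qsmult[OF N(1)] \<Phi>_coset[OF w N(1)]
      using N by (simp add: cf_smult tr_smult_right)
  qed
  then show ?thesis unfolding carrier_dual_space[of _ Q] by (simp add: \<Phi>_def)
qed

lemma act_\<Phi>:
  assumes w: "w \<in> cent bad_coeff" and x: "x \<in> carrier G0" "br x v0 = \<zero>\<^bsub>G1\<^esub>"
  shows "act' x (\<Phi> w) = \<Phi> (com (cf x) w)"
proof -
  have "- \<Phi> w (quot_action G1 U br x X) = tr (com (cf x) w) (cf (rep X))" if X: "X \<in> carrier Q" for X
  proof -
    note R = rep[OF X]
    have b: "br x (rep X) \<in> carrier G1" by (rule M.act_closed[OF x(1) R(1)])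
    have "quot_action G1 U br x X = cs (br x (rep X))"
      using M.quot_action_coset[OF v0(1) x R(1)] unfolding R(2) .
    then have "\<Phi> w (quot_action G1 U br x X) = tr w (cf (br x (rep X)))"
      using \<Phi>_coset[OF w b] by simp
    also have "cf (br x (rep X)) = com (cf x) (cf (rep X))"
      using x R(1) by (intro cf_bracket) auto
    also have "tr w (com (cf x) (cf (rep X))) = - tr (com (cf x) w) (cf (rep X))"
      by (rule tr_com)
    finally show ?thesis by simp
  qed
  then show ?thesis
    unfolding dual_action_def \<Phi>_def[of "com (cf x) w"] by (intro restrict_ext) simp
qed

lemma stab_cf:
  assumes x: "x \<in> carrier G0" "br x v0 = \<zero>\<^bsub>G1\<^esub>"
  shows "cf x \<in> stab bad_coeff"
proof -
  have "com (cf x) (strip bad_coeff) = (\<lambda>a b. 0)"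
    using cf_bracket[of x v0] x v0 cf_zero by simp
  then show ?thesis
    using x comm_iff[OF valid_bad, of "cf x"] cf_supp by (auto simp: stab_def simp del: mem_I)
qed

text \<open>An arbitrary form on the dual of the slice is pulled back along \<Phi> to the
  centraliser, where \<open>bad_invariants\<close> supplies k + 1 elements.\<close>

lemma bad_index: "int (Suc k) \<le> lie_index L' (dual_space Q) act'"
proof -
  obtain C d where fr: "frame (dual_space Q) {..<vdim (dual_space Q)} C d"
    using frame_dual_Q by (elim exE)
  show ?thesis
  proof (rule D.lie_index_ge[OF fr])
    fix \<zeta> assume \<zeta>: "\<zeta> \<in> carrier (dual_space (dual_space Q))"
    have lin\<zeta>: "linear_on (dual_space Q) \<zeta>"
      using \<zeta> unfolding carrier_dual_space[of _ "dual_space Q"] by simp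
    have lin: "linear_cent bad_coeff (\<lambda>w. \<zeta> (\<Phi> w))"
      unfolding linear_cent_def
    proof (intro conjI ballI allI)
      fix w w' :: "'a array" assume w: "w \<in> cent bad_coeff" "w' \<in> cent bad_coeff"
      have "\<Phi> (\<lambda>a b. w a b + w' a b) = \<Phi> w \<oplus>\<^bsub>dual_space Q\<^esub> \<Phi> w'"
        unfolding dual_space_ops by (auto simp: \<Phi>_def tr_add_left intro!: restrict_ext)
      then show "\<zeta> (\<Phi> (\<lambda>a b. w a b + w' a b)) = \<zeta> (\<Phi> w) + \<zeta> (\<Phi> w')"
        using linear_onD(1)[OF lin\<zeta> \<Phi>_dual[OF w(1)] \<Phi>_dual[OF w(2)]] by simp
    next
      fix c and w :: "'a array" assume w: "w \<in> cent bad_coeff"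
      have "\<Phi> (\<lambda>a b. c * w a b) = c \<odot>\<^bsub>dual_space Q\<^esub> \<Phi> w"
        unfolding dual_space_ops by (auto simp: \<Phi>_def tr_smult_left intro!: restrict_ext)
      then show "\<zeta> (\<Phi> (\<lambda>a b. c * w a b)) = c * \<zeta> (\<Phi> w)"
        using linear_onD(2)[OF lin\<zeta> \<Phi>_dual[OF w]] by simp
    qed
    obtain w p where wp: "\<forall>t<Suc k. inv_under bad_coeff (\<lambda>w. \<zeta> (\<Phi> w)) (w t) \<and>
        (\<forall>s<Suc k. w s (fst (p t)) (snd (p t)) = 0 \<longleftrightarrow> s \<noteq> t)"
      using bad_invariants[OF lin] by (elim exE)
    have wc: "w t \<in> cent bad_coeff" and winv: "\<And>x. x \<in> stab bad_coeff \<Longrightarrow> \<zeta> (\<Phi> (com x (w t))) = 0"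
      if "t < Suc k" for t
      using wp that unfolding inv_under_def by simp_all
    have wpt: "w s (fst (p t)) (snd (p t)) = 0 \<longleftrightarrow> s \<noteq> t" if "s < Suc k" "t < Suc k" for s t
      using wp that by simp
    \<comment> \<open>Pairing with the matrix unit at the transposed position reads off the entry of
      the array at \<open>p t\<close>.\<close>
    define g where "g t f = f (cs (op (unit (snd (p t)) (fst (p t)))))" for t and f :: "('v \<Rightarrow> 'v) set \<Rightarrow> 'a"
    have pI: "(snd (p t), fst (p t)) \<in> I1" if "t < Suc k" for t
    proof -
      have "w t (fst (p t)) (snd (p t)) \<noteq> 0" using wpt[OF that that] by simp
      then have "fst (p t) \<in> I \<and> snd (p t) \<in> I \<and> fst (fst (p t)) = fst (dn (snd (p t)))"
        using wc[OF that] unfolding cent_def degm_def by blast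
      then show ?thesis
        using I_less[of "fst (p t)"] I_less[of "snd (p t)"] m_pos
        by (auto simp: I1_def up_def dn_def simp del: mem_I)
    qed
    have gw: "g t (\<Phi> (w s)) = w s (fst (p t)) (snd (p t))" if st: "s < Suc k" "t < Suc k" for s t
    proof -
      have I: "snd (p t) \<in> I" "fst (p t) \<in> I" using pI[OF st(2)] unfolding I1_def by auto
      show ?thesis
        unfolding g_def \<Phi>_coset[OF wc[OF st(1)] unit_G1[OF pI[OF st(2)]]] cf_op_unit[OF I]
        by (rule tr_unit[OF I])
    qed
    have "\<forall>t<Suc k. \<Phi> (w t) \<in> carrier (dual_space Q) \<and>
        (\<forall>x\<in>carrier L'. \<zeta> (act' x (\<Phi> (w t))) = 0) \<and>
        linear_on (dual_space Q) (g t) \<and> (\<forall>s<Suc k. g t (\<Phi> (w s)) = 0 \<longleftrightarrow> s \<noteq> t)"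
    proof (intro allI impI conjI ballI)
      fix t assume t: "t < Suc k"
      show "\<Phi> (w t) \<in> carrier (dual_space Q)" by (rule \<Phi>_dual[OF wc[OF t]])
      show "linear_on (dual_space Q) (g t)"
        unfolding g_def by (rule linear_on_dual_eval[OF cs_mem[OF unit_G1[OF pI[OF t]]]])
      show "g t (\<Phi> (w s)) = 0 \<longleftrightarrow> s \<noteq> t" if "s < Suc k" for s
        unfolding gw[OF that t] by (rule wpt[OF that t])
      fix x assume "x \<in> carrier L'"
      then have x: "x \<in> carrier G0" "br x v0 = \<zero>\<^bsub>G1\<^esub>" by (auto simp: lie_stabiliser_def)
      show "\<zeta> (act' x (\<Phi> (w t))) = 0"
        unfolding act_\<Phi>[OF wc[OF t] x] by (rule winv[OF t stab_cf[OF x]])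
    qed
    then show "\<exists>z g. \<forall>t<Suc k. z t \<in> carrier (dual_space Q) \<and>
        (\<forall>x\<in>carrier L'. \<zeta> (act' x (z t)) = 0) \<and>
        linear_on (dual_space Q) (g t) \<and> (\<forall>s<Suc k. g t (z s) = 0 \<longleftrightarrow> s \<noteq> t)"
      by (intro exI[of _ "\<lambda>t. \<Phi> (w t)"] exI[of _ g])
  qed
qed

lemma no_GIB:
  assumes k: "\<And>j. (\<forall>i<m. j < r i) \<Longrightarrow> j < k"
  shows "\<not> has_GIB G0 G1 br"
proof
  assume "has_GIB G0 G1 br"
  then have "lie_index G0 (dual_space G1) (dual_action G1 br) = lie_index L' (dual_space Q) act'"
    using v0(1) unfolding has_GIB_def Let_def by (rule bspec)
  moreover have "lie_index G0 (dual_space G1) (dual_action G1 br) \<le> int k"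
    by (rule index_dual_le) (fact k, fact kr)
  ultimately show False using bad_index by linarith
qed

end

section \<open>Coordinates adapted to the grading\<close>

lemma primitive_root_power_eq:
  fixes \<zeta> :: "'a::field"
  assumes "primitive_root_of_unity m \<zeta>"
  shows "\<zeta> ^ p = \<zeta> ^ q \<longleftrightarrow> p mod m = q mod m"
proof -
  have m: "m > 0" "\<zeta> ^ m = 1" and prim: "\<And>k. 0 < k \<Longrightarrow> k < m \<Longrightarrow> \<zeta> ^ k \<noteq> 1"
    using assms by (auto simp: primitive_root_of_unity_def)
  have nz: "\<zeta> \<noteq> 0" using m by (auto simp: power_0_left)
  have red: "\<zeta> ^ p = \<zeta> ^ (p mod m)" for p
  proof -
    have "\<zeta> ^ p = \<zeta> ^ (m * (p div m) + p mod m)" by simp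
    also have "\<dots> = \<zeta> ^ (p mod m)" unfolding power_add power_mult m(2) by simp
    finally show ?thesis .
  qed
  have inj: "p = q" if "p \<le> q" "q < m" "\<zeta> ^ p = \<zeta> ^ q" for p q
  proof (rule ccontr)
    assume "p \<noteq> q"
    have "\<zeta> ^ q = \<zeta> ^ p * \<zeta> ^ (q - p)" using that(1) by (simp add: power_add[symmetric])
    then have "\<zeta> ^ (q - p) = 1" using that(3) nz by simp
    then show False using prim[of "q - p"] that \<open>p \<noteq> q\<close> by simp
  qed
  show ?thesis
  proof
    assume "\<zeta> ^ p = \<zeta> ^ q"
    then have "\<zeta> ^ (p mod m) = \<zeta> ^ (q mod m)" using red by metis
    then show "p mod m = q mod m"
      using inj[of "p mod m" "q mod m"] inj[of "q mod m" "p mod m"] m(1) by (metis linear mod_less_divisor)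
  qed (metis red)
qed

lemma mod_add_right_cancel:
  assumes "(m::nat) > 0"
  shows "(x + e) mod m = (y + e) mod m \<longleftrightarrow> x mod m = y mod m"
proof -
  have "(x + e) mod m = (y + e) mod m \<longleftrightarrow> (int x + int e) mod int m = (int y + int e) mod int m"
    by (simp flip: of_nat_add of_nat_mod)
  also have "\<dots> \<longleftrightarrow> int x mod int m = int y mod int m"
    by (simp add: mod_eq_dvd_iff)
  finally show ?thesis by (simp flip: of_nat_mod)
qed

context framed_levels
begin

text \<open>In an eigenbasis of \<open>s\<close>, conjugation multiplies the entry at (a, b) by d a
  / d b. Passing through the equation s f = c f s avoids inverses.\<close>

lemma conj_eigen_iff:
  assumes s: "s \<in> GL V" "\<And>b. b \<in> I \<Longrightarrow> s (B b) = d b \<odot>\<^bsub>V\<^esub> B b"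
    and f: "f \<in> carrier (gl V)"
  shows "GL_conj V s f = c \<odot>\<^bsub>gl V\<^esub> f \<longleftrightarrow> (\<forall>a b. cf f a b \<noteq> 0 \<longrightarrow> d a = c * d b)"
proof -
  have sg: "s \<in> carrier (gl V)" and bij: "bij_betw s (carrier V) (carrier V)"
    using s(1) by (auto simp: GL_def)
  define t where "t = inv_into (carrier V) s"
  have tc: "t v \<in> carrier V" if "v \<in> carrier V" for v
    unfolding t_def using bij_betwE[OF bij_betw_inv_into[OF bij]] that by blast
  have st: "s (t v) = v" if "v \<in> carrier V" for v
    unfolding t_def by (rule bij_betw_inv_into_right[OF bij that])
  have ts: "t (s v) = v" if "v \<in> carrier V" for v
    unfolding t_def by (rule bij_betw_inv_into_left[OF bij that])
  have th: "GL_conj V s f = (\<lambda>v\<in>carrier V. s (f (t v)))"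
    using f by (simp add: GL_conj_def t_def)
  have 1: "GL_conj V s f = c \<odot>\<^bsub>gl V\<^esub> f \<longleftrightarrow> (\<forall>v\<in>carrier V. s (f v) = c \<odot>\<^bsub>V\<^esub> f (s v))"
  proof
    assume e: "GL_conj V s f = c \<odot>\<^bsub>gl V\<^esub> f"
    show "\<forall>v\<in>carrier V. s (f v) = c \<odot>\<^bsub>V\<^esub> f (s v)"
    proof
      fix v assume v: "v \<in> carrier V"
      show "s (f v) = c \<odot>\<^bsub>V\<^esub> f (s v)"
        using fun_cong[OF e, of "s v"] v sg by (simp add: th gl_ops ts)
    qed
  next
    assume "\<forall>v\<in>carrier V. s (f v) = c \<odot>\<^bsub>V\<^esub> f (s v)"
    then show "GL_conj V s f = c \<odot>\<^bsub>gl V\<^esub> f"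
      using tc st by (auto simp: th gl_ops intro!: restrict_ext)
  qed
  have co_s: "co a (s w) = d a * co a w" if aw: "a \<in> I" "w \<in> carrier V" for a w
  proof -
    have "co a (s w) = (\<Sum>b\<in>I. if b = a then d a * co a w else 0)"
      unfolding co_apply[OF sg aw]
      using aw by (intro sum.cong refl)
        (auto simp: cf_def s(2) F.B_closed linear_onD(2)[OF F.linear_co] F.co_B simp del: mem_I)
    then show ?thesis using aw finite_I by simp
  qed
  have lc: "linear_on V (\<lambda>v. g (h v))" if "linear_on V g" "h \<in> carrier (gl V)" for g h
    using that by (simp add: linear_on_def carrier_gl)
  have l1: "linear_on V (\<lambda>v. co a (s (f v)))" if a: "a \<in> I" for a
    by (rule lc[OF lc[OF F.linear_co[OF a] sg] f])
  have l2: "linear_on V (\<lambda>v. co a (c \<odot>\<^bsub>V\<^esub> f (s v)))" if a: "a \<in> I" for a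
  proof -
    have "linear_on V (\<lambda>v. co a (c \<odot>\<^bsub>V\<^esub> v))"
      using linear_onD[OF F.linear_co[OF a]] unfolding linear_on_def
      by (simp add: distrib_left mult.left_commute)
    from lc[OF lc[OF this f] sg] show ?thesis .
  qed
  have e1: "co a (s (f (B b))) = d a * cf f a b" if "a \<in> I" "b \<in> I" for a b
    using that f F.B_closed by (simp add: co_s cf_def del: mem_I)
  have e2: "co a (c \<odot>\<^bsub>V\<^esub> f (s (B b))) = c * d b * cf f a b" if ab: "a \<in> I" "b \<in> I" for a b
  proof -
    have "f (s (B b)) = d b \<odot>\<^bsub>V\<^esub> f (B b)"
      using f F.B_closed[OF ab(2)] unfolding s(2)[OF ab(2)] carrier_gl by blast
    then show ?thesis
      using ab f F.B_closed[OF ab(2)] by (simp add: linear_onD(2)[OF F.linear_co] cf_def del: mem_I)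
  qed
  have "(\<forall>v\<in>carrier V. s (f v) = c \<odot>\<^bsub>V\<^esub> f (s v)) \<longleftrightarrow> (\<forall>a\<in>I. \<forall>b\<in>I. d a * cf f a b = c * d b * cf f a b)"
  proof
    assume h: "\<forall>v\<in>carrier V. s (f v) = c \<odot>\<^bsub>V\<^esub> f (s v)"
    show "\<forall>a\<in>I. \<forall>b\<in>I. d a * cf f a b = c * d b * cf f a b"
    proof (intro ballI)
      fix a b assume ab: "a \<in> I" "b \<in> I"
      show "d a * cf f a b = c * d b * cf f a b"
        unfolding e1[OF ab, symmetric] e2[OF ab, symmetric] using h F.B_closed[OF ab(2)] by simp
    qed
  next
    assume h: "\<forall>a\<in>I. \<forall>b\<in>I. d a * cf f a b = c * d b * cf f a b"
    show "\<forall>v\<in>carrier V. s (f v) = c \<odot>\<^bsub>V\<^esub> f (s v)"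
    proof
      fix v assume v: "v \<in> carrier V"
      show "s (f v) = c \<odot>\<^bsub>V\<^esub> f (s v)"
      proof (rule F.co_eqI)
        show "s (f v) \<in> carrier V" "c \<odot>\<^bsub>V\<^esub> f (s v) \<in> carrier V" using v f sg by auto
        fix a assume a: "a \<in> I"
        show "co a (s (f v)) = co a (c \<odot>\<^bsub>V\<^esub> f (s v))"
          unfolding F.linear_expand[OF l1[OF a] v] F.linear_expand[OF l2[OF a] v]
          using h a by (intro sum.cong refl) (simp add: e1 e2 del: mem_I)
      qed
    qed
  qed
  also have "\<dots> \<longleftrightarrow> (\<forall>a b. cf f a b \<noteq> 0 \<longrightarrow> d a = c * d b)"
  proof (intro iffI allI impI ballI)
    fix a b assume h: "\<forall>a\<in>I. \<forall>b\<in>I. d a * cf f a b = c * d b * cf f a b" and nz: "cf f a b \<noteq> 0"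
    then have "d a * cf f a b = c * d b * cf f a b" using cf_supp[OF nz] by blast
    then show "d a = c * d b" using nz by simp
  next
    fix a b assume "\<forall>a b. cf f a b \<noteq> 0 \<longrightarrow> d a = c * d b"
    then show "d a * cf f a b = c * d b * cf f a b" by (cases "cf f a b = 0") auto
  qed
  finally show ?thesis using 1 by simp
qed

text \<open>Level i carries the eigenvalue with exponent i + e. Conjugation sees ratios of
  eigenvalues only, so the rotation \<open>e\<close> cancels and the degree is read off the
  levels.\<close>

lemma graded_parts:
  assumes prim: "primitive_root_of_unity m \<zeta>" and s: "s \<in> GL V"
    and sB: "\<And>b. b \<in> I \<Longrightarrow> s (B b) = \<zeta> ^ ((fst b + e) mod m) \<odot>\<^bsub>V\<^esub> B b"
  shows "graded_part V \<zeta> (GL_conj V s) 0 = G0" and "graded_part V \<zeta> (GL_conj V s) 1 = G1"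
proof -
  have iff: "GL_conj V s f = c \<odot>\<^bsub>gl V\<^esub> f \<longleftrightarrow>
      (\<forall>a b. cf f a b \<noteq> 0 \<longrightarrow> \<zeta> ^ ((fst a + e) mod m) = c * \<zeta> ^ ((fst b + e) mod m))"
    if "f \<in> carrier (gl V)" for f c
    using s sB that by (rule conj_eigen_iff)
  have key: "(\<zeta> ^ ((fst a + e) mod m) = \<zeta> ^ i * \<zeta> ^ ((fst b + e) mod m)) \<longleftrightarrow> fst a = (fst b + i) mod m"
    if "a \<in> I" for a b :: "nat \<times> nat" and i
  proof -
    have "fst a < m" by (rule I_less[OF that])
    have "(\<zeta> ^ ((fst a + e) mod m) = \<zeta> ^ i * \<zeta> ^ ((fst b + e) mod m)) \<longleftrightarrow>
        (fst a + e) mod m = (fst b + i + e) mod m"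
      unfolding power_add[symmetric] primitive_root_power_eq[OF prim]
      by (simp add: mod_simps add_ac)
    also have "\<dots> \<longleftrightarrow> fst a mod m = (fst b + i) mod m"
      by (rule mod_add_right_cancel[OF m_pos])
    finally show ?thesis using \<open>fst a < m\<close> by simp
  qed
  have up1: "fst (up b) = (fst b + 1) mod m" if "b \<in> I" for b
    using I_less[OF that] by (auto simp: up_def mod_Suc)
  have up0: "fst b = (fst b + 0) mod m" if "b \<in> I" for b
    using I_less[OF that] by simp
  have "GL_conj V s f = \<zeta> ^ 0 \<odot>\<^bsub>gl V\<^esub> f \<longleftrightarrow> deg0 (cf f)" if "f \<in> carrier (gl V)" for f
    unfolding iff[OF that] deg0_def using key[of _ 0] up0 cf_supp by metis
  then show "graded_part V \<zeta> (GL_conj V s) 0 = G0"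
    unfolding graded_part_def by (intro arg_cong[of _ _ "\<lambda>C. (gl V)\<lparr>carrier := C\<rparr>"]) auto
  have "GL_conj V s f = \<zeta> ^ 1 \<odot>\<^bsub>gl V\<^esub> f \<longleftrightarrow> deg1 (cf f)" if "f \<in> carrier (gl V)" for f
    unfolding iff[OF that] deg1_def using key[of _ 1] up1 cf_supp by metis
  then show "graded_part V \<zeta> (GL_conj V s) 1 = G1"
    unfolding graded_part_def by (intro arg_cong[of _ _ "\<lambda>C. (gl V)\<lparr>carrier := C\<rparr>"]) auto
qed

end

text \<open>Uniqueness of the decomposition makes the component maps linear and determines them on
  each summand.\<close>

lemma direct_sum_projections:
  assumes V: "vectorspace class_ring (V :: ('a::field, 'v, 'e) module_scheme)"
    and ds: "internal_direct_sum V T W" and T: "finite T"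
  obtains pr where
    "\<And>v t. v \<in> carrier V \<Longrightarrow> t \<in> T \<Longrightarrow> pr t v \<in> W t"
    "\<And>v w t. v \<in> carrier V \<Longrightarrow> w \<in> carrier V \<Longrightarrow> t \<in> T \<Longrightarrow> pr t (v \<oplus>\<^bsub>V\<^esub> w) = pr t v \<oplus>\<^bsub>V\<^esub> pr t w"
    "\<And>c v t. v \<in> carrier V \<Longrightarrow> t \<in> T \<Longrightarrow> pr t (c \<odot>\<^bsub>V\<^esub> v) = c \<odot>\<^bsub>V\<^esub> pr t v"
    "\<And>b t t'. t \<in> T \<Longrightarrow> t' \<in> T \<Longrightarrow> b \<in> W t \<Longrightarrow> pr t' b = (if t' = t then b else \<zero>\<^bsub>V\<^esub>)"
    "\<And>v. v \<in> carrier V \<Longrightarrow> (\<And>t. t \<in> T \<Longrightarrow> pr t v = \<zero>\<^bsub>V\<^esub>) \<Longrightarrow> v = \<zero>\<^bsub>V\<^esub>"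
proof -
  interpret V: vectorspace class_ring V by (rule V)
  have sm: "submodule class_ring (W t) V" if "t \<in> T" for t
    using ds that by (auto simp: internal_direct_sum_def VectorSpace.subspace_def)
  have WV: "w \<in> carrier V" if "t \<in> T" "w \<in> W t" for t w
    using submodule.subset[OF sm[OF that(1)]] that(2) by blast
  have W0: "\<zero>\<^bsub>V\<^esub> \<in> W t" if "t \<in> T" for t using submodule.zero_closed[OF sm[OF that]] .
  have Wa: "u \<oplus>\<^bsub>V\<^esub> w \<in> W t" if "t \<in> T" "u \<in> W t" "w \<in> W t" for t u w
    using submodule.m_closed[OF sm[OF that(1)] that(2,3)] .
  have Ws: "c \<odot>\<^bsub>V\<^esub> w \<in> W t" if "t \<in> T" "w \<in> W t" for t c w
    using submodule.smult_closed[OF sm[OF that(1)], of c w] that by simp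
  have ex1: "\<exists>!u. u \<in> (\<Pi>\<^sub>E t\<in>T. W t) \<and> v = (\<Oplus>\<^bsub>V\<^esub>t\<in>T. u t)" if "v \<in> carrier V" for v
    using ds that unfolding internal_direct_sum_def by blast
  define P where "P v = (THE u. u \<in> (\<Pi>\<^sub>E t\<in>T. W t) \<and> v = (\<Oplus>\<^bsub>V\<^esub>t\<in>T. u t))" for v
  have P: "P v \<in> (\<Pi>\<^sub>E t\<in>T. W t)" "v = (\<Oplus>\<^bsub>V\<^esub>t\<in>T. P v t)" if "v \<in> carrier V" for v
    using theI'[OF ex1[OF that]] unfolding P_def by (rule conjunct1, rule conjunct2)
  have PW: "P v t \<in> W t" if "v \<in> carrier V" "t \<in> T" for v t using P(1)[OF that(1)] that(2) by auto
  have PI: "P v t = u t" if v: "v \<in> carrier V" and u: "\<And>t. t \<in> T \<Longrightarrow> u t \<in> W t"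
    and e: "v = (\<Oplus>\<^bsub>V\<^esub>t\<in>T. u t)" and t: "t \<in> T" for v u t
  proof -
    have "(\<Oplus>\<^bsub>V\<^esub>t\<in>T. restrict u T t) = (\<Oplus>\<^bsub>V\<^esub>t\<in>T. u t)"
      using u WV by (intro V.M.finsum_cong') auto
    then have "restrict u T \<in> (\<Pi>\<^sub>E t\<in>T. W t) \<and> v = (\<Oplus>\<^bsub>V\<^esub>t\<in>T. restrict u T t)"
      using u e by auto
    then have "P v = restrict u T"
      unfolding P_def by (rule the1_equality[OF ex1[OF v]])
    then show ?thesis using t by simp
  qed
  show thesis
  proof (rule that[of "\<lambda>t v. P v t"])
    show "P v t \<in> W t" if "v \<in> carrier V" "t \<in> T" for v t by (rule PW[OF that])
    show "P (v \<oplus>\<^bsub>V\<^esub> w) t = P v t \<oplus>\<^bsub>V\<^esub> P w t"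
      if vw: "v \<in> carrier V" "w \<in> carrier V" and t: "t \<in> T" for v w t
    proof (rule PI)
      show "v \<oplus>\<^bsub>V\<^esub> w \<in> carrier V" using vw by simp
      show "P v t \<oplus>\<^bsub>V\<^esub> P w t \<in> W t" if "t \<in> T" for t using PW vw that Wa by simp
      have "(\<Oplus>\<^bsub>V\<^esub>t\<in>T. P v t \<oplus>\<^bsub>V\<^esub> P w t) = (\<Oplus>\<^bsub>V\<^esub>t\<in>T. P v t) \<oplus>\<^bsub>V\<^esub> (\<Oplus>\<^bsub>V\<^esub>t\<in>T. P w t)"
        using PW vw WV by (intro V.M.finsum_addf) auto
      then show "v \<oplus>\<^bsub>V\<^esub> w = (\<Oplus>\<^bsub>V\<^esub>t\<in>T. P v t \<oplus>\<^bsub>V\<^esub> P w t)" using P(2)[OF vw(1)] P(2)[OF vw(2)] by simp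
      show "t \<in> T" by (rule t)
    qed
    show "P (c \<odot>\<^bsub>V\<^esub> v) t = c \<odot>\<^bsub>V\<^esub> P v t" if v: "v \<in> carrier V" and t: "t \<in> T" for c v t
    proof (rule PI)
      show "c \<odot>\<^bsub>V\<^esub> v \<in> carrier V" by (rule vs_facts(2)[OF V v])
      show "c \<odot>\<^bsub>V\<^esub> P v t \<in> W t" if "t \<in> T" for t using PW v that Ws by simp
      have "c \<odot>\<^bsub>V\<^esub> (\<Oplus>\<^bsub>V\<^esub>t\<in>T. P v t) = (\<Oplus>\<^bsub>V\<^esub>t\<in>T. c \<odot>\<^bsub>V\<^esub> P v t)"
        using T PW v WV by (intro V.finsum_smult) auto
      then show "c \<odot>\<^bsub>V\<^esub> v = (\<Oplus>\<^bsub>V\<^esub>t\<in>T. c \<odot>\<^bsub>V\<^esub> P v t)" using P(2)[OF v] by simp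
      show "t \<in> T" by (rule t)
    qed
    show "P b t' = (if t' = t then b else \<zero>\<^bsub>V\<^esub>)" if t: "t \<in> T" "t' \<in> T" and b: "b \<in> W t" for b t t'
    proof (rule PI[of _ "\<lambda>t'. if t' = t then b else \<zero>\<^bsub>V\<^esub>"])
      show "b \<in> carrier V" by (rule WV[OF t(1) b])
      show "(if t' = t then b else \<zero>\<^bsub>V\<^esub>) \<in> W t'" if "t' \<in> T" for t' using b W0 that by auto
      have "(\<Oplus>\<^bsub>V\<^esub>t'\<in>T. if t = t' then b else \<zero>\<^bsub>V\<^esub>) = b"
        using V.M.finsum_singleton[OF t(1) T, of "\<lambda>_. b"] WV[OF t(1) b] by simp
      then show "b = (\<Oplus>\<^bsub>V\<^esub>t'\<in>T. if t' = t then b else \<zero>\<^bsub>V\<^esub>)" by (simp add: eq_commute)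
      show "t' \<in> T" by (rule t(2))
    qed
    show "v = \<zero>\<^bsub>V\<^esub>" if v: "v \<in> carrier V" and 0: "\<And>t. t \<in> T \<Longrightarrow> P v t = \<zero>\<^bsub>V\<^esub>" for v
    proof -
      have "(\<Oplus>\<^bsub>V\<^esub>t\<in>T. P v t) = (\<Oplus>\<^bsub>V\<^esub>t\<in>T. \<zero>\<^bsub>V\<^esub>)" using 0 by (intro V.M.finsum_cong') auto
      then show ?thesis using P(2)[OF v] by simp
    qed
  qed
qed

text \<open>Level i is filled from the summand \<open>W ((i + e) mod m)\<close>; the free choice of
  \<open>e\<close> realises the cyclic permutations of the multiplicities vector for one and the
  same \<theta>.\<close>

lemma multiplicities_frame:
  fixes V :: "('a::field_char_0, 'v) module"
  assumes V: "vectorspace class_ring V" and fd: "vectorspace.fin_dim class_ring V"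
    and prim: "primitive_root_of_unity m \<zeta>" and mult: "has_multiplicities V m \<zeta> r \<theta>"
  obtains B co where "graded_levels m (\<lambda>i. r ((i + e) mod m)) V B co"
    and "graded_part V \<zeta> \<theta> 0 = framed_levels.G0 m (\<lambda>i. r ((i + e) mod m)) V B co"
    and "graded_part V \<zeta> \<theta> 1 = framed_levels.G1 m (\<lambda>i. r ((i + e) mod m)) V B co"
proof -
  obtain W s where s: "s \<in> GL V" and ds: "internal_direct_sum V {..<m} W"
    and dim: "\<And>t. t < m \<Longrightarrow> vdim (V\<lparr>carrier := W t\<rparr>) = r t"
    and sW: "\<And>t v. t < m \<Longrightarrow> v \<in> W t \<Longrightarrow> s v = (\<zeta> ^ t) \<odot>\<^bsub>V\<^esub> v"
    and \<theta>: "\<theta> = GL_conj V s"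
    using mult unfolding has_multiplicities_def by metis
  have m: "m > 0" using prim by (simp add: primitive_root_of_unity_def)
  interpret V: vectorspace class_ring V by (rule V)
  have sub: "VectorSpace.subspace class_ring (W t) V" if "t < m" for t
    using ds that by (simp add: internal_direct_sum_def)
  have WV: "W t \<subseteq> carrier V" if "t < m" for t
    using sub[OF that] submodule.subset by (fastforce simp: VectorSpace.subspace_def)
  obtain B0 co0 where "frame V {..<vdim V} B0 co0" using frame_exists[OF V fd] by (elim exE)
  then interpret F0: frame V "{..<vdim V}" B0 co0 .
  have "\<exists>B co. frame (V\<lparr>carrier := W t\<rparr>) {..<r t} B co" if t: "t < m" for t
  proof -
    have vsW: "vectorspace class_ring (V\<lparr>carrier := W t\<rparr>)" by (rule V.subspace_is_vs[OF sub[OF t]])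
    have "vectorspace.fin_dim class_ring (V\<lparr>carrier := W t\<rparr>)"
    proof (rule dim_le_card_separating(1)[OF vsW F0.finite_I, of co0])
      show "linear_on (V\<lparr>carrier := W t\<rparr>) (co0 j)" if "j \<in> {..<vdim V}" for j
        by (rule linear_on_carrier[OF F0.linear_co[OF that] WV[OF t]])
      show "w = \<zero>\<^bsub>V\<lparr>carrier := W t\<rparr>\<^esub>"
        if "w \<in> carrier (V\<lparr>carrier := W t\<rparr>)" "\<And>j. j \<in> {..<vdim V} \<Longrightarrow> co0 j w = 0" for w
        using F0.co_separates[of w] that WV[OF t] by auto
    qed
    from frame_exists[OF vsW this] show ?thesis unfolding dim[OF t] .
  qed
  then have "\<forall>t. \<exists>B co. t < m \<longrightarrow> frame (V\<lparr>carrier := W t\<rparr>) {..<r t} B co" by blast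
  then obtain Bt where "\<forall>t. \<exists>co. t < m \<longrightarrow> frame (V\<lparr>carrier := W t\<rparr>) {..<r t} (Bt t) co"
    using choice[of "\<lambda>t B. \<exists>co. t < m \<longrightarrow> frame (V\<lparr>carrier := W t\<rparr>) {..<r t} B co"] by blast
  then obtain ct where fr: "\<forall>t. t < m \<longrightarrow> frame (V\<lparr>carrier := W t\<rparr>) {..<r t} (Bt t) (ct t)"
    using choice[of "\<lambda>t co. t < m \<longrightarrow> frame (V\<lparr>carrier := W t\<rparr>) {..<r t} (Bt t) co"] by blast
  obtain pr where
    prW: "\<And>v t. v \<in> carrier V \<Longrightarrow> t \<in> {..<m} \<Longrightarrow> pr t v \<in> W t" and
    pra: "\<And>v w t. v \<in> carrier V \<Longrightarrow> w \<in> carrier V \<Longrightarrow> t \<in> {..<m} \<Longrightarrow> pr t (v \<oplus>\<^bsub>V\<^esub> w) = pr t v \<oplus>\<^bsub>V\<^esub> pr t w" and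
    prs: "\<And>c v t. v \<in> carrier V \<Longrightarrow> t \<in> {..<m} \<Longrightarrow> pr t (c \<odot>\<^bsub>V\<^esub> v) = c \<odot>\<^bsub>V\<^esub> pr t v" and
    prd: "\<And>b t t'. t \<in> {..<m} \<Longrightarrow> t' \<in> {..<m} \<Longrightarrow> b \<in> W t \<Longrightarrow> pr t' b = (if t' = t then b else \<zero>\<^bsub>V\<^esub>)" and
    prz: "\<And>v. v \<in> carrier V \<Longrightarrow> (\<And>t. t \<in> {..<m} \<Longrightarrow> pr t v = \<zero>\<^bsub>V\<^esub>) \<Longrightarrow> v = \<zero>\<^bsub>V\<^esub>"
    using direct_sum_projections[OF V ds finite_lessThan] by blast
  define \<sigma> where "\<sigma> i = (i + e) mod m" for i
  have \<sigma>: "\<sigma> i < m" for i using m by (simp add: \<sigma>_def)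
  have \<sigma>_inj: "\<sigma> i = \<sigma> j \<longleftrightarrow> i = j" if "i < m" "j < m" for i j
    using that mod_add_right_cancel[OF m] by (simp add: \<sigma>_def)
  have \<sigma>_surj: "\<exists>i<m. \<sigma> i = t" if "t < m" for t
  proof -
    have "\<sigma> ` {..<m} = {..<m}"
      using \<sigma> \<sigma>_inj by (intro card_subset_eq) (auto simp: card_image inj_on_def)
    then show ?thesis using that by (metis imageE lessThan_iff)
  qed
  define r' where "r' i = r (\<sigma> i)" for i
  define B where "B p = Bt (\<sigma> (fst p)) (snd p)" for p
  define co where "co p v = ct (\<sigma> (fst p)) (snd p) (pr (\<sigma> (fst p)) v)" for p v
  interpret L: levels m r' by (rule levels.intro[OF m])
  have mI: "fst p < m \<and> snd p < r (\<sigma> (fst p))" if "p \<in> L.I" for p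
    using that by (cases p) (simp add: r'_def)
  have fr': "frame (V\<lparr>carrier := W (\<sigma> i)\<rparr>) {..<r (\<sigma> i)} (Bt (\<sigma> i)) (ct (\<sigma> i))" for i
    using fr \<sigma> by blast
  have BW: "B p \<in> W (\<sigma> (fst p))" if "p \<in> L.I" for p
    using frame.B_closed[OF fr', of "snd p"] mI[OF that] by (simp add: B_def)
  have frV: "frame V L.I B co"
  proof (rule frame.intro[OF V L.finite_I])
    fix p assume p: "p \<in> L.I"
    show "B p \<in> carrier V" using BW[OF p] WV[OF \<sigma>] by blast
    have "linear_on (V\<lparr>carrier := W (\<sigma> (fst p))\<rparr>) (ct (\<sigma> (fst p)) (snd p))"
      using mI[OF p] by (intro frame.linear_co[OF fr']) simp
    then show "linear_on V (co p)"
      unfolding linear_on_def co_def using pra prs prW \<sigma> by simp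
  next
    fix p q assume pq: "p \<in> L.I" "q \<in> L.I"
    show "co p (B q) = (if p = q then 1 else 0)"
    proof (cases "fst p = fst q")
      case True
      have "pr (\<sigma> (fst p)) (B q) = B q"
        using prd[of "\<sigma> (fst q)" "\<sigma> (fst p)" "B q"] \<sigma> BW[OF pq(2)] True by simp
      moreover have "ct (\<sigma> (fst p)) (snd p) (Bt (\<sigma> (fst p)) (snd q)) = (if snd p = snd q then 1 else 0)"
        using mI[OF pq(1)] mI[OF pq(2)] True by (intro frame.co_B[OF fr']) auto
      ultimately show ?thesis using True by (simp add: co_def B_def prod_eq_iff)
    next
      case False
      then have "\<sigma> (fst p) \<noteq> \<sigma> (fst q)" using \<sigma>_inj mI pq by blast
      then have z: "pr (\<sigma> (fst p)) (B q) = \<zero>\<^bsub>V\<^esub>"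
        using prd[of "\<sigma> (fst q)" "\<sigma> (fst p)" "B q"] \<sigma> BW[OF pq(2)] by simp
      have "linear_on (V\<lparr>carrier := W (\<sigma> (fst p))\<rparr>) (ct (\<sigma> (fst p)) (snd p))"
        using mI[OF pq(1)] by (intro frame.linear_co[OF fr']) simp
      from linear_on_zero[OF V.subspace_is_vs[OF sub[OF \<sigma>]] this]
      show ?thesis using False by (auto simp: co_def z)
    qed
  next
    fix w assume w: "w \<in> carrier V" and 0: "\<And>p. p \<in> L.I \<Longrightarrow> co p w = 0"
    show "w = \<zero>\<^bsub>V\<^esub>"
    proof (rule prz[OF w])
      fix t assume "t \<in> {..<m}"
      then obtain i where i: "i < m" "\<sigma> i = t" using \<sigma>_surj by auto
      have "pr (\<sigma> i) w = \<zero>\<^bsub>V\<lparr>carrier := W (\<sigma> i)\<rparr>\<^esub>"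
      proof (rule frame.co_separates[OF fr'])
        show "pr (\<sigma> i) w \<in> carrier (V\<lparr>carrier := W (\<sigma> i)\<rparr>)" using prW[OF w] \<sigma> by simp
        show "ct (\<sigma> i) j (pr (\<sigma> i) w) = 0" if "j \<in> {..<r (\<sigma> i)}" for j
          using 0[of "(i, j)"] that i by (simp add: co_def r'_def)
      qed
      then show "pr t w = \<zero>\<^bsub>V\<^esub>" using i by simp
    qed
  qed
  have FL: "framed_levels m r' V B co"
    by (rule framed_levels.intro[OF L.levels_axioms frV])
  interpret FL: framed_levels m r' V B co by (rule FL)
  have sB: "s (B b) = \<zeta> ^ ((fst b + e) mod m) \<odot>\<^bsub>V\<^esub> B b" if "b \<in> L.I" for b
    using sW[OF \<sigma> BW[OF that]] by (simp add: \<sigma>_def)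
  have gp0: "graded_part V \<zeta> \<theta> 0 = FL.G0"
    unfolding \<theta> by (rule FL.graded_parts(1)[OF prim s]) (rule sB)
  have gp1: "graded_part V \<zeta> \<theta> 1 = FL.G1"
    unfolding \<theta> by (rule FL.graded_parts(2)[OF prim s]) (rule sB)
  have "lie_module FL.G0 FL.G1 (lie_bracket (gl V))"
    using lie_module_theta[OF V mult] unfolding gp0 gp1 .
  then have GL: "graded_levels m r' V B co"
    by (intro graded_levels.intro[OF FL] graded_levels_axioms.intro)
  have r'_eq: "(\<lambda>i. r ((i + e) mod m)) = r'" by (simp add: r'_def \<sigma>_def fun_eq_iff)
  show thesis
    by (rule that[of B co]; unfold r'_eq) (rule GL gp0 gp1)+
qed

section \<open>The rank and the multiplicities\<close>

context framed_levels
begin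

section \<open>Homogeneous components of eigenvectors\<close>

definition at_level :: "nat \<Rightarrow> 'v \<Rightarrow> bool"
  where "at_level i w \<longleftrightarrow> w \<in> carrier V \<and> (\<forall>a\<in>I. fst a \<noteq> i \<longrightarrow> co a w = 0)"

lemma at_level_apply:
  assumes x: "x \<in> carrier G1" and w: "at_level i w"
  shows "at_level (fst (up (i, 0))) (x w)"
  unfolding at_level_def
proof (intro conjI ballI impI)
  have xg: "x \<in> carrier (gl V)" and d: "deg1 (cf x)" using x by auto
  have wV: "w \<in> carrier V" using w by (simp add: at_level_def)
  show "x w \<in> carrier V" using xg wV by simp
  fix a assume a: "a \<in> I" "fst a \<noteq> fst (up (i, 0))"
  have "cf x a b * co b w = 0" if "b \<in> I" for b
  proof (cases "fst b = i")
    case True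
    then have "fst (up b) = fst (up (i, 0))" by (simp add: up_def)
    then have "cf x a b = 0" using a(2) d unfolding deg1_def by metis
    then show ?thesis by simp
  next
    case False
    then show ?thesis using w that unfolding at_level_def by simp
  qed
  then show "co a (x w) = 0" unfolding co_apply[OF xg a(1) wV] by (intro sum.neutral) simp
qed

lemma at_level_iter:
  assumes x: "x \<in> carrier G1" and w: "at_level i w"
  shows "at_level (fst ((up ^^ t) (i, 0))) ((x ^^ t) w)"
proof (induction t)
  case (Suc t)
  have "fst (up (fst ((up ^^ t) (i, 0)), 0)) = fst (up ((up ^^ t) (i, 0)))"
    by (simp add: up_def)
  then show ?case using at_level_apply[OF x Suc] by simp
qed (use w in simp)

definition part :: "nat \<Rightarrow> 'v \<Rightarrow> 'v"
  where "part i u = F.vec (\<lambda>a. if fst a = i then co a u else 0)"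

lemma co_part: "a \<in> I \<Longrightarrow> co a (part i u) = (if fst a = i then co a u else 0)"
  by (simp add: part_def F.co_vec del: mem_I)

lemma part_closed: "part i u \<in> carrier V"
  by (simp add: part_def)

text \<open>As \<open>x\<close> raises the level by one, the equation x u = c u can be compared
  level by level.\<close>

lemma eigen_part:
  assumes x: "x \<in> carrier G1" and u: "u \<in> carrier V" "x u = c \<odot>\<^bsub>V\<^esub> u" and i: "i < m"
  shows "x (part i u) = c \<odot>\<^bsub>V\<^esub> part (fst (up (i, 0))) u"
proof (rule F.co_eqI)
  have xg: "x \<in> carrier (gl V)" and d: "deg1 (cf x)" using x by auto
  show "x (part i u) \<in> carrier V" using xg part_closed by simp
  show "c \<odot>\<^bsub>V\<^esub> part (fst (up (i, 0))) u \<in> carrier V" using part_closed by simp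
  fix a assume a: "a \<in> I"
  have eq: "cf x a b * co b (part i u) = (if fst a = fst (up (i, 0)) then cf x a b * co b u else 0)"
    if b: "b \<in> I" for b
  proof (cases "cf x a b = 0")
    case False
    then have "fst a = fst (up b)" using d unfolding deg1_def by blast
    then have "fst b = i \<longleftrightarrow> fst a = fst (up (i, 0))"
      using I_less[OF b] i by (auto simp: up_def split: if_splits)
    then show ?thesis using b by (simp add: co_part del: mem_I)
  qed simp
  have "co a (x (part i u)) = (\<Sum>b\<in>I. if fst a = fst (up (i, 0)) then cf x a b * co b u else 0)"
    unfolding co_apply[OF xg a part_closed] by (intro sum.cong refl eq)
  also have "\<dots> = (if fst a = fst (up (i, 0)) then co a (x u) else 0)"
    unfolding co_apply[OF xg a u(1)] by simp
  also have "\<dots> = co a (c \<odot>\<^bsub>V\<^esub> part (fst (up (i, 0))) u)"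
    using a u(1) by (simp add: u(2) linear_onD(2)[OF F.linear_co] part_closed co_part del: mem_I)
  finally show "co a (x (part i u)) = co a (c \<odot>\<^bsub>V\<^esub> part (fst (up (i, 0))) u)" .
qed

lemma eigen_part_iter:
  assumes x: "x \<in> carrier G1" and u: "u \<in> carrier V" "x u = c \<odot>\<^bsub>V\<^esub> u" and i: "i < m"
  shows "(x ^^ t) (part i u) = (c ^ t) \<odot>\<^bsub>V\<^esub> part (fst ((up ^^ t) (i, 0))) u"
proof (induction t)
  case 0
  then show ?case by (simp add: vs_facts(6)[OF F.vs] part_closed)
next
  case (Suc t)
  have xg: "x \<in> carrier (gl V)" using x by auto
  define j where "j = fst ((up ^^ t) (i, 0))"
  have j: "j < m" using i by (simp add: j_def up_iter m_pos)
  have "(x ^^ Suc t) (part i u) = x ((c ^ t) \<odot>\<^bsub>V\<^esub> part j u)" using Suc by (simp add: j_def)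
  also have "\<dots> = (c ^ t) \<odot>\<^bsub>V\<^esub> x (part j u)" using xg part_closed by (simp add: carrier_gl)
  also have "\<dots> = (c ^ t * c) \<odot>\<^bsub>V\<^esub> part (fst (up (j, 0))) u"
    unfolding eigen_part[OF x u j] by (simp add: vs_facts(5)[OF F.vs part_closed])
  also have "fst (up (j, 0)) = fst ((up ^^ Suc t) (i, 0))" by (simp add: j_def up_def)
  finally show ?case by (simp add: mult.commute)
qed

text \<open>A nonzero map cannot kill a whole basis of eigenvectors, and a basis vector that
  survives has a nonzero eigenvalue.\<close>

lemma semisimple_eigenvector:
  assumes x: "x \<in> carrier (gl V)" "x \<noteq> \<zero>\<^bsub>gl V\<^esub>" and ss: "semisimple_endo V x"
  obtains u c where "u \<in> carrier V" "u \<noteq> \<zero>\<^bsub>V\<^esub>" "c \<noteq> 0" "x u = c \<odot>\<^bsub>V\<^esub> u"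
proof -
  obtain S where S: "F.basis S" and eig: "\<forall>b\<in>S. \<exists>c. x b = c \<odot>\<^bsub>V\<^esub> b"
    using ss unfolding semisimple_endo_def by blast
  have SV: "S \<subseteq> carrier V" and gen: "F.span S = carrier V" and finS: "finite S"
    using S F.fin_dim_li_fin[OF F.frame_dim(2), of S] unfolding F.basis_def by auto
  have x0: "x \<zero>\<^bsub>V\<^esub> = \<zero>\<^bsub>V\<^esub>"
  proof -
    have "x (0 \<odot>\<^bsub>V\<^esub> \<zero>\<^bsub>V\<^esub>) = 0 \<odot>\<^bsub>V\<^esub> x \<zero>\<^bsub>V\<^esub>"
      using x(1) unfolding carrier_gl using F.M.zero_closed by blast
    then show ?thesis using x(1) by (simp add: vs_facts(7,8)[OF F.vs])
  qed
  have "\<exists>b\<in>S. x b \<noteq> \<zero>\<^bsub>V\<^esub>"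
  proof (rule ccontr)
    assume "\<not> (\<exists>b\<in>S. x b \<noteq> \<zero>\<^bsub>V\<^esub>)"
    then have z: "x b = \<zero>\<^bsub>V\<^esub>" if "b \<in> S" for b using that by blast
    have "x = \<zero>\<^bsub>gl V\<^esub>"
    proof (rule extensionalityI[of _ "carrier V"])
      show "x \<in> extensional (carrier V)" using x(1) by (simp add: carrier_gl)
      show "\<zero>\<^bsub>gl V\<^esub> \<in> extensional (carrier V)" by (simp add: gl_ops)
      fix w assume w: "w \<in> carrier V"
      then have "w \<in> F.span S" using gen by simp
      then obtain a where a: "w = F.lincomb a S"
        using F.finite_in_span[OF finS SV, of w] by (auto simp: F.finite_span[OF finS SV])
      have "x w = \<zero>\<^bsub>V\<^esub>"
      proof (rule F.co_separates)
        show "x w \<in> carrier V" using x w by simp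
        fix i assume i: "i \<in> I"
        note lin = linear_co_gl[OF x(1) i]
        have "co i (x w) = (\<Sum>b\<in>S. co i (x (a b \<odot>\<^bsub>V\<^esub> b)))"
          unfolding a F.lincomb_def using SV
          by (intro linear_on_finsum[OF F.vs lin finS]) auto
        also have "\<dots> = 0"
        proof (rule sum.neutral, rule ballI)
          fix b assume b: "b \<in> S"
          then have "b \<in> carrier V" using SV by blast
          from linear_onD(2)[OF lin this, of "a b"] show "co i (x (a b \<odot>\<^bsub>V\<^esub> b)) = 0"
            using z[OF b] linear_on_zero[OF F.vs F.linear_co[OF i]] by simp
        qed
        finally show "co i (x w) = 0" .
      qed
      then show "x w = \<zero>\<^bsub>gl V\<^esub> w" using w by (simp add: gl_ops)
    qed
    then show False using x(2) by simp
  qed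
  then obtain b where b: "b \<in> S" "x b \<noteq> \<zero>\<^bsub>V\<^esub>" by blast
  obtain c where c: "x b = c \<odot>\<^bsub>V\<^esub> b" using eig b(1) by blast
  have bV: "b \<in> carrier V" using b(1) SV by blast
  show thesis
  proof (rule that[OF bV _ _ c])
    show "b \<noteq> \<zero>\<^bsub>V\<^esub>" using b(2) x0 by metis
    show "c \<noteq> 0" using b(2) c vs_facts(8)[OF F.vs bV] by metis
  qed
qed

text \<open>Up to the nonzero factor \<open>c\<close>, each component of \<open>u\<close> is the
  image of the preceding one. So a nonzero component forces a nonzero one on the level before, and
  going around reaches every level.\<close>

lemma eigen_levels:
  assumes x: "x \<in> carrier G1" and u: "u \<in> carrier V" "u \<noteq> \<zero>\<^bsub>V\<^esub>" "c \<noteq> 0" "x u = c \<odot>\<^bsub>V\<^esub> u"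
    and i: "i < m"
  shows "\<exists>j<r i. co (i, j) u \<noteq> 0"
proof -
  have xg: "x \<in> carrier (gl V)" and d: "deg1 (cf x)" using x by auto
  define P where "P i \<longleftrightarrow> (\<exists>a\<in>I. fst a = i \<and> co a u \<noteq> 0)" for i
  have step: "P (fst (dn (i, 0)))" if Pi: "P i" for i
  proof -
    obtain a where a: "a \<in> I" "fst a = i" "co a u \<noteq> 0" using Pi by (auto simp: P_def)
    have "(\<Sum>b\<in>I. cf x a b * co b u) = c * co a u"
      using co_apply[OF xg a(1) u(1)] u(4) linear_onD(2)[OF F.linear_co[OF a(1)] u(1)] by simp
    then have "(\<Sum>b\<in>I. cf x a b * co b u) \<noteq> 0" using u(3) a(3) by simp
    then obtain b where b: "b \<in> I" "cf x a b * co b u \<noteq> 0"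
      by (meson sum.not_neutral_contains_not_neutral)
    then have "fst a = fst (up b)" using d unfolding deg1_def by auto
    then have "fst b = fst (dn (i, 0))"
      using a(2) I_less[OF b(1)] m_pos by (auto simp: up_def dn_def split: if_splits)
    then show ?thesis using b unfolding P_def by auto
  qed
  have "\<not> (\<forall>a\<in>I. co a u = 0)" using F.co_separates[OF u(1)] u(2) by blast
  then obtain a where a: "a \<in> I" "co a u \<noteq> 0" by blast
  have iter: "P (fst ((dn ^^ t) a))" for t
  proof (induction t)
    case 0
    then show ?case using a by (auto simp: P_def)
  next
    case (Suc t)
    have "fst (dn ((dn ^^ t) a)) = fst (dn (fst ((dn ^^ t) a), 0))" by (simp add: dn_def)
    then show ?case using step[OF Suc] by simp
  qed
  obtain t where "(dn ^^ t) a = (i, snd a)"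
    using dn_iter_reaches[OF I_less[OF a(1)] i] .
  then have "P i" using iter[of t] by simp
  then obtain a' where "a' \<in> I" "fst a' = i" "co a' u \<noteq> 0" by (auto simp: P_def)
  then show ?thesis by (cases a') auto
qed

text \<open>If the level \<open>i\<close> is a line \<open>e\<close>, then two commuting semisimple elements \<open>x\<close>, \<open>y\<close> of degree 1
  are proportional: some combination \<open>z = y - d x\<close> satisfies \<open>z x\<^sup>m\<^sup>-\<^sup>1 e = 0\<close>, whereas \<open>x\<^sup>m e\<close> and,
  if \<open>z \<noteq> 0\<close>, also \<open>z\<^sup>m e\<close> are nonzero multiples of \<open>e\<close>.\<close>

lemma semisimple_iter_line:
  assumes x: "x \<in> carrier G1" "x \<noteq> \<zero>\<^bsub>gl V\<^esub>" "semisimple_endo V x" and i: "i < m" "r i = 1"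
  shows "\<exists>d. d \<noteq> 0 \<and> (x ^^ m) (B (i, 0)) = d \<odot>\<^bsub>V\<^esub> B (i, 0)"
proof -
  have xg: "x \<in> carrier (gl V)" using x by auto
  obtain u c where u: "u \<in> carrier V" "u \<noteq> \<zero>\<^bsub>V\<^esub>" "c \<noteq> 0" "x u = c \<odot>\<^bsub>V\<^esub> u"
    using semisimple_eigenvector[OF xg x(2,3)] .
  have iI: "(i, 0) \<in> I" using i by simp
  have nz: "co (i, 0) u \<noteq> 0" using eigen_levels[OF x(1) u i(1)] i(2) by auto
  define h where "h = co (i, 0) u"
  have pB: "part i u = h \<odot>\<^bsub>V\<^esub> B (i, 0)"
  proof (rule F.co_eqI)
    show "part i u \<in> carrier V" by (rule part_closed)
    show "h \<odot>\<^bsub>V\<^esub> B (i, 0) \<in> carrier V" using F.B_closed[OF iI] by simp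
    fix a assume a: "a \<in> I"
    then have "fst a = i \<longleftrightarrow> a = (i, 0)" using i by (cases a) auto
    then show "co a (part i u) = co a (h \<odot>\<^bsub>V\<^esub> B (i, 0))"
      using a iI F.B_closed[OF iI]
      by (simp add: co_part linear_onD(2)[OF F.linear_co] F.co_B h_def del: mem_I)
  qed
  have "(up ^^ m) (i, 0) = (i, 0)" using i(1) by (intro up_iter_m) simp
  then have e: "(x ^^ m) (part i u) = (c ^ m) \<odot>\<^bsub>V\<^esub> part i u"
    using eigen_part_iter[OF x(1) u(1,4) i(1), of m] by simp
  have iterV: "(x ^^ t) w \<in> carrier V" if "w \<in> carrier V" for t w
    using that xg by (induction t) auto
  have iter_smult: "(x ^^ t) (c \<odot>\<^bsub>V\<^esub> w) = c \<odot>\<^bsub>V\<^esub> (x ^^ t) w" if "w \<in> carrier V" for t c w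
    using that iterV[OF that] xg by (induction t) (auto simp: carrier_gl)
  have BV: "B (i, 0) \<in> carrier V" by (rule F.B_closed[OF iI])
  have hu: "inverse h \<odot>\<^bsub>V\<^esub> part i u = B (i, 0)"
    using nz vs_facts(5)[OF F.vs BV, of "inverse h" h] vs_facts(6)[OF F.vs BV]
    by (simp add: pB h_def)
  have "(x ^^ m) (B (i, 0)) = (c ^ m) \<odot>\<^bsub>V\<^esub> B (i, 0)"
  proof -
    have "(x ^^ m) (B (i, 0)) = inverse h \<odot>\<^bsub>V\<^esub> ((c ^ m) \<odot>\<^bsub>V\<^esub> part i u)"
      using iter_smult[OF part_closed, of m "inverse h" i u] unfolding hu e by simp
    also have "\<dots> = (c ^ m) \<odot>\<^bsub>V\<^esub> (inverse h \<odot>\<^bsub>V\<^esub> part i u)"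
      unfolding vs_facts(5)[OF F.vs part_closed, symmetric] by (simp add: mult.commute)
    finally show ?thesis unfolding hu .
  qed
  moreover have "c ^ m \<noteq> 0" using u(3) by simp
  ultimately show ?thesis by blast
qed

end

context graded_levels
begin

text \<open>Proportionality appears as injectivity of one functional on \<open>C\<close>: for f =
  x^(m-1) e every y f lies on the line of e, and y f = 0 forces y = 0.\<close>

lemma rank_space_dim_le_1:
  assumes C: "VectorSpace.subspace class_ring C G1"
    and comm: "\<And>x y. x \<in> C \<Longrightarrow> y \<in> C \<Longrightarrow> lie_bracket (gl V) x y = \<zero>\<^bsub>gl V\<^esub>"
    and ss: "\<And>x. x \<in> C \<Longrightarrow> semisimple_endo V x"
    and i: "i < m" "r i = 1"
  shows "vdim ((gl V)\<lparr>carrier := C\<rparr>) \<le> 1"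
proof -
  interpret GV: vectorspace class_ring G1 by (rule M.vectorspace_V)
  have sm: "submodule class_ring C G1" using C by (simp add: VectorSpace.subspace_def)
  have CG: "x \<in> carrier G1" if "x \<in> C" for x using submodule.subset[OF sm] that by blast
  have Cg: "x \<in> carrier (gl V)" if "x \<in> C" for x using CG[OF that] by simp
  have vsC: "vectorspace class_ring ((gl V)\<lparr>carrier := C\<rparr>)"
    using GV.subspace_is_vs[OF C] by simp
  have iI: "(i, 0) \<in> I" using i by simp
  define e where "e = B (i, 0)"
  have eV: "e \<in> carrier V" unfolding e_def by (rule F.B_closed[OF iI])
  show ?thesis
  proof (cases "\<exists>x\<in>C. x \<noteq> \<zero>\<^bsub>gl V\<^esub>")
    case False
    have "vdim ((gl V)\<lparr>carrier := C\<rparr>) \<le> card ({} :: nat set)"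
      by (rule dim_le_card_separating(2)[OF vsC, of _ "\<lambda>_ _. 0"]) (use False in auto)
    then show ?thesis by simp
  next
    case True
    then obtain x where x: "x \<in> C" "x \<noteq> \<zero>\<^bsub>gl V\<^esub>" by blast
    obtain l where l: "l \<noteq> 0" "(x ^^ m) e = l \<odot>\<^bsub>V\<^esub> e"
      using semisimple_iter_line[OF CG[OF x(1)] x(2) ss[OF x(1)] i] unfolding e_def by blast
    have iterV: "(z ^^ t) w \<in> carrier V" if "z \<in> C" "w \<in> carrier V" for z t w
      using that Cg[OF that(1)] by (induction t) auto
    define f where "f = (x ^^ (m - 1)) e"
    have fV: "f \<in> carrier V" unfolding f_def by (rule iterV[OF x(1) eV])
    have xf: "x f = l \<odot>\<^bsub>V\<^esub> e"
    proof -
      have "x f = (x ^^ Suc (m - 1)) e" by (simp add: f_def)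
      then show ?thesis using l(2) m_pos by simp
    qed
    have f0: "f \<noteq> \<zero>\<^bsub>V\<^esub>"
    proof
      assume "f = \<zero>\<^bsub>V\<^esub>"
      then have "co (i, 0) (x f) = 0"
        using linear_on_zero[OF F.vs linear_co_gl[OF Cg[OF x(1)] iI]] by simp
      then have "l * co (i, 0) e = 0" unfolding xf using linear_onD(2)[OF F.linear_co[OF iI] eV] by simp
      then show False using l(1) F.co_B[OF iI iI] by (simp add: e_def)
    qed
    have eL: "at_level i e"
      unfolding at_level_def
    proof (intro conjI ballI impI)
      show "e \<in> carrier V" by (rule eV)
      fix a assume "a \<in> I" "fst a \<noteq> i"
      then show "co a e = 0" using F.co_B[of a "(i, 0)"] iI unfolding e_def by auto
    qed
    have yf: "y f = co (i, 0) (y f) \<odot>\<^bsub>V\<^esub> e" if y: "y \<in> C" for y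
    proof (rule F.co_eqI)
      show "y f \<in> carrier V" using Cg[OF y] fV by simp
      show "co (i, 0) (y f) \<odot>\<^bsub>V\<^esub> e \<in> carrier V" using eV by simp
      fix a assume a: "a \<in> I"
      have "at_level (fst (up (fst ((up ^^ (m - 1)) (i, 0)), 0))) (y f)"
        unfolding f_def by (rule at_level_apply[OF CG[OF y] at_level_iter[OF CG[OF x(1)] eL]])
      moreover have "fst (up (fst ((up ^^ (m - 1)) (i, 0)), 0)) = fst ((up ^^ Suc (m - 1)) (i, 0))"
        by (simp add: up_def)
      moreover have "(up ^^ Suc (m - 1)) (i, 0) = (i, 0)"
        using up_iter_m[of "(i, 0)"] i(1) m_pos by simp
      ultimately have lev: "at_level i (y f)" by simp
      show "co a (y f) = co a (co (i, 0) (y f) \<odot>\<^bsub>V\<^esub> e)"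
      proof (cases "fst a = i")
        case True
        then have "a = (i, 0)" using a i by (cases a) auto
        then show ?thesis
          using linear_onD(2)[OF F.linear_co[OF iI] eV] F.co_B[OF iI iI] by (simp add: e_def)
      next
        case False
        then show ?thesis
          using lev eL a linear_onD(2)[OF F.linear_co[OF a] eV] unfolding at_level_def by simp
      qed
    qed
    \<comment> \<open>Since \<open>z\<close> commutes with \<open>x\<close>, z^m f = x^(m-1) z^m e
      would be a nonzero multiple of f, against z f = 0.\<close>
    have vanish: "z = \<zero>\<^bsub>gl V\<^esub>" if z: "z \<in> C" and zf: "z f = \<zero>\<^bsub>V\<^esub>" for z
    proof (rule ccontr)
      assume "z \<noteq> \<zero>\<^bsub>gl V\<^esub>"
      then obtain d where d: "d \<noteq> 0" "(z ^^ m) e = d \<odot>\<^bsub>V\<^esub> e"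
        using semisimple_iter_line[OF CG[OF z] _ ss[OF z] i] unfolding e_def by blast
      have xz: "x (z w) = z (x w)" if w: "w \<in> carrier V" for w
      proof (rule F.co_eqI)
        show cl: "x (z w) \<in> carrier V" "z (x w) \<in> carrier V" using w Cg x(1) z by auto
        fix a assume a: "a \<in> I"
        have "x (z w) \<ominus>\<^bsub>V\<^esub> z (x w) = \<zero>\<^bsub>V\<^esub>"
          using fun_cong[OF comm[OF x(1) z], of w] w by (simp add: gl_ops)
        then have "co a (x (z w)) - co a (z (x w)) = 0"
          using linear_on_diff[OF F.vs F.linear_co[OF a] cl] linear_on_zero[OF F.vs F.linear_co[OF a]] by simp
        then show "co a (x (z w)) = co a (z (x w))" by simp
      qed
      have xzt: "x ((z ^^ t) w) = (z ^^ t) (x w)" if w: "w \<in> carrier V" for t w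
      proof (induction t)
        case (Suc t)
        then show ?case using xz[OF iterV[OF z w]] by simp
      qed simp
      have comm_iter: "(x ^^ s) ((z ^^ t) w) = (z ^^ t) ((x ^^ s) w)" if w: "w \<in> carrier V" for s t w
      proof (induction s)
        case (Suc s)
        then show ?case using xzt[OF iterV[OF x(1) w]] by simp
      qed simp
      have z0: "(z ^^ t) \<zero>\<^bsub>V\<^esub> = \<zero>\<^bsub>V\<^esub>" for t
      proof (induction t)
        case (Suc t)
        have "z (0 \<odot>\<^bsub>V\<^esub> \<zero>\<^bsub>V\<^esub>) = 0 \<odot>\<^bsub>V\<^esub> z \<zero>\<^bsub>V\<^esub>"
          using Cg[OF z] unfolding carrier_gl using F.M.zero_closed by blast
        then show ?case using Suc Cg[OF z] by (simp add: vs_facts(7,8)[OF F.vs])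
      qed simp
      have "(z ^^ m) f = (z ^^ Suc (m - 1)) f" using m_pos by simp
      also have "\<dots> = (z ^^ (m - 1)) (z f)" by (simp only: funpow_Suc_right o_apply)
      finally have "(z ^^ m) f = \<zero>\<^bsub>V\<^esub>" using zf z0 by simp
      moreover have "(z ^^ m) f = d \<odot>\<^bsub>V\<^esub> f"
      proof -
        have "(z ^^ m) f = (x ^^ (m - 1)) ((z ^^ m) e)"
          unfolding f_def by (rule comm_iter[OF eV, symmetric])
        also have "\<dots> = d \<odot>\<^bsub>V\<^esub> (x ^^ (m - 1)) e"
        proof -
          have "(x ^^ t) (d \<odot>\<^bsub>V\<^esub> e) = d \<odot>\<^bsub>V\<^esub> (x ^^ t) e" for t
          proof (induction t)
            case (Suc t)
            have "x (d \<odot>\<^bsub>V\<^esub> (x ^^ t) e) = d \<odot>\<^bsub>V\<^esub> x ((x ^^ t) e)"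
              using Cg[OF x(1)] iterV[OF x(1) eV, of t] unfolding carrier_gl by blast
            then show ?case using Suc by simp
          qed simp
          then show ?thesis unfolding d(2) .
        qed
        finally show ?thesis by (simp add: f_def)
      qed
      ultimately have "d \<odot>\<^bsub>V\<^esub> f = \<zero>\<^bsub>V\<^esub>" by simp
      then have "inverse d \<odot>\<^bsub>V\<^esub> (d \<odot>\<^bsub>V\<^esub> f) = \<zero>\<^bsub>V\<^esub>" by (simp add: vs_facts(7)[OF F.vs])
      then show False
        using d(1) f0 vs_facts(5)[OF F.vs fV, of "inverse d" d] vs_facts(6)[OF F.vs fV] by simp
    qed
    have "vdim ((gl V)\<lparr>carrier := C\<rparr>) \<le> card {()}"
    proof (rule dim_le_card_separating(2)[OF vsC, of _ "\<lambda>_ y. co (i, 0) (y f)"])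
      show "linear_on ((gl V)\<lparr>carrier := C\<rparr>) (\<lambda>y. co (i, 0) (y f))"
        using linear_onD[OF F.linear_co[OF iI]] fV Cg by (simp add: linear_on_def gl_ops)
      fix y assume y: "y \<in> carrier ((gl V)\<lparr>carrier := C\<rparr>)" and 0: "\<And>j. j \<in> {()} \<Longrightarrow> co (i, 0) (y f) = 0"
      have yC: "y \<in> C" using y by simp
      have "y f = \<zero>\<^bsub>V\<^esub>" using yf[OF yC] 0[of "()"] vs_facts(8)[OF F.vs eV] by simp
      from vanish[OF yC this] show "y = \<zero>\<^bsub>(gl V)\<lparr>carrier := C\<rparr>\<^esub>" by simp
    qed simp
    then show ?thesis by simp
  qed
qed

text \<open>A nonzero space contains a nonzero semisimple element, whose eigenvectors for nonzero
  eigenvalues have components on every level.\<close>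

lemma rank_space_levels:
  assumes C: "VectorSpace.subspace class_ring C G1"
    and ss: "\<And>x. x \<in> C \<Longrightarrow> semisimple_endo V x"
    and dim: "vdim ((gl V)\<lparr>carrier := C\<rparr>) \<ge> 1" and i: "i < m"
  shows "r i \<ge> 1"
proof -
  interpret GV: vectorspace class_ring G1 by (rule M.vectorspace_V)
  have sm: "submodule class_ring C G1" using C by (simp add: VectorSpace.subspace_def)
  have CG: "x \<in> carrier G1" if "x \<in> C" for x using submodule.subset[OF sm] that by blast
  have vsC: "vectorspace class_ring ((gl V)\<lparr>carrier := C\<rparr>)"
    using GV.subspace_is_vs[OF C] by simp
  have "\<exists>x\<in>C. x \<noteq> \<zero>\<^bsub>gl V\<^esub>"
  proof (rule ccontr)
    assume n: "\<not> (\<exists>x\<in>C. x \<noteq> \<zero>\<^bsub>gl V\<^esub>)"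
    have "vdim ((gl V)\<lparr>carrier := C\<rparr>) \<le> card ({} :: nat set)"
      by (rule dim_le_card_separating(2)[OF vsC, of _ "\<lambda>_ _. 0"]) (use n in auto)
    then show False using dim by simp
  qed
  then obtain x where x: "x \<in> C" "x \<noteq> \<zero>\<^bsub>gl V\<^esub>" by blast
  have xg: "x \<in> carrier (gl V)" using CG[OF x(1)] by simp
  obtain u c where u: "u \<in> carrier V" "u \<noteq> \<zero>\<^bsub>V\<^esub>" "c \<noteq> 0" "x u = c \<odot>\<^bsub>V\<^esub> u"
    using semisimple_eigenvector[OF xg x(2) ss[OF x(1)]] .
  obtain j where "j < r i" using eigen_levels[OF CG[OF x(1)] u i] by blast
  then show ?thesis by simp
qed

text \<open>The \<open>Max\<close> defining the rank is attained: the set of dimensions contains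
  that of the zero space and is bounded by the number of matrix units of degree 1.\<close>

lemma theta_rank_attained:
  assumes g1: "graded_part V \<zeta> \<theta> 1 = G1"
  shows "\<exists>C. theta_rank V \<zeta> \<theta> = vdim ((gl V)\<lparr>carrier := C\<rparr>) \<and> VectorSpace.subspace class_ring C G1 \<and>
    (\<forall>x\<in>C. \<forall>y\<in>C. lie_bracket (gl V) x y = \<zero>\<^bsub>gl V\<^esub>) \<and> (\<forall>x\<in>C. semisimple_endo V x)"
proof -
  interpret GV: vectorspace class_ring G1 by (rule M.vectorspace_V)
  define S where "S = {vdim ((gl V)\<lparr>carrier := C\<rparr>) | C.
      VectorSpace.subspace class_ring C G1 \<and>
      (\<forall>x\<in>C. \<forall>y\<in>C. lie_bracket (gl V) x y = \<zero>\<^bsub>gl V\<^esub>) \<and> (\<forall>x\<in>C. semisimple_endo V x)}"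
  have le: "vdim ((gl V)\<lparr>carrier := C\<rparr>) \<le> card I1" if C: "VectorSpace.subspace class_ring C G1" for C
  proof -
    have vsC: "vectorspace class_ring ((gl V)\<lparr>carrier := C\<rparr>)"
      using GV.subspace_is_vs[OF C] by simp
    have sub: "C \<subseteq> carrier G1" using C submodule.subset by (fastforce simp: VectorSpace.subspace_def)
    interpret FG: frame G1 I1 "\<lambda>(p, q). op (unit p q)" "\<lambda>(p, q) f. cf f p q" by (rule frame_G1)
    show ?thesis
    proof (rule dim_le_card_separating(2)[OF vsC finite_I1, of "\<lambda>(p, q) f. cf f p q"])
      show "linear_on ((gl V)\<lparr>carrier := C\<rparr>) ((\<lambda>(p, q) f. cf f p q) j)" if "j \<in> I1" for j
        using linear_on_carrier[OF FG.linear_co[OF that] sub] by simp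
      show "w = \<zero>\<^bsub>(gl V)\<lparr>carrier := C\<rparr>\<^esub>"
        if "w \<in> carrier ((gl V)\<lparr>carrier := C\<rparr>)" "\<And>j. j \<in> I1 \<Longrightarrow> (\<lambda>(p, q) f. cf f p q) j w = 0" for w
        using FG.co_separates[of w] that sub by auto
    qed
  qed
  have fin: "finite S"
    by (rule finite_subset[OF _ finite_atMost[of "card I1"]]) (use le in \<open>auto simp: S_def\<close>)
  have "S \<noteq> {}"
  proof -
    interpret G: lie_algebra "gl V" by (rule lie_algebra_gl[OF F.vs])
    interpret gV: vectorspace class_ring "gl V" by (rule G.vectorspace_L)
    have z: "\<zero>\<^bsub>gl V\<^esub> \<in> carrier G1" using GV.M.zero_closed by simp
    have sub0: "VectorSpace.subspace class_ring {\<zero>\<^bsub>gl V\<^esub>} G1"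
    proof -
      have "submodule class_ring {\<zero>\<^bsub>gl V\<^esub>} G1"
      proof (rule submodule.intro, goal_cases)
        case 1 show ?case by (rule GV.module_axioms)
      next
        case 2 show ?case using z by simp
      next
        case (3 x y) then show ?case using gV.M.zero_closed by simp
      next
        case 4 show ?case by simp
      next
        case (5 c x) then show ?case using vs_facts(7)[OF G.vectorspace_L] by simp
      qed
      then show ?thesis using M.vectorspace_V by (simp add: VectorSpace.subspace_def)
    qed
    have br0: "lie_bracket (gl V) \<zero>\<^bsub>gl V\<^esub> \<zero>\<^bsub>gl V\<^esub> = \<zero>\<^bsub>gl V\<^esub>"
      by (rule G.bracket_self) simp
    have ss0: "semisimple_endo V \<zero>\<^bsub>gl V\<^esub>"
    proof -
      obtain \<beta> where \<beta>: "F.basis \<beta>" using F.finite_basis_exists[OF F.frame_dim(2)] by blast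
      then have "\<beta> \<subseteq> carrier V" by (simp add: F.basis_def)
      then have "\<forall>b\<in>\<beta>. \<exists>c. \<zero>\<^bsub>gl V\<^esub> b = c \<odot>\<^bsub>V\<^esub> b"
        using vs_facts(8)[OF F.vs] by (intro ballI exI[of _ 0]) (auto simp: gl_ops)
      then show ?thesis using \<beta> unfolding semisimple_endo_def by blast
    qed
    have "vdim ((gl V)\<lparr>carrier := {\<zero>\<^bsub>gl V\<^esub>}\<rparr>) \<in> S"
      unfolding S_def using sub0 br0 ss0 by (intro CollectI exI[of _ "{\<zero>\<^bsub>gl V\<^esub>}"]) simp
    then show ?thesis by blast
  qed
  from Max_in[OF fin this] have "theta_rank V \<zeta> \<theta> \<in> S"
    unfolding theta_rank_def g1 S_def .
  then show ?thesis unfolding S_def by (rule CollectD)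
qed

text \<open>The two instances of the inequality between the rank and the least multiplicity on which
  the theorem draws.\<close>

lemma theta_rank_le_levels:
  assumes g1: "graded_part V \<zeta> \<theta> 1 = G1" and i: "i < m"
  shows "theta_rank V \<zeta> \<theta> \<ge> 1 \<Longrightarrow> r i \<ge> 1" and "theta_rank V \<zeta> \<theta> > 1 \<Longrightarrow> r i \<ge> 2"
proof -
  obtain C where rank: "theta_rank V \<zeta> \<theta> = vdim ((gl V)\<lparr>carrier := C\<rparr>) \<and>
      VectorSpace.subspace class_ring C G1 \<and>
      (\<forall>x\<in>C. \<forall>y\<in>C. lie_bracket (gl V) x y = \<zero>\<^bsub>gl V\<^esub>) \<and> (\<forall>x\<in>C. semisimple_endo V x)"
    using theta_rank_attained[OF g1] by (rule exE)
  then have dim: "theta_rank V \<zeta> \<theta> = vdim ((gl V)\<lparr>carrier := C\<rparr>)"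
    and C: "VectorSpace.subspace class_ring C G1"
      "\<And>x y. x \<in> C \<Longrightarrow> y \<in> C \<Longrightarrow> lie_bracket (gl V) x y = \<zero>\<^bsub>gl V\<^esub>"
      "\<And>x. x \<in> C \<Longrightarrow> semisimple_endo V x"
    by simp_all
  show 1: "r i \<ge> 1" if "theta_rank V \<zeta> \<theta> \<ge> 1"
    by (rule rank_space_levels[OF C(1,3) _ i]) (use that dim in simp_all)
  show "r i \<ge> 2" if "theta_rank V \<zeta> \<theta> > 1"
  proof (rule ccontr)
    assume "\<not> r i \<ge> 2"
    then have "r i = 1" using 1 that by linarith
    from rank_space_dim_le_1[OF C i this] show False using that unfolding dim by simp
  qed
qed

end

theorem theorem4p14:
  fixes V :: "('a::{alg_closed_field, field_char_0}, 'v) module"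
    and m :: nat and \<zeta> :: 'a and r :: "nat \<Rightarrow> nat"
    and \<theta> :: "('v \<Rightarrow> 'v) \<Rightarrow> ('v \<Rightarrow> 'v)"
  assumes "vectorspace class_ring V" and "vectorspace.fin_dim class_ring V"
    and "m \<ge> 4" and "primitive_root_of_unity m \<zeta>"
    and "has_multiplicities V m \<zeta> r \<theta>"
    and "group.ord (BijGroup (carrier (gl V))) \<theta> = m"
    and "theta_rank V \<zeta> \<theta> > 1 \<or>
      (theta_rank V \<zeta> \<theta> = 1 \<and>
        (\<exists>i<m. r i \<ge> 2 \<and> r ((i + 1) mod m) \<ge> 2 \<and> r ((i + 2) mod m) \<ge> 2))"
  shows "\<not> theta_rep_has_GIB V \<zeta> \<theta>"
proof -
  note m4 = assms(3)
  \<comment> \<open>The unrotated frame compares the rank with the given multiplicities; a rotated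
    one is chosen afterwards.\<close>
  obtain B0 co0 where gl0: "graded_levels m (\<lambda>i. r ((i + 0) mod m)) V B0 co0"
    and "graded_part V \<zeta> \<theta> 0 = framed_levels.G0 m (\<lambda>i. r ((i + 0) mod m)) V B0 co0"
    and g10: "graded_part V \<zeta> \<theta> 1 = framed_levels.G1 m (\<lambda>i. r ((i + 0) mod m)) V B0 co0"
    by (rule multiplicities_frame[OF assms(1,2,4,5), of 0])
  note rank = graded_levels.theta_rank_le_levels[OF gl0 g10]
  have r1: "r i \<ge> 1" if "i < m" for i
    using rank(1)[OF that] that assms(7) by auto
  \<comment> \<open>A rank above 1 makes every multiplicity at least 2, so that any three
    consecutive levels serve.\<close>
  have "\<exists>i<m. r i \<ge> 2 \<and> r ((i + 1) mod m) \<ge> 2 \<and> r ((i + 2) mod m) \<ge> 2"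
  proof (cases "theta_rank V \<zeta> \<theta> > 1")
    case True
    then have "r i \<ge> 2" if "i < m" for i using rank(2)[OF that] that by simp
    then show ?thesis using m4 by (intro exI[of _ 0]) simp
  qed (use assms(7) in blast)
  then obtain i where i: "i < m" "r i \<ge> 2" "r ((i + 1) mod m) \<ge> 2" "r ((i + 2) mod m) \<ge> 2"
    by blast
  \<comment> \<open>The rotation by i + 2 moves the entries at i, i + 1, i + 2 to the levels m - 2,
    m - 1, 0, since m - 2 + (i + 2) is i modulo m.\<close>
  define r' where "r' = (\<lambda>j. r ((j + (i + 2)) mod m))"
  obtain B co where gl: "graded_levels m r' V B co"
    and g0: "graded_part V \<zeta> \<theta> 0 = framed_levels.G0 m r' V B co"
    and g1: "graded_part V \<zeta> \<theta> 1 = framed_levels.G1 m r' V B co"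
    unfolding r'_def by (rule multiplicities_frame[OF assms(1,2,4,5), of "i + 2"])
  define k where "k = Min (r' ` {..<m})"
  have ne: "r' ` {..<m} \<noteq> {}" using m4 by (simp add: lessThan_empty_iff)
  have fin: "finite (r' ` {..<m})" by simp
  have kr: "k \<le> r' j" if "j < m" for j
    unfolding k_def using that fin by (intro Min_le) auto
  obtain j0 where j0: "j0 < m" "k = r' j0"
    using Min_in[OF fin ne] unfolding k_def by auto
  have "bad_levels m r' k"
  proof (intro bad_levels.intro bad_levels_axioms.intro)
    show "levels m" using m4 by (intro levels.intro) simp
    show "4 \<le> m" by (rule m4)
    show "1 \<le> k" unfolding j0(2) r'_def using m4 by (intro r1) simp
    show "k \<le> r' j" if "j < m" for j by (rule kr[OF that])
    have e: "(m - 2 + (i + 2)) mod m = i" "(m - 1 + (i + 2)) mod m = (i + 1) mod m"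
    proof -
      have "m - 2 + (i + 2) = i + m" "m - 1 + (i + 2) = (i + 1) + m" using m4 by auto
      then show "(m - 2 + (i + 2)) mod m = i" "(m - 1 + (i + 2)) mod m = (i + 1) mod m"
        using i(1) by (simp_all only: mod_add_self2 mod_less)
    qed
    show "2 \<le> r' (m - 2)" "2 \<le> r' (m - 1)" "2 \<le> r' 0" using i e by (simp_all add: r'_def)
  qed
  then interpret bad_graded m r' V B co k by (intro bad_graded.intro gl)
  have "\<not> has_GIB G0 G1 (lie_bracket (gl V))"
  proof (rule no_GIB)
    show "j < k" if "\<forall>i<m. j < r' i" for j using that j0 by simp
  qed
  then show ?thesis unfolding theta_rep_has_GIB_def g0 g1 .
qed

end
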